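(* Let $V$ be a real vector space with lattice $\Lambda$, let $\mathfrak p_1,\dots,\mathfrak p_q$ be semi-rational polytopes in $V$, let $L\subseteq V$ be a rational subspace and $h$ a polynomial function on $V$. There exists a semi-quasi-polynomial function $E(t_1,\dots,t_q)$ on $\mathbb{R}^q$ such that for all $t_1\ge0,\dots,t_q\ge0$, $$S^L(t_1\mathfrak p_1+t_2\mathfrak p_2+\cdots+t_q\mathfrak p_q,h)=E(t_1,\dots,t_q),$$ where $+$ denotes Minkowski sum.
   Context: A subspace $L$ is rational if $L\cap\Lambda$ is a lattice in $L$; $\Lambda_{V/L}$ is the image of $\Lambda$ in $V/L$ and $y+L$ carries Lebesgue measure normalized by $L\cap\Lambda$. A polytope is semi-rational if each facet is parallel to a rational hyperplane. $S^L(\mathfrak p,h)=\sum_{y\in\Lambda_{V/L}}\int_{\mathfrak p\cap(y+L)}h(x)\,dx$. A semi-quasi-polynomial on $\mathbb{R}^q$ is an element of the algebra of functions generated by ordinary polynomials on $\mathbb{R}^q$ and the functions $t\mapsto\{\langle\eta,t\rangle\}$ for $\eta\in\mathbb{R}^q$, where $\{u\}\in[0,1)$ is the fractional part. *)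

theory Defs
  imports "HOL-Analysis.Analysis" "HOL-Library.Set_Algebras"
begin

definition lattice_basis :: "'a::euclidean_space set \<Rightarrow> 'a set \<Rightarrow> 'a set \<Rightarrow> bool" where
  "lattice_basis B \<Gamma> W \<longleftrightarrow>
     independent B \<and> span B = W \<and>
     \<Gamma> = range (\<lambda>c :: 'a \<Rightarrow> int. \<Sum>b\<in>B. of_int (c b) *\<^sub>R b)"

definition lattice_in :: "'a::euclidean_space set \<Rightarrow> 'a set \<Rightarrow> bool" where
  "lattice_in \<Gamma> W \<longleftrightarrow> (\<exists>B. lattice_basis B \<Gamma> W)"

definition rational_subspace :: "'a::euclidean_space set \<Rightarrow> 'a set \<Rightarrow> bool" where
  "rational_subspace \<Lambda> L \<longleftrightarrow> subspace L \<and> lattice_in (L \<inter> \<Lambda>) L"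

definition rational_hyperplane :: "'a::euclidean_space set \<Rightarrow> 'a set \<Rightarrow> bool" where
  "rational_hyperplane \<Lambda> H \<longleftrightarrow> rational_subspace \<Lambda> H \<and> dim H + 1 = DIM('a)"

text \<open>
  Polytopes need not be full-dimensional.  The direction \<open>W\<close> of the affine hull of \<open>P\<close> must be
  rational, and the hyperplanes bounding \<open>P\<close> inside its affine hull are cut out by rational
  hyperplanes; equivalently, \<open>P\<close> is a bounded intersection of finitely many closed half-spaces
  whose bounding hyperplanes have rational direction.  Without the condition on \<open>W\<close>, segments of
  irrational direction would be admitted, since their facets are points.  For full-dimensional
  \<open>P\<close> one has \<open>W = UNIV\<close>, see \<open>semi_rational_polytope_full_dim\<close> below.
\<close>

definition semi_rational_polytope :: "'a::euclidean_space set \<Rightarrow> 'a set \<Rightarrow> bool" where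
  "semi_rational_polytope \<Lambda> P \<longleftrightarrow>
     polytope P \<and>
     (P = {} \<or>
      (\<exists>W. rational_subspace \<Lambda> W \<and> affine_parallel (affine hull P) W \<and>
           (\<forall>F. F facet_of P \<longrightarrow>
                (\<exists>H. rational_hyperplane \<Lambda> H \<and> affine_parallel (affine hull F) (W \<inter> H)))))"

lemma semi_rational_polytope_full_dim:
  fixes P :: "'a::euclidean_space set"
  assumes "lattice_in \<Lambda> UNIV" and "polytope P" and "interior P \<noteq> {}"
  shows "semi_rational_polytope \<Lambda> P \<longleftrightarrow>
           (\<forall>F. F facet_of P \<longrightarrow>
                (\<exists>H. rational_hyperplane \<Lambda> H \<and> affine_parallel (affine hull F) H))"
proof -
  have aff: "affine hull P = UNIV"
    using assms(3) by (rule affine_hull_nonempty_interior)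
  have W: "affine_parallel (affine hull P) W \<longleftrightarrow> W = UNIV" for W
    unfolding aff affine_parallel_def by (simp add: surj_plus)
  have "rational_subspace \<Lambda> UNIV"
    using assms(1) by (simp add: rational_subspace_def)
  moreover have "P \<noteq> {}"
    using assms(3) by auto
  ultimately show ?thesis
    using assms(2) by (simp add: semi_rational_polytope_def W)
qed

text \<open>The lattice of \<open>V / L\<close>, with elements of \<open>V / L\<close> represented as cosets of \<open>L\<close> in \<open>V\<close>.\<close>

definition quotient_lattice :: "'a::euclidean_space set \<Rightarrow> 'a set \<Rightarrow> 'a set set" where
  "quotient_lattice \<Lambda> L = (\<lambda>v. {v} + L) ` \<Lambda>"

text \<open>
  Lebesgue measure on the coset \<open>Y\<close> of \<open>L\<close>, as a Borel measure on the whole space: the image of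
  the Lebesgue measure on coordinate space under an affine parametrization of \<open>Y\<close> by a basis of
  the lattice \<open>L \<inter> \<Lambda>\<close>.  Changing the basis (by a unimodular matrix) or the base point (by a
  translation in \<open>L\<close>) does not change the measure.  For \<open>L = {0}\<close> it is the unit point mass.
\<close>

definition coset_measure :: "'a::euclidean_space set \<Rightarrow> 'a set \<Rightarrow> 'a set \<Rightarrow> 'a measure" where
  "coset_measure \<Lambda> L Y =
     (let B = (SOME B. lattice_basis B (L \<inter> \<Lambda>) L);
          y = (SOME y. y \<in> Y)
      in distr (Pi\<^sub>M B (\<lambda>_. lborel)) borel (\<lambda>c. y + (\<Sum>b\<in>B. c b *\<^sub>R b)))"

text \<open>The sum has only finitely many nonzero terms when \<open>P\<close> is bounded.\<close>

definition intermediate_sum ::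
  "'a::euclidean_space set \<Rightarrow> 'a set \<Rightarrow> 'a set \<Rightarrow> ('a \<Rightarrow> real) \<Rightarrow> real" where
  "intermediate_sum \<Lambda> L P h =
     (\<Sum>\<^sub>\<infinity>Y\<in>quotient_lattice \<Lambda> L. LINT x:P \<inter> Y|coset_measure \<Lambda> L Y. h x)"

inductive semi_quasi_polynomial :: "('v::euclidean_space \<Rightarrow> real) \<Rightarrow> bool" where
  polynomial: "real_polynomial_function f \<Longrightarrow> semi_quasi_polynomial f"
| fractional_part: "semi_quasi_polynomial (\<lambda>t. frac (\<eta> \<bullet> t))"
| add: "semi_quasi_polynomial f \<Longrightarrow> semi_quasi_polynomial g \<Longrightarrow>
        semi_quasi_polynomial (\<lambda>t. f t + g t)"
| mult: "semi_quasi_polynomial f \<Longrightarrow> semi_quasi_polynomial g \<Longrightarrow>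
         semi_quasi_polynomial (\<lambda>t. f t * g t)"

end

theory Submission imports Defs begin

text \<open>
  In coordinates adapted to \<open>\<Lambda>\<close> and \<open>L\<close>, the intermediate sum is an integral over a product of counting
  measures (for \<open>\<Lambda> / L\<close>) and Lebesgue measures (for \<open>L\<close>), and the coordinates can be eliminated one by
  one, those of \<open>L\<close> first.  For positive \<open>t\<close>, the family \<open>\<Sum>i. t\<^sub>i p\<^sub>i\<close> is cut out by finitely many
  inequalities \<open>\<eta> \<bullet> t + \<kappa> \<bullet> x \<ge> 0\<close> with \<open>\<kappa>\<close> rational.  Over a point of its projection, the last coordinate
  runs from the maximum of some forms of this type to the minimum of others, so summation or integration
  replaces the integrand by a quasi-polynomial evaluated at these two envelopes.  By inclusion-exclusion
  over the forms that attain the envelope, this is an alternating sum of single forms restricted to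
  projections of faces of the family.  Since \<open>t\<close> is positive, a face is again a Minkowski family
  \<open>\<Sum>i. t\<^sub>i f\<^sub>i\<close> with \<open>f\<^sub>i\<close> a face of \<open>p\<^sub>i\<close> independent of \<open>t\<close>, and the argument can be iterated without ever
  subdividing the parameter space.  Rationality of \<open>\<kappa>\<close> keeps the fractional parts periodic in the
  summation variable.
\<close>

subsection \<open>Fourier--Motzkin elimination\<close>

text \<open>An envelope is only piecewise a form in t, and splitting the parameter space accordingly
  would give a separate formula on each chamber. This is avoided because the signs attached to the
  nonempty subsets of the attaining set sum to 1, while each term evaluates a form chosen in advance
  from its subset. That faces are Minkowski families rests on one fact: a sum of nonnegative terms
  with positive weights vanishes only if every term does. This confines the induction to the open
  orthant. The coordinates of L go first because eliminating a lattice coordinate creates fractional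
  parts, which are not polynomial in a real variable. The closed orthant cannot be reached by
  evaluating the resulting function on the boundary, where fractional parts may jump. A limit along
  a fixed direction from inside is taken instead; it stays in the class because the left limit of
  the fractional part at y is 1 - {-y}. An auxiliary cube makes the perturbed sums contain the
  unperturbed one, since otherwise lattice points on the boundary could be lost in the
  limit.\<close>

lemma between_finite_sets:
  fixes L U :: "real set"
  assumes "finite L" "finite U"
  shows "(\<exists>s. (\<forall>u\<in>U. s \<le> u) \<and> (\<forall>l\<in>L. l \<le> s)) \<longleftrightarrow> (\<forall>u\<in>U. \<forall>l\<in>L. l \<le> u)"
proof
  assume H: "\<forall>u\<in>U. \<forall>l\<in>L. l \<le> u"
  show "\<exists>s. (\<forall>u\<in>U. s \<le> u) \<and> (\<forall>l\<in>L. l \<le> s)"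
  proof (cases "L = {}")
    case True
    show ?thesis
    proof (cases "U = {}")
      case False
      then show ?thesis using True assms(2) by (intro exI[of _ "Min U"]) auto
    qed (use True in auto)
  next
    case False
    then show ?thesis using H assms(1) by (intro exI[of _ "Max L"]) auto
  qed
qed force

text \<open>The right-hand sides are functions of an abstract parameter, so that only the coefficients of
  the eliminated variables need to be rational.\<close>

lemma fourier_motzkin:
  fixes F :: "('p \<Rightarrow> real) set" and K :: "(('b \<Rightarrow> real) \<times> ('p \<Rightarrow> real)) set"
  assumes add: "\<And>f g. f \<in> F \<Longrightarrow> g \<in> F \<Longrightarrow> (\<lambda>\<tau>. f \<tau> + g \<tau>) \<in> F"
    and scale: "\<And>q f. q \<in> \<rat> \<Longrightarrow> f \<in> F \<Longrightarrow> (\<lambda>\<tau>. q * f \<tau>) \<in> F"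
    and "finite B" "finite K"
    and "\<And>w f. (w, f) \<in> K \<Longrightarrow> f \<in> F \<and> (\<forall>b. w b \<in> \<rat>)"
  shows "\<exists>G. finite G \<and> G \<subseteq> F \<and>
    (\<forall>\<tau>. (\<exists>z. \<forall>(w, f)\<in>K. (\<Sum>b\<in>B. w b * z b) \<le> f \<tau>) \<longleftrightarrow> (\<forall>g\<in>G. 0 \<le> g \<tau>))"
  using assms(3-)
proof (induction B arbitrary: K rule: finite_induct)
  case empty
  show ?case
    by (rule exI[of _ "snd ` K"]) (use empty in force)
next
  case (insert b B)
  define K0 where "K0 = {(w, f) \<in> K. w b = 0}"
  define Kp where "Kp = {(w, f) \<in> K. w b > 0}"
  define Kn where "Kn = {(w, f) \<in> K. w b < 0}"
  \<comment> \<open>Both rows are divided by the absolute value of their coefficient at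
    \<open>b\<close>, so that in the sum the two contributions of \<open>b\<close> cancel. The
    multipliers are rational, which keeps the coefficients rational and the right-hand sides in
    \<open>F\<close>.\<close>
  define comb :: "(('b \<Rightarrow> real) \<times> ('p \<Rightarrow> real)) \<times> (('b \<Rightarrow> real) \<times> ('p \<Rightarrow> real)) \<Rightarrow> _"
    where "comb = (\<lambda>((w, f), (v, g)). (\<lambda>c. (1 / w b) * w c + (- 1 / v b) * v c,
      \<lambda>\<tau>. (1 / w b) * f \<tau> + (- 1 / v b) * g \<tau>))"
  define K' where "K' = K0 \<union> comb ` (Kp \<times> Kn)"
  have sub: "K0 \<subseteq> K" "Kp \<subseteq> K" "Kn \<subseteq> K" by (auto simp: K0_def Kp_def Kn_def)
  then have fin: "finite K0" "finite Kp" "finite Kn"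
    using insert.prems(1) by (auto intro: finite_subset)
  have rat: "f \<in> F \<and> (\<forall>c. w c \<in> \<rat>)" if wf: "(w, f) \<in> K'" for w f
  proof (cases "(w, f) \<in> K0")
    case True
    then show ?thesis using insert.prems(2) sub by blast
  next
    case False
    then obtain w1 f1 w2 f2 where *: "(w1, f1) \<in> K" "(w2, f2) \<in> K"
      "w = (\<lambda>c. (1 / w1 b) * w1 c + (- 1 / w2 b) * w2 c)"
      "f = (\<lambda>\<tau>. (1 / w1 b) * f1 \<tau> + (- 1 / w2 b) * f2 \<tau>)"
    proof -
      from False wf have "(w, f) \<in> comb ` (Kp \<times> Kn)" by (auto simp: K'_def)
      then obtain w1 f1 w2 f2 where "(w1, f1) \<in> Kp" "(w2, f2) \<in> Kn" "(w, f) = comb ((w1, f1), (w2, f2))"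
        by auto
      then show thesis using that[of w1 f1 w2 f2] sub by (auto simp: comb_def)
    qed
    show ?thesis
      unfolding *(3,4) using insert.prems(2)[OF *(1)] insert.prems(2)[OF *(2)]
      by (intro conjI add scale allI Rats_add Rats_mult Rats_divide) auto
  qed
  have "finite K'" using fin by (auto simp: K'_def)
  from insert.IH[OF this rat] obtain G where G: "finite G" "G \<subseteq> F"
    "\<And>\<tau>. (\<exists>z. \<forall>(w, f)\<in>K'. (\<Sum>b\<in>B. w b * z b) \<le> f \<tau>) \<longleftrightarrow> (\<forall>g\<in>G. 0 \<le> g \<tau>)"
    by auto
  have "(\<exists>z. \<forall>(w, f)\<in>K. (\<Sum>c\<in>insert b B. w c * z c) \<le> f \<tau>) \<longleftrightarrow>
        (\<exists>z. \<forall>(w, f)\<in>K'. (\<Sum>c\<in>B. w c * z c) \<le> f \<tau>)" for \<tau>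
  proof -
    have split: "(\<Sum>c\<in>insert b B. w c * (z(b := s)) c) = w b * s + (\<Sum>c\<in>B. w c * z c)"
      for w z :: "'b \<Rightarrow> real" and s
    proof -
      have "(\<Sum>c\<in>B. w c * (z(b := s)) c) = (\<Sum>c\<in>B. w c * z c)"
        by (rule sum.cong) (use insert.hyps in auto)
      then show ?thesis using insert.hyps by (simp add: sum.insert del: fun_upd_apply) simp
    qed
    have "(\<exists>z. \<forall>(w, f)\<in>K. (\<Sum>c\<in>insert b B. w c * z c) \<le> f \<tau>) \<longleftrightarrow>
        (\<exists>z s. \<forall>(w, f)\<in>K. w b * s + (\<Sum>c\<in>B. w c * z c) \<le> f \<tau>)"
    proof safe
      fix z assume "\<forall>(w, f)\<in>K. (\<Sum>c\<in>insert b B. w c * z c) \<le> f \<tau>"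
      then show "\<exists>z s. \<forall>(w, f)\<in>K. w b * s + (\<Sum>c\<in>B. w c * z c) \<le> f \<tau>"
        using insert.hyps by (intro exI[of _ z] exI[of _ "z b"]) simp
    next
      fix z s assume "\<forall>(w, f)\<in>K. w b * s + (\<Sum>c\<in>B. w c * z c) \<le> f \<tau>"
      then show "\<exists>z. \<forall>(w, f)\<in>K. (\<Sum>c\<in>insert b B. w c * z c) \<le> f \<tau>"
        by (intro exI[of _ "z(b := s)"]) (simp only: split)
    qed
    also have "\<dots> \<longleftrightarrow> (\<exists>z. \<forall>(w, f)\<in>K'. (\<Sum>c\<in>B. w c * z c) \<le> f \<tau>)"
    proof (rule ex_cong1)
      fix z
      let ?S = "\<lambda>w :: 'b \<Rightarrow> real. \<Sum>c\<in>B. w c * z c"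
      \<comment> \<open>With the other variables fixed, the rows in \<open>Kp\<close> bound the
        eliminated value from above and those in \<open>Kn\<close> from below. A value exists iff no
        lower bound exceeds an upper bound, and these comparisons are exactly the combined
        rows.\<close>
      let ?U = "(\<lambda>(w, f). (f \<tau> - ?S w) / w b) ` Kp"
      let ?L = "(\<lambda>(w, f). (f \<tau> - ?S w) / w b) ` Kn"
      have lin: "?S (fst (comb (p, q))) = ?S (fst p) / fst p b - ?S (fst q) / fst q b" for p q
        by (auto simp: comb_def split_def algebra_simps sum.distrib sum_divide_distrib sum_subtractf sum_negf)
      have K: "K = K0 \<union> Kp \<union> Kn" by (auto simp: K0_def Kp_def Kn_def)
      have "(\<forall>(w, f)\<in>K. w b * s + ?S w \<le> f \<tau>) \<longleftrightarrow>
         (\<forall>(w, f)\<in>K0. ?S w \<le> f \<tau>) \<and> (\<forall>u\<in>?U. s \<le> u) \<and> (\<forall>l\<in>?L. l \<le> s)" for s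
      proof -
        have "(\<forall>(w, f)\<in>K0. w b * s + ?S w \<le> f \<tau>) \<longleftrightarrow> (\<forall>(w, f)\<in>K0. ?S w \<le> f \<tau>)"
          by (rule ball_cong) (auto simp: K0_def)
        moreover have "(\<forall>(w, f)\<in>Kp. w b * s + ?S w \<le> f \<tau>) \<longleftrightarrow> (\<forall>u\<in>?U. s \<le> u)"
          unfolding ball_simps by (rule ball_cong) (auto simp: Kp_def field_simps)
        moreover have "(\<forall>(w, f)\<in>Kn. w b * s + ?S w \<le> f \<tau>) \<longleftrightarrow> (\<forall>l\<in>?L. l \<le> s)"
          unfolding ball_simps by (rule ball_cong) (auto simp: Kn_def field_simps)
        ultimately show ?thesis unfolding K ball_Un by blast
      qed
      then have "(\<exists>s. \<forall>(w, f)\<in>K. w b * s + ?S w \<le> f \<tau>) \<longleftrightarrow>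
        (\<forall>(w, f)\<in>K0. ?S w \<le> f \<tau>) \<and> (\<forall>u\<in>?U. \<forall>l\<in>?L. l \<le> u)"
        using between_finite_sets[of ?L ?U] fin by auto
      also have "\<dots> \<longleftrightarrow> (\<forall>(w, f)\<in>K0. ?S w \<le> f \<tau>) \<and> (\<forall>p\<in>Kp. \<forall>q\<in>Kn.
          (snd q \<tau> - ?S (fst q)) / fst q b \<le> (snd p \<tau> - ?S (fst p)) / fst p b)"
        by (simp add: split_def)
      also have "\<dots> \<longleftrightarrow> (\<forall>(w, f)\<in>K0. ?S w \<le> f \<tau>) \<and>
          (\<forall>p\<in>Kp. \<forall>q\<in>Kn. ?S (fst (comb (p, q))) \<le> snd (comb (p, q)) \<tau>)"
      proof -
        have "(snd q \<tau> - ?S (fst q)) / fst q b \<le> (snd p \<tau> - ?S (fst p)) / fst p b \<longleftrightarrow>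
          ?S (fst (comb (p, q))) \<le> snd (comb (p, q)) \<tau>" for p q
          unfolding lin by (simp add: comb_def split_def diff_divide_distrib) linarith
        then show ?thesis by simp
      qed
      finally show "(\<exists>s. \<forall>(w, f)\<in>K. w b * s + ?S w \<le> f \<tau>) \<longleftrightarrow> (\<forall>(w, f)\<in>K'. ?S w \<le> f \<tau>)"
        by (auto simp: K'_def split_def ball_Un)
    qed
    finally show ?thesis .
  qed
  with G show ?case by auto
qed

subsection \<open>Quasi-polynomials with rational dependence on the lattice coordinates\<close>

text \<open>Only the coefficients of the coordinates and the constant are rational;
  \<open>\<eta>\<close> is an arbitrary real vector. The constant is there to absorb the rational
  shifts caused by splitting into residue classes.\<close>

definition rational_form ::
  "nat \<Rightarrow> ('e::euclidean_space \<Rightarrow> (nat \<Rightarrow> real) \<Rightarrow> real) \<Rightarrow> bool" where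
  "rational_form n \<phi> \<longleftrightarrow> (\<exists>\<eta> \<kappa> q. (\<forall>j. \<kappa> j \<in> \<rat>) \<and> q \<in> \<rat> \<and>
     \<phi> = (\<lambda>t x. \<eta> \<bullet> t + (\<Sum>j<n. \<kappa> j * x j) + q))"

text \<open>Functions of a parameter and of coordinates \<open>x 0, \<dots>, x (n - 1)\<close>, of which those with index
  below \<open>k\<close> run over the integers and the others over the reals.  Fractional parts only occur
  once the real coordinates have been eliminated.\<close>

inductive qpoly ::
  "nat \<Rightarrow> nat \<Rightarrow> ('e::euclidean_space \<Rightarrow> (nat \<Rightarrow> real) \<Rightarrow> real) \<Rightarrow> bool" for k n where
  const: "qpoly k n (\<lambda>t x. c)"
| form: "rational_form n \<phi> \<Longrightarrow> qpoly k n \<phi>"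
| frac: "n \<le> k \<Longrightarrow> rational_form n \<phi> \<Longrightarrow> qpoly k n (\<lambda>t x. frac (\<phi> t x))"
| add: "qpoly k n f \<Longrightarrow> qpoly k n g \<Longrightarrow> qpoly k n (\<lambda>t x. f t x + g t x)"
| mult: "qpoly k n f \<Longrightarrow> qpoly k n g \<Longrightarrow> qpoly k n (\<lambda>t x. f t x * g t x)"

lemma rational_form_add:
  assumes "rational_form n \<phi>" "rational_form n \<psi>"
  shows "rational_form n (\<lambda>t x. \<phi> t x + \<psi> t x)"
proof -
  from assms obtain \<eta> \<kappa> q \<eta>' \<kappa>' q' where "\<forall>j. \<kappa> j \<in> \<rat>" "q \<in> \<rat>" "\<forall>j. \<kappa>' j \<in> \<rat>" "q' \<in> \<rat>"
    "\<phi> = (\<lambda>t x. \<eta> \<bullet> t + (\<Sum>j<n. \<kappa> j * x j) + q)"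
    "\<psi> = (\<lambda>t x. \<eta>' \<bullet> t + (\<Sum>j<n. \<kappa>' j * x j) + q')"
    unfolding rational_form_def by blast
  then show ?thesis
    unfolding rational_form_def
    by (intro exI[of _ "\<eta> + \<eta>'"] exI[of _ "\<lambda>j. \<kappa> j + \<kappa>' j"] exI[of _ "q + q'"])
       (auto simp: inner_add_left sum.distrib algebra_simps)
qed

lemma rational_form_scale:
  assumes "rational_form n \<phi>" "c \<in> \<rat>"
  shows "rational_form n (\<lambda>t x. c * \<phi> t x)"
proof -
  from assms obtain \<eta> \<kappa> q where "\<forall>j. \<kappa> j \<in> \<rat>" "q \<in> \<rat>"
    "\<phi> = (\<lambda>t x. \<eta> \<bullet> t + (\<Sum>j<n. \<kappa> j * x j) + q)"
    unfolding rational_form_def by blast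
  then show ?thesis
    unfolding rational_form_def using assms(2)
    by (intro exI[of _ "c *\<^sub>R \<eta>"] exI[of _ "\<lambda>j. c * \<kappa> j"] exI[of _ "c * q"])
       (auto simp: sum_distrib_left algebra_simps)
qed

lemma rational_form_const: "q \<in> \<rat> \<Longrightarrow> rational_form n (\<lambda>t x. q)"
  unfolding rational_form_def by (intro exI[of _ 0] exI[of _ "\<lambda>_. 0"] exI[of _ q]) auto

lemma rational_form_Suc:
  assumes "rational_form (Suc n) \<phi>"
  obtains \<psi> \<kappa> where "rational_form n \<psi>" "\<kappa> \<in> \<rat>"
    "\<And>t x s. \<phi> t (x(n := s)) = \<psi> t x + \<kappa> * s"
proof -
  from assms obtain \<eta> \<kappa> q where *: "\<forall>j. \<kappa> j \<in> \<rat>" "q \<in> \<rat>"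
    "\<phi> = (\<lambda>t x. \<eta> \<bullet> t + (\<Sum>j<Suc n. \<kappa> j * x j) + q)"
    unfolding rational_form_def by blast
  have "(\<Sum>j<n. \<kappa> j * (x(n := s)) j) = (\<Sum>j<n. \<kappa> j * x j)" for x s
    by (rule sum.cong) auto
  then show ?thesis
    using * by (intro that[of "\<lambda>t x. \<eta> \<bullet> t + (\<Sum>j<n. \<kappa> j * x j) + q" "\<kappa> n"])
      (auto simp: rational_form_def)
qed

lemma qpoly_sum:
  "finite I \<Longrightarrow> (\<And>i. i \<in> I \<Longrightarrow> qpoly k n (f i)) \<Longrightarrow> qpoly k n (\<lambda>t x. \<Sum>i\<in>I. f i t x)"
proof (induction I rule: finite_induct)
  case empty
  show ?case using qpoly.const[of k n 0] by simp
next
  case (insert i I)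
  then show ?case using qpoly.add[of k n "f i" "\<lambda>t x. \<Sum>i\<in>I. f i t x"] by simp
qed

lemma qpoly_uminus: "qpoly k n f \<Longrightarrow> qpoly k n (\<lambda>t x. - f t x)"
  using qpoly.mult[OF qpoly.const[of k n "-1"]] by simp

lemma qpoly_scale: "qpoly k n f \<Longrightarrow> qpoly k n (\<lambda>t x. c * f t x)"
  by (rule qpoly.mult[OF qpoly.const])

lemma qpoly_floor:
  assumes "n \<le> k" "rational_form n \<phi>"
  shows "qpoly k n (\<lambda>t x. of_int \<lfloor>\<phi> t x\<rfloor>)"
  using qpoly.add[OF qpoly.form[OF assms(2)] qpoly_uminus[OF qpoly.frac[OF assms]]]
  by (simp add: frac_def)

text \<open>Polynomials in a distinguished variable \<open>s\<close> over the ring of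
  \<open>qpoly\<close> functions. Keeping \<open>s\<close> separate allows an antiderivative or
  antidifference in \<open>s\<close> to be evaluated later at any \<open>qpoly\<close>
  function.\<close>

inductive var_poly ::
  "nat \<Rightarrow> nat \<Rightarrow> ('e::euclidean_space \<Rightarrow> (nat \<Rightarrow> real) \<Rightarrow> real \<Rightarrow> real) \<Rightarrow> bool" for k n where
  monom: "qpoly k n a \<Longrightarrow> var_poly k n (\<lambda>t x s. a t x * s ^ e)"
| add: "var_poly k n f \<Longrightarrow> var_poly k n g \<Longrightarrow> var_poly k n (\<lambda>t x s. f t x s + g t x s)"

lemma var_poly_coeff: "qpoly k n a \<Longrightarrow> var_poly k n (\<lambda>t x s. a t x)"
  using var_poly.monom[of k n a 0] by simp

lemma var_poly_coeff_mult:
  assumes "var_poly k n f" "qpoly k n a"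
  shows "var_poly k n (\<lambda>t x s. a t x * f t x s)"
  using assms
proof (induction rule: var_poly.induct)
  case (monom b e)
  then show ?case
    using var_poly.monom[OF qpoly.mult[OF monom(2) monom(1)], of e] by (simp add: mult.assoc)
next
  case (add f g)
  then show ?case
    using var_poly.add[OF add.IH(1)[OF add.prems] add.IH(2)[OF add.prems]]
    by (simp add: distrib_left)
qed

lemma var_poly_mult:
  assumes "var_poly k n f" "var_poly k n g"
  shows "var_poly k n (\<lambda>t x s. f t x s * g t x s)"
  using assms
proof (induction rule: var_poly.induct)
  case (monom a e)
  from monom(2) show ?case
  proof (induction rule: var_poly.induct)
    case (monom b e')
    then show ?case
      using var_poly.monom[OF qpoly.mult[OF \<open>qpoly k n a\<close> monom(1)], of "e + e'"]
      by (simp add: power_add mult_ac)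
  next
    case (add f g)
    then show ?case using var_poly.add[OF add.IH] by (simp add: distrib_left)
  qed
next
  case (add f h)
  then show ?case
    using var_poly.add[OF add.IH(1)[OF add.prems] add.IH(2)[OF add.prems]]
    by (simp add: distrib_right)
qed

lemma var_poly_sum:
  "finite I \<Longrightarrow> (\<And>i. i \<in> I \<Longrightarrow> var_poly k n (f i)) \<Longrightarrow>
    var_poly k n (\<lambda>t x s. \<Sum>i\<in>I. f i t x s)"
proof (induction I rule: finite_induct)
  case empty
  show ?case using var_poly_coeff[OF qpoly.const[of k n 0]] by simp
next
  case (insert i I)
  then show ?case using var_poly.add[of k n "f i" "\<lambda>t x s. \<Sum>i\<in>I. f i t x s"] by simp
qed

lemma var_poly_scale: "var_poly k n f \<Longrightarrow> var_poly k n (\<lambda>t x s. c * f t x s)"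
  by (rule var_poly_coeff_mult[OF _ qpoly.const])

lemma var_poly_dilate:
  assumes "var_poly k n f"
  shows "var_poly k n (\<lambda>t x s. f t x (c * s))"
  using assms
proof (induction rule: var_poly.induct)
  case (monom a e)
  then show ?case
    using var_poly.monom[OF qpoly.mult[OF monom qpoly.const[of k n "c ^ e"]], of e]
    by (simp add: power_mult_distrib mult.assoc)
qed (rule var_poly.add)

lemma qpoly_subst:
  assumes "var_poly k n f" "qpoly k n \<sigma>"
  shows "qpoly k n (\<lambda>t x. f t x (\<sigma> t x))"
  using assms
proof (induction rule: var_poly.induct)
  case (monom a e)
  have "qpoly k n (\<lambda>t x. \<sigma> t x ^ e)"
    by (induction e) (auto intro: qpoly.const qpoly.mult monom)
  with monom show ?case by (auto intro: qpoly.mult)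
next
  case (add f g)
  then show ?case by (auto intro: qpoly.add)
qed

lemma qpoly_real_variable:
  assumes "qpoly k (Suc n) f" "k \<le> n"
  shows "\<exists>g. var_poly k n g \<and> (\<forall>t x s. f t (x(n := s)) = g t x s)"
  using assms
proof (induction rule: qpoly.induct)
  case (const c)
  show ?case using var_poly_coeff[OF qpoly.const] by fastforce
next
  case (form \<phi>)
  obtain \<psi> \<kappa> where *: "rational_form n \<psi>" "\<kappa> \<in> \<rat>"
    "\<And>t x s. \<phi> t (x(n := s)) = \<psi> t x + \<kappa> * s" by (rule rational_form_Suc[OF form(1)]) (rule that)
  have "var_poly k n (\<lambda>t x s. \<psi> t x + \<kappa> * s ^ 1)"
    by (intro var_poly.add var_poly_coeff var_poly.monom qpoly.form qpoly.const *)
  then show ?case using *(3) by (intro exI[of _ "\<lambda>t x s. \<psi> t x + \<kappa> * s ^ 1"]) (simp del: fun_upd_apply)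
next
  case (frac \<phi>)
  then show ?case by simp
next
  case (add f g)
  then obtain f' g' where *: "var_poly k n f'" "var_poly k n g'"
    "\<forall>t x s. f t (x(n := s)) = f' t x s" "\<forall>t x s. g t (x(n := s)) = g' t x s" by blast
  show ?case using var_poly.add[OF *(1,2)] *(3,4)
    by (intro exI[of _ "\<lambda>t x s. f' t x s + g' t x s"]) (simp del: fun_upd_apply)
next
  case (mult f g)
  then obtain f' g' where *: "var_poly k n f'" "var_poly k n g'"
    "\<forall>t x s. f t (x(n := s)) = f' t x s" "\<forall>t x s. g t (x(n := s)) = g' t x s" by blast
  show ?case using var_poly_mult[OF *(1,2)] *(3,4)
    by (intro exI[of _ "\<lambda>t x s. f' t x s * g' t x s"]) (simp del: fun_upd_apply)
qed

text \<open>Polynomial behaviour on each residue class modulo \<open>N\<close>. The offset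
  \<open>r\<close> runs over all naturals, not only those below \<open>N\<close>, so that a multiple
  of \<open>N\<close> can be handled with the same offset.\<close>

definition periodic_poly ::
  "nat \<Rightarrow> nat \<Rightarrow> nat \<Rightarrow> ('e::euclidean_space \<Rightarrow> (nat \<Rightarrow> real) \<Rightarrow> real) \<Rightarrow> bool" where
  "periodic_poly k n N f \<longleftrightarrow> (\<forall>r::nat. \<exists>g. var_poly k n g \<and>
     (\<forall>t x. \<forall>z::int. f t (x(n := of_nat N * of_int z + of_nat r)) = g t x (of_int z)))"

lemma periodic_poly_multiple:
  assumes "periodic_poly k n N f"
  shows "periodic_poly k n (N * M) f"
  unfolding periodic_poly_def
proof
  fix r
  from assms obtain g where g: "var_poly k n g"
    "\<And>t x z. f t (x(n := of_nat N * of_int z + of_nat r)) = g t x (of_int z)"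
    unfolding periodic_poly_def by blast
  have "f t (x(n := of_nat (N * M) * of_int z + of_nat r)) = g t x (of_nat M * of_int z)" for t x z
    using g(2)[where z = "int M * z"] by (simp add: mult.assoc)
  then show "\<exists>g. var_poly k n g \<and>
     (\<forall>t x. \<forall>z::int. f t (x(n := of_nat (N * M) * of_int z + of_nat r)) = g t x (of_int z))"
    using var_poly_dilate[OF g(1)] by (intro exI[of _ "\<lambda>t x s. g t x (of_nat M * s)"]) auto
qed

text \<open>If the last coordinate has coefficient a / b in a form, advancing it by b changes the
  form by the integer a and leaves the fractional part unchanged. So b is a period, and for sums and
  products the product of the two periods works.\<close>

lemma qpoly_integer_variable:
  assumes "qpoly k (Suc n) f" "n < k"
  shows "\<exists>N>0. periodic_poly k n N f"
  using assms
proof (induction rule: qpoly.induct)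
  case (const c)
  show ?case
    unfolding periodic_poly_def
    by (intro exI[of _ 1] conjI allI exI[of _ "\<lambda>t x s. c"] var_poly_coeff qpoly.const) auto
next
  case (form \<phi>)
  obtain \<psi> \<kappa> where *: "rational_form n \<psi>" "\<kappa> \<in> \<rat>"
    "\<And>t x s. \<phi> t (x(n := s)) = \<psi> t x + \<kappa> * s" by (rule rational_form_Suc[OF form(1)]) (rule that)
  have "var_poly k n (\<lambda>t x s. (\<psi> t x + \<kappa> * of_nat r) + \<kappa> * s ^ 1)" for r
    by (intro var_poly.add var_poly_coeff var_poly.monom qpoly.form qpoly.const
        rational_form_add rational_form_const *(1)) (use * in auto)
  then show ?case
    unfolding periodic_poly_def
    by (intro exI[of _ 1] conjI allI exI[of _ "\<lambda>t x s. (\<psi> t x + \<kappa> * of_nat r) + \<kappa> * s ^ 1" for r])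
       (auto simp: * algebra_simps)
next
  case (frac \<phi>)
  obtain \<psi> \<kappa> where *: "rational_form n \<psi>" "\<kappa> \<in> \<rat>"
    "\<And>t x s. \<phi> t (x(n := s)) = \<psi> t x + \<kappa> * s" by (rule rational_form_Suc[OF frac(2)]) (rule that)
  obtain a b where ab: "\<kappa> = of_int a / of_int b" "b > 0"
    using *(2) by (metis Rats_cases')
  have "frac (\<phi> t (x(n := of_nat (nat b) * of_int z + of_nat r))) = frac (\<psi> t x + \<kappa> * of_nat r)"
    for t x z and r :: nat
  proof -
    have "\<phi> t (x(n := of_nat (nat b) * of_int z + of_nat r)) = (\<psi> t x + \<kappa> * of_nat r) + of_int (a * z)"
      using ab by (simp add: * field_simps)
    then show ?thesis by (simp only: frac_add_of_int_right) 
  qed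
  moreover have "var_poly k n (\<lambda>t x s. frac (\<psi> t x + \<kappa> * of_nat r))" for r :: nat
    by (intro var_poly_coeff qpoly.frac rational_form_add rational_form_const *(1))
       (use * frac in auto)
  ultimately show ?case
    unfolding periodic_poly_def using ab(2) by (intro exI[of _ "nat b"]) fastforce
next
  case (add f g)
  then obtain N M where NM: "N > 0" "M > 0" "periodic_poly k n N f" "periodic_poly k n M g" by auto
  have "periodic_poly k n (N * M) f" "periodic_poly k n (N * M) g"
    using periodic_poly_multiple[OF NM(3), of M] periodic_poly_multiple[OF NM(4), of N]
    by (simp_all only: mult.commute)
  then have "periodic_poly k n (N * M) (\<lambda>t x. f t x + g t x)"
    unfolding periodic_poly_def by (metis (no_types, lifting) var_poly.add)
  then show ?case using NM by (intro exI[of _ "N * M"]) simp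
next
  case (mult f g)
  then obtain N M where NM: "N > 0" "M > 0" "periodic_poly k n N f" "periodic_poly k n M g" by auto
  have "periodic_poly k n (N * M) f" "periodic_poly k n (N * M) g"
    using periodic_poly_multiple[OF NM(3), of M] periodic_poly_multiple[OF NM(4), of N]
    by (simp_all only: mult.commute)
  then have "periodic_poly k n (N * M) (\<lambda>t x. f t x * g t x)"
    unfolding periodic_poly_def by (metis (no_types, lifting) var_poly_mult)
  then show ?case using NM by (intro exI[of _ "N * M"]) simp
qed

text \<open>By strong induction on the degree: (s + 1)^(e + 1) - s^(e + 1) is (e + 1) s^e plus lower
  powers, whose antidifferences are already known and are subtracted.\<close>

lemma var_poly_antidifference:
  assumes "var_poly k n g"
  shows "\<exists>G. var_poly k n G \<and> (\<forall>t x s. G t x (s + 1) - G t x s = g t x s)"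
  using assms
proof (induction rule: var_poly.induct)
  case (monom a e)
  then show ?case
  proof (induction e arbitrary: a rule: less_induct)
    case (less e)
    then have "\<forall>i\<in>{..<e}. \<exists>G. var_poly k n G \<and> (\<forall>t x s. G t x (s + 1) - G t x s = a t x * s ^ i)"
      by auto
    then obtain G where G: "\<And>i. i < e \<Longrightarrow> var_poly k n (G i)"
      "\<And>i t x s. i < e \<Longrightarrow> G i t x (s + 1) - G i t x s = a t x * s ^ i"
      unfolding lessThan_iff Ball_def by metis
    define H where "H = (\<lambda>t x s. 1 / of_nat (Suc e) *
      (a t x * s ^ Suc e + (\<Sum>i<e. (- of_nat (Suc e choose i)) * G i t x s)))"
    have "var_poly k n H"
      unfolding H_def
      by (intro var_poly_scale var_poly.add var_poly.monom var_poly_sum less G) auto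
    moreover have "H t x (s + 1) - H t x s = a t x * s ^ e" for t x s
    proof -
      have "(s + 1) ^ Suc e = (\<Sum>i\<le>Suc e. of_nat (Suc e choose i) * s ^ i)"
        by (simp only: binomial_ring power_one mult_1_right)
      also have "{..Suc e} = insert (Suc e) (insert e {..<e})" by auto
      finally have bin: "(s + 1) ^ Suc e =
          s ^ Suc e + of_nat (Suc e) * s ^ e + (\<Sum>i<e. of_nat (Suc e choose i) * s ^ i)"
        by simp
      have "of_nat (Suc e) * (H t x (s + 1) - H t x s) = a t x * ((s + 1) ^ Suc e - s ^ Suc e)
          - (\<Sum>i<e. of_nat (Suc e choose i) * (G i t x (s + 1) - G i t x s))"
        unfolding H_def by (simp add: field_simps sum_subtractf sum_negf del: power_Suc of_nat_Suc)
      also have "(\<Sum>i<e. of_nat (Suc e choose i) * (G i t x (s + 1) - G i t x s))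
          = a t x * (\<Sum>i<e. of_nat (Suc e choose i) * s ^ i)"
        by (simp add: G(2) sum_distrib_left mult_ac)
      finally have "of_nat (Suc e) * (H t x (s + 1) - H t x s) = of_nat (Suc e) * (a t x * s ^ e)"
        unfolding bin by (simp add: algebra_simps del: power_Suc of_nat_Suc)
      then show ?thesis by (simp del: of_nat_Suc)
    qed
    ultimately show ?case by blast
  qed
next
  case (add f g)
  then obtain F G where *: "var_poly k n F" "var_poly k n G"
    "\<forall>t x s. F t x (s + 1) - F t x s = f t x s" "\<forall>t x s. G t x (s + 1) - G t x s = g t x s"
    by auto
  show ?case
    using var_poly.add[OF *(1,2)] *(3,4)
    by (intro exI[of _ "\<lambda>t x s. F t x s + G t x s"]) (auto simp: algebra_simps)
qed

section \<open>Integration and summation over a single coordinate\<close>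

definition coord_measure :: "nat \<Rightarrow> nat \<Rightarrow> real measure" where
  "coord_measure k j = (if j < k then count_space \<int> else lborel)"

lemma has_integral_var_poly:
  assumes "var_poly k n g"
  shows "\<exists>G. var_poly k n G \<and> (\<forall>t x l r. l \<le> r \<longrightarrow>
    has_bochner_integral lborel (\<lambda>s. g t x s * indicator {l..r} s) (G t x r - G t x l))"
  using assms
proof (induction rule: var_poly.induct)
  case (monom a e)
  define G where "G = (\<lambda>t x s. (1 / of_nat (Suc e)) * (a t x * s ^ Suc e))"
  have "var_poly k n G"
    unfolding G_def by (intro var_poly_scale var_poly.monom monom)
  moreover have "has_bochner_integral lborel (\<lambda>s. a t x * s ^ e * indicator {l..r} s)
      (G t x r - G t x l)" if "l \<le> r" for t x and l r :: real
  proof -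
    have "has_bochner_integral lborel (\<lambda>s. s ^ e * indicator {l..r} s)
        ((r ^ Suc e - l ^ Suc e) / of_nat (Suc e))"
    proof -
      have "((\<lambda>s. s ^ Suc e / of_nat (Suc e)) has_real_derivative s ^ e) (at s)" for s :: real
        by (rule derivative_eq_intros refl | simp del: of_nat_Suc)+
      from has_bochner_integral_FTC_Icc_real[OF that this] show ?thesis
        by (simp add: diff_divide_distrib)
    qed
    then have "has_bochner_integral lborel (\<lambda>s. a t x * (s ^ e * indicator {l..r} s))
        (a t x * ((r ^ Suc e - l ^ Suc e) / of_nat (Suc e)))"
      by (rule has_bochner_integral_mult_right)
    then show ?thesis by (simp add: G_def field_simps del: of_nat_Suc)
  qed
  ultimately show ?case by blast
next
  case (add f g)
  then obtain F G where *: "var_poly k n F" "var_poly k n G"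
    "\<And>t x l r. l \<le> r \<Longrightarrow>
      has_bochner_integral lborel (\<lambda>s. f t x s * indicator {l..r} s) (F t x r - F t x l)"
    "\<And>t x l r. l \<le> r \<Longrightarrow>
      has_bochner_integral lborel (\<lambda>s. g t x s * indicator {l..r} s) (G t x r - G t x l)"
    by blast
  have "has_bochner_integral lborel (\<lambda>s. (f t x s + g t x s) * indicator {l..r} s)
     ((F t x r + G t x r) - (F t x l + G t x l))" if "l \<le> r" for t x l r
    using has_bochner_integral_add[OF *(3,4)[OF that]] by (simp add: algebra_simps)
  then show ?case
    using var_poly.add[OF *(1,2)] by (intro exI[of _ "\<lambda>t x s. F t x s + G t x s"]) simp
qed

lemma sum_int_telescope:
  fixes H :: "int \<Rightarrow> real"
  assumes "a \<le> c"
  shows "(\<Sum>z\<in>{a..c - 1}. H (z + 1) - H z) = H c - H a"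
  using assms
proof (induction c rule: int_ge_induct)
  case (step i)
  then have "{a..(i + 1) - 1} = insert i {a..i - 1}" by auto
  with step show ?case by simp
qed simp

lemma integral_count_space_Ints:
  fixes f :: "real \<Rightarrow> real"
  shows "(\<integral>s. f s * indicator {l..r} s \<partial>count_space \<int>) = (\<Sum>m\<in>{\<lceil>l\<rceil>..\<lfloor>r\<rfloor>}. f (of_int m))"
proof -
  have *: "{s\<in>\<int>. f s * indicator {l..r} s \<noteq> 0} \<subseteq> of_int ` {\<lceil>l\<rceil>..\<lfloor>r\<rfloor>}"
    by (auto elim!: Ints_cases simp: ceiling_le_iff le_floor_iff indicator_def split: if_splits)
  have "(\<integral>s. f s * indicator {l..r} s \<partial>count_space \<int>) =
      (\<Sum>s | s \<in> \<int> \<and> f s * indicator {l..r} s \<noteq> 0. f s * indicator {l..r} s)"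
    by (rule lebesgue_integral_count_space_finite_support) (rule finite_subset[OF *], auto)
  also have "\<dots> = (\<Sum>s\<in>of_int ` {\<lceil>l\<rceil>..\<lfloor>r\<rfloor>}. f s * indicator {l..r} s)"
    by (rule sum.mono_neutral_left) (use * in auto)
  also have "\<dots> = (\<Sum>m\<in>{\<lceil>l\<rceil>..\<lfloor>r\<rfloor>}. f (of_int m) * indicator {l..r} (of_int m))"
    by (subst sum.reindex) (auto simp: inj_on_def)
  also have "\<dots> = (\<Sum>m\<in>{\<lceil>l\<rceil>..\<lfloor>r\<rfloor>}. f (of_int m))"
    by (rule sum.cong) (auto simp: indicator_def ceiling_le_iff le_floor_iff)
  finally show ?thesis .
qed

text \<open>Division with remainder m = N z + \<rho>; solving l \<le> N z + \<rho> \<le> r for z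
  gives the ranges on the right.\<close>

lemma sum_residue_classes:
  fixes F :: "int \<Rightarrow> real" and l r :: real
  assumes "N > 0"
  shows "(\<Sum>m\<in>{\<lceil>l\<rceil>..\<lfloor>r\<rfloor>}. F m) =
    (\<Sum>\<rho><N. \<Sum>z\<in>{\<lceil>(l - real \<rho>) / real N\<rceil>..\<lfloor>(r - real \<rho>) / real N\<rfloor>}. F (int N * z + int \<rho>))"
proof -
  let ?Z = "\<lambda>\<rho>. {\<lceil>(l - real \<rho>) / real N\<rceil>..\<lfloor>(r - real \<rho>) / real N\<rfloor>}"
  have Z: "z \<in> ?Z \<rho> \<longleftrightarrow> int N * z + int \<rho> \<in> {\<lceil>l\<rceil>..\<lfloor>r\<rfloor>}" for z \<rho>
    using assms by (simp add: ceiling_le_iff le_floor_iff field_simps)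
  have "(\<Sum>m\<in>{\<lceil>l\<rceil>..\<lfloor>r\<rfloor>}. F m) = (\<Sum>(\<rho>, z)\<in>Sigma {..<N} ?Z. F (int N * z + int \<rho>))"
  proof (rule sum.reindex_bij_witness[of _ "\<lambda>(\<rho>, z). int N * z + int \<rho>"
        "\<lambda>m. (nat (m mod int N), m div int N)"])
    fix m assume m: "m \<in> {\<lceil>l\<rceil>..\<lfloor>r\<rfloor>}"
    have m_eq: "int N * (m div int N) + int (nat (m mod int N)) = m"
      using assms by simp
    show "(case (nat (m mod int N), m div int N) of (\<rho>, z) \<Rightarrow> int N * z + int \<rho>) = m"
      unfolding prod.case by (rule m_eq)
    show "(nat (m mod int N), m div int N) \<in> Sigma {..<N} ?Z"
      unfolding mem_Sigma_iff Z m_eq using m assms by (simp add: nat_less_iff)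
    show "(case (nat (m mod int N), m div int N) of (\<rho>, z) \<Rightarrow> F (int N * z + int \<rho>)) = F m"
      unfolding prod.case by (simp only: m_eq)
  next
    fix b assume "b \<in> Sigma {..<N} ?Z"
    then obtain \<rho> z where b: "b = (\<rho>, z)" "\<rho> < N" "z \<in> ?Z \<rho>" by blast
    show "(nat ((case b of (\<rho>, z) \<Rightarrow> int N * z + int \<rho>) mod int N),
        (case b of (\<rho>, z) \<Rightarrow> int N * z + int \<rho>) div int N) = b"
      using b(2) by (simp add: b(1))
    show "(case b of (\<rho>, z) \<Rightarrow> int N * z + int \<rho>) \<in> {\<lceil>l\<rceil>..\<lfloor>r\<rfloor>}"
      using b(3) unfolding Z b(1) by simp
  qed
  also have "\<dots> = (\<Sum>\<rho><N. \<Sum>z\<in>?Z \<rho>. F (int N * z + int \<rho>))"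
    by (subst sum.Sigma) auto
  finally show ?thesis .
qed

text \<open>The one-variable step. The integral over an interval separates into a function of the
  upper end and a function of the lower end, which lets the two envelopes be treated independently.
  For a lattice coordinate \<open>\<Phi>\<close> and \<open>\<Psi>\<close> contain floors of their
  last argument, so they are only claimed to give \<open>qpoly\<close> functions when evaluated at
  rational forms, not at arbitrary \<open>qpoly\<close> functions.\<close>

lemma integrate_last_coordinate:
  fixes f :: "'e::euclidean_space \<Rightarrow> (nat \<Rightarrow> real) \<Rightarrow> real"
  assumes "qpoly k (Suc n) f"
  shows "\<exists>\<Phi> \<Psi>. (\<forall>\<rho>. rational_form n \<rho> \<longrightarrow>
      qpoly k n (\<lambda>t x. \<Phi> t x (\<rho> t x)) \<and> qpoly k n (\<lambda>t x. \<Psi> t x (\<rho> t x))) \<and>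
    (\<forall>t x l r. l \<le> r \<longrightarrow>
      (\<integral>s. f t (x(n := s)) * indicator {l..r} s \<partial>coord_measure k n) = \<Phi> t x r + \<Psi> t x l)"
proof (cases "n < k")
  case False
  then obtain g where g: "var_poly k n g" "\<And>t x s. f t (x(n := s)) = g t x s"
    using qpoly_real_variable[OF assms] by auto
  from has_integral_var_poly[OF g(1)] obtain G where G: "var_poly k n G" "\<And>t x l r. l \<le> r \<Longrightarrow>
    has_bochner_integral lborel (\<lambda>s. g t x s * indicator {l..r} s) (G t x r - G t x l)" by blast
  have "qpoly k n (\<lambda>t x. G t x (\<rho> t x)) \<and> qpoly k n (\<lambda>t x. - G t x (\<rho> t x))"
    if "rational_form n \<rho>" for \<rho>
    using qpoly_subst[OF G(1) qpoly.form[OF that]] qpoly_uminus by blast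
  moreover have "(\<integral>s. f t (x(n := s)) * indicator {l..r} s \<partial>coord_measure k n) =
      G t x r + - G t x l" if "l \<le> r" for t x l r
    using False has_bochner_integral_integral_eq[OF G(2)[OF that]]
    by (simp add: coord_measure_def g(2) del: fun_upd_apply)
  ultimately show ?thesis
    by (intro exI[of _ G] exI[of _ "\<lambda>t x s. - G t x s"]) blast
next
  case True
  obtain N where N: "N > 0" "periodic_poly k n N f"
    using qpoly_integer_variable[OF assms True] by blast
  have "\<exists>G. var_poly k n G \<and> (\<forall>t x. \<forall>z::int.
      f t (x(n := real N * of_int z + real \<rho>)) = G t x (of_int (z + 1)) - G t x (of_int z))" for \<rho>
  proof -
    obtain g where "var_poly k n g"
      "\<forall>t x. \<forall>z::int. f t (x(n := real N * of_int z + real \<rho>)) = g t x (of_int z)"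
      using N(2) unfolding periodic_poly_def by blast
    with var_poly_antidifference[of k n g] show ?thesis by (auto simp del: fun_upd_apply)
  qed
  then obtain G where G: "\<And>\<rho>. var_poly k n (G \<rho>)" "\<And>\<rho> t x (z::int).
    f t (x(n := real N * of_int z + real \<rho>)) = G \<rho> t x (of_int (z + 1)) - G \<rho> t x (of_int z)"
    by metis
  \<comment> \<open>On the class of \<open>\<rho>\<close> the sum telescopes: the antidifference is
    evaluated one past the last index, which is the floor of (r - \<rho>) / N, and at the first
    index, the ceiling of (l - \<rho>) / N, written in \<open>\<Psi>\<close> as a negated
    floor.\<close>
  define \<Phi> where "\<Phi> = (\<lambda>t x r. \<Sum>\<rho><N. G \<rho> t x (of_int \<lfloor>(1 / real N) * (r + (- real \<rho>))\<rfloor> + 1))"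
  define \<Psi> where "\<Psi> = (\<lambda>t x l. - (\<Sum>\<rho><N. G \<rho> t x (- of_int \<lfloor>(- 1 / real N) * (l + (- real \<rho>))\<rfloor>)))"
  have "qpoly k n (\<lambda>t x. \<Phi> t x (\<rho> t x))" "qpoly k n (\<lambda>t x. \<Psi> t x (\<rho> t x))"
    if "rational_form n \<rho>" for \<rho>
    unfolding \<Phi>_def \<Psi>_def
    by (intro qpoly_sum qpoly_uminus qpoly_subst[OF G(1)] qpoly.add qpoly.const qpoly_floor
        rational_form_scale rational_form_add rational_form_const that Rats_divide Rats_minus_iff[THEN iffD2];
        use True in auto)+
  moreover have "(\<integral>s. f t (x(n := s)) * indicator {l..r} s \<partial>coord_measure k n) = \<Phi> t x r + \<Psi> t x l"
    if "l \<le> r" for t x l r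
  proof -
    have "(\<integral>s. f t (x(n := s)) * indicator {l..r} s \<partial>coord_measure k n) =
        (\<Sum>m\<in>{\<lceil>l\<rceil>..\<lfloor>r\<rfloor>}. f t (x(n := of_int m)))"
      using True integral_count_space_Ints[of "\<lambda>s. f t (x(n := s))" l r]
      by (simp add: coord_measure_def)
    also have "\<dots> = (\<Sum>\<rho><N. \<Sum>z\<in>{\<lceil>(l - real \<rho>) / real N\<rceil>..\<lfloor>(r - real \<rho>) / real N\<rfloor>}.
        f t (x(n := real N * of_int z + real \<rho>)))"
      using sum_residue_classes[OF N(1), of "\<lambda>m. f t (x(n := of_int m))" l r] by simp
    also have "\<dots> = (\<Sum>\<rho><N. G \<rho> t x (of_int (\<lfloor>(r - real \<rho>) / real N\<rfloor> + 1))
        - G \<rho> t x (of_int \<lceil>(l - real \<rho>) / real N\<rceil>))"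
    proof (rule sum.cong[OF refl])
      fix \<rho>
      \<comment> \<open>From \<open>l \<le> r\<close> the first index exceeds the last by at most
        one. So the telescoping formula also covers classes without any term, where both ends
        coincide and the difference is 0.\<close>
      have "(l - real \<rho>) / real N \<le> (r - real \<rho>) / real N"
        using that N(1) by (intro divide_right_mono) auto
      then have "\<lceil>(l - real \<rho>) / real N\<rceil> \<le> \<lfloor>(r - real \<rho>) / real N\<rfloor> + 1"
        by linarith
      from sum_int_telescope[OF this, of "\<lambda>z. G \<rho> t x (of_int z)"]
      show "(\<Sum>z\<in>{\<lceil>(l - real \<rho>) / real N\<rceil>..\<lfloor>(r - real \<rho>) / real N\<rfloor>}.
        f t (x(n := real N * of_int z + real \<rho>))) =
        G \<rho> t x (of_int (\<lfloor>(r - real \<rho>) / real N\<rfloor> + 1))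
        - G \<rho> t x (of_int \<lceil>(l - real \<rho>) / real N\<rceil>)"
        by (simp add: G(2) del: fun_upd_apply of_int_add)
    qed
    also have "\<dots> = \<Phi> t x r + \<Psi> t x l"
      unfolding \<Phi>_def \<Psi>_def by (simp add: sum_subtractf ceiling_def)
    finally show ?thesis .
  qed
  ultimately show ?thesis by blast
qed

subsection \<open>Minkowski families\<close>

text \<open>Membership of \<open>x\<close> in the projection of \<open>\<Sum>i. t $ i *\<^sub>R p i\<close> to the first \<open>n\<close> coordinates;
  the coordinates of \<open>x\<close> from \<open>n\<close> on are ignored.\<close>

definition in_family ::
  "nat \<Rightarrow> real ^ 'q::finite \<Rightarrow> ('q \<Rightarrow> (nat \<Rightarrow> real) set) \<Rightarrow> (nat \<Rightarrow> real) \<Rightarrow> bool" where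
  "in_family n t p x \<longleftrightarrow>
     (\<exists>y. (\<forall>i. y i \<in> p i) \<and> (\<forall>j<n. x j = (\<Sum>i\<in>UNIV. t $ i * y i j)))"

text \<open>The absence of a constant term makes the form linear in the pair (t, x); this is what
  allows its value on a Minkowski combination to be distributed over the summands.\<close>

definition homogeneous_form ::
  "nat \<Rightarrow> ('e::euclidean_space \<Rightarrow> (nat \<Rightarrow> real) \<Rightarrow> real) \<Rightarrow> bool" where
  "homogeneous_form n \<phi> \<longleftrightarrow> (\<exists>\<eta> \<kappa>. (\<forall>j. \<kappa> j \<in> \<rat>) \<and>
     \<phi> = (\<lambda>t x. \<eta> \<bullet> t + (\<Sum>j<n. \<kappa> j * x j)))"

text \<open>The forms constrain t and x jointly, so that one finite set serves all t. Only positive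
  t are considered: points of the single \<open>p i\<close> are recovered from a decomposition of x
  by dividing by the entries of t.\<close>

definition cut_out ::
  "nat \<Rightarrow> ('q::finite \<Rightarrow> (nat \<Rightarrow> real) set) \<Rightarrow> (real ^ 'q \<Rightarrow> (nat \<Rightarrow> real) \<Rightarrow> real) set \<Rightarrow> bool"
where
  "cut_out n p \<Phi> \<longleftrightarrow> finite \<Phi> \<and> (\<forall>\<phi>\<in>\<Phi>. homogeneous_form n \<phi>) \<and>
     (\<forall>t x. (\<forall>i. 0 < t $ i) \<longrightarrow> in_family n t p x \<longleftrightarrow> (\<forall>\<phi>\<in>\<Phi>. 0 \<le> \<phi> t x))"

lemma homogeneous_form_add:
  assumes "homogeneous_form n \<phi>" "homogeneous_form n \<psi>"
  shows "homogeneous_form n (\<lambda>t x. \<phi> t x + \<psi> t x)"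
proof -
  from assms obtain \<eta> \<kappa> \<eta>' \<kappa>' where "\<forall>j. \<kappa> j \<in> \<rat>" "\<forall>j. \<kappa>' j \<in> \<rat>"
    "\<phi> = (\<lambda>t x. \<eta> \<bullet> t + (\<Sum>j<n. \<kappa> j * x j))" "\<psi> = (\<lambda>t x. \<eta>' \<bullet> t + (\<Sum>j<n. \<kappa>' j * x j))"
    unfolding homogeneous_form_def by blast
  then show ?thesis
    unfolding homogeneous_form_def
    by (intro exI[of _ "\<eta> + \<eta>'"] exI[of _ "\<lambda>j. \<kappa> j + \<kappa>' j"])
       (auto simp: inner_add_left sum.distrib algebra_simps)
qed

lemma homogeneous_form_scale:
  assumes "homogeneous_form n \<phi>" "c \<in> \<rat>"
  shows "homogeneous_form n (\<lambda>t x. c * \<phi> t x)"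
proof -
  from assms obtain \<eta> \<kappa> where "\<forall>j. \<kappa> j \<in> \<rat>" "\<phi> = (\<lambda>t x. \<eta> \<bullet> t + (\<Sum>j<n. \<kappa> j * x j))"
    unfolding homogeneous_form_def by blast
  then show ?thesis
    unfolding homogeneous_form_def using assms(2)
    by (intro exI[of _ "c *\<^sub>R \<eta>"] exI[of _ "\<lambda>j. c * \<kappa> j"])
       (auto simp: sum_distrib_left algebra_simps)
qed

lemma homogeneous_form_rational: "homogeneous_form n \<phi> \<Longrightarrow> rational_form n \<phi>"
proof -
  assume "homogeneous_form n \<phi>"
  then obtain \<eta> \<kappa> where "\<forall>j. \<kappa> j \<in> \<rat>" "\<phi> = (\<lambda>t x. \<eta> \<bullet> t + (\<Sum>j<n. \<kappa> j * x j))"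
    unfolding homogeneous_form_def by blast
  then show ?thesis
    unfolding rational_form_def by (intro exI[of _ \<eta>] exI[of _ \<kappa>] exI[of _ 0]) simp
qed

lemma homogeneous_form_Suc:
  assumes "homogeneous_form (Suc n) \<phi>"
  shows "\<exists>\<psi> \<kappa>. homogeneous_form n \<psi> \<and> \<kappa> \<in> \<rat> \<and> (\<forall>t x s. \<phi> t (x(n := s)) = \<psi> t x + \<kappa> * s)"
proof -
  from assms obtain \<eta> \<kappa> where *: "\<forall>j. \<kappa> j \<in> \<rat>" "\<phi> = (\<lambda>t x. \<eta> \<bullet> t + (\<Sum>j<Suc n. \<kappa> j * x j))"
    unfolding homogeneous_form_def by blast
  have "(\<Sum>j<n. \<kappa> j * (x(n := s)) j) = (\<Sum>j<n. \<kappa> j * x j)" for x s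
    by (rule sum.cong) auto
  then show ?thesis
    using * by (intro exI[of _ "\<lambda>t x. \<eta> \<bullet> t + (\<Sum>j<n. \<kappa> j * x j)"] exI[of _ "\<kappa> n"])
      (auto simp: homogeneous_form_def)
qed

text \<open>The pair (t, x) is the combination of the pairs (\<open>axis i 1\<close>,
  \<open>y i\<close>) with weights \<open>t $ i\<close> as far as the first n coordinates are
  concerned, and the form is linear.\<close>

lemma homogeneous_form_family:
  fixes \<phi> :: "real ^ 'q::finite \<Rightarrow> (nat \<Rightarrow> real) \<Rightarrow> real"
  assumes "homogeneous_form n \<phi>" "\<And>j. j < n \<Longrightarrow> x j = (\<Sum>i\<in>UNIV. t $ i * y i j)"
  shows "\<phi> t x = (\<Sum>i\<in>UNIV. t $ i * \<phi> (axis i 1) (y i))"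
proof -
  from assms obtain \<eta> \<kappa> where phi: "\<phi> = (\<lambda>t x. \<eta> \<bullet> t + (\<Sum>j<n. \<kappa> j * x j))"
    unfolding homogeneous_form_def by blast
  have "(\<Sum>j<n. \<kappa> j * x j) = (\<Sum>j<n. \<Sum>i\<in>UNIV. t $ i * (\<kappa> j * y i j))"
    by (rule sum.cong) (simp_all add: assms(2) sum_distrib_left mult_ac)
  also have "\<dots> = (\<Sum>i\<in>UNIV. t $ i * (\<Sum>j<n. \<kappa> j * y i j))"
    by (subst sum.swap) (simp add: sum_distrib_left)
  finally show ?thesis
    by (simp add: phi inner_axis inner_vec_def[of \<eta> t] sum.distrib distrib_left mult_ac)
qed

lemma in_family_Suc: "in_family n t p x \<longleftrightarrow> (\<exists>s. in_family (Suc n) t p (x(n := s)))"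
proof
  assume "in_family n t p x"
  then obtain y where "\<forall>i. y i \<in> p i" "\<forall>j<n. x j = (\<Sum>i\<in>UNIV. t $ i * y i j)"
    unfolding in_family_def by blast
  then show "\<exists>s. in_family (Suc n) t p (x(n := s))"
    unfolding in_family_def
    by (intro exI[of _ "\<Sum>i\<in>UNIV. t $ i * y i n"] exI[of _ y]) (auto simp: less_Suc_eq)
qed (force simp: in_family_def less_Suc_eq)

lemma fourier_motzkin_homogeneous:
  fixes K :: "(('b \<Rightarrow> real) \<times> ('e::euclidean_space \<times> (nat \<Rightarrow> real) \<Rightarrow> real)) set"
  assumes "finite B" "finite K"
    and "\<And>w f. (w, f) \<in> K \<Longrightarrow>
      (\<exists>\<phi>. homogeneous_form n \<phi> \<and> f = (\<lambda>(t, x). \<phi> t x)) \<and> (\<forall>b. w b \<in> \<rat>)"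
  shows "\<exists>\<Phi>. finite \<Phi> \<and> (\<forall>\<phi>\<in>\<Phi>. homogeneous_form n \<phi>) \<and>
    (\<forall>t x. (\<exists>z. \<forall>(w, f)\<in>K. (\<Sum>b\<in>B. w b * z b) \<le> f (t, x)) \<longleftrightarrow> (\<forall>\<phi>\<in>\<Phi>. 0 \<le> \<phi> t x))"
proof -
  let ?F = "{\<lambda>(t, x). \<phi> t x | \<phi> :: 'e \<Rightarrow> (nat \<Rightarrow> real) \<Rightarrow> real. homogeneous_form n \<phi>}"
  have "\<exists>G. finite G \<and> G \<subseteq> ?F \<and>
    (\<forall>\<tau>. (\<exists>z. \<forall>(w, f)\<in>K. (\<Sum>b\<in>B. w b * z b) \<le> f \<tau>) \<longleftrightarrow> (\<forall>g\<in>G. 0 \<le> g \<tau>))"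
  proof (rule fourier_motzkin)
    show "(\<lambda>\<tau>. f \<tau> + g \<tau>) \<in> ?F" if fg: "f \<in> ?F" "g \<in> ?F" for f g
    proof -
      from fg obtain a b where "f = (\<lambda>(t, x). a t x)" "g = (\<lambda>(t, x). b t x)"
        "homogeneous_form n a" "homogeneous_form n b" by blast
      then show ?thesis
        by (auto intro!: exI[of _ "\<lambda>t x. a t x + b t x"] homogeneous_form_add)
    qed
    show "(\<lambda>\<tau>. q * f \<tau>) \<in> ?F" if qf: "q \<in> \<rat>" "f \<in> ?F" for q f
    proof -
      from qf obtain a where "f = (\<lambda>(t, x). a t x)" "homogeneous_form n a" by blast
      with qf show ?thesis
        by (auto intro!: exI[of _ "\<lambda>t x. q * a t x"] homogeneous_form_scale)
    qed
    show "f \<in> ?F \<and> (\<forall>b. w b \<in> \<rat>)" if "(w, f) \<in> K" for w f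
      using assms(3)[OF that] by blast
  qed (use assms in auto)
  then obtain G where G: "finite G" "G \<subseteq> ?F"
    "\<And>\<tau>. (\<exists>z. \<forall>(w, f)\<in>K. (\<Sum>b\<in>B. w b * z b) \<le> f \<tau>) \<longleftrightarrow> (\<forall>g\<in>G. 0 \<le> g \<tau>)"
    by blast
  have "\<forall>\<phi>\<in>(\<lambda>g t x. g (t, x)) ` G. homogeneous_form n \<phi>"
    using G(2) by (auto dest!: subsetD)
  then show ?thesis
    using G(1) unfolding G(3) by (intro exI[of _ "(\<lambda>g t x. g (t, x)) ` G"]) simp
qed

lemma cut_out_project:
  fixes p :: "'q::finite \<Rightarrow> (nat \<Rightarrow> real) set"
  assumes "cut_out (Suc n) p \<Phi>"
  shows "\<exists>\<Phi>'. cut_out n p \<Phi>'"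
proof -
  have "\<forall>\<phi>\<in>\<Phi>. \<exists>\<psi> \<kappa>. homogeneous_form n \<psi> \<and> \<kappa> \<in> \<rat> \<and> (\<forall>t x s. \<phi> t (x(n := s)) = \<psi> t x + \<kappa> * s)"
    using assms homogeneous_form_Suc unfolding cut_out_def by blast
  then obtain \<psi> \<kappa> where *: "\<And>\<phi>. \<phi> \<in> \<Phi> \<Longrightarrow> homogeneous_form n (\<psi> \<phi>)"
    "\<And>\<phi>. \<phi> \<in> \<Phi> \<Longrightarrow> \<kappa> \<phi> \<in> \<rat>"
    "\<And>\<phi> t x s. \<phi> \<in> \<Phi> \<Longrightarrow> \<phi> t (x(n := s)) = \<psi> \<phi> t x + \<kappa> \<phi> * s"
    by metis
  \<comment> \<open>Elimination of one variable, indexed by the type \<open>unit\<close>. Each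
    inequality 0 \<le> \<psi> + \<kappa> s is rewritten as - \<kappa> s \<le> \<psi>.\<close>
  let ?K = "(\<lambda>\<phi>. (\<lambda>_::unit. - \<kappa> \<phi>, \<lambda>(t, x). \<psi> \<phi> t x)) ` \<Phi>"
  have "\<exists>\<Phi>. finite \<Phi> \<and> (\<forall>\<phi>\<in>\<Phi>. homogeneous_form n \<phi>) \<and> (\<forall>t x.
    (\<exists>z. \<forall>(w, f)\<in>?K. (\<Sum>b\<in>UNIV. w b * z b) \<le> f (t, x)) \<longleftrightarrow> (\<forall>\<phi>\<in>\<Phi>. 0 \<le> \<phi> t x))"
  proof (rule fourier_motzkin_homogeneous)
    show "finite ?K" using assms by (simp add: cut_out_def)
    show "(\<exists>\<phi>. homogeneous_form n \<phi> \<and> f = (\<lambda>(t, x). \<phi> t x)) \<and> (\<forall>b. w b \<in> \<rat>)"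
      if "(w, f) \<in> ?K" for w f
      using that *(1,2) by auto
  qed auto
  then obtain \<Phi>' where \<Phi>': "finite \<Phi>'" "\<And>\<phi>. \<phi> \<in> \<Phi>' \<Longrightarrow> homogeneous_form n \<phi>"
    "\<And>t x. (\<exists>z. \<forall>(w, f)\<in>?K. (\<Sum>b\<in>UNIV. w b * z b) \<le> f (t, x)) \<longleftrightarrow> (\<forall>\<phi>\<in>\<Phi>'. 0 \<le> \<phi> t x)"
    by blast
  have "cut_out n p \<Phi>'"
    unfolding cut_out_def
  proof (intro conjI allI impI)
    fix t :: "real ^ 'q" and x assume t: "\<forall>i. 0 < t $ i"
    have "in_family n t p x \<longleftrightarrow> (\<exists>s. \<forall>\<phi>\<in>\<Phi>. 0 \<le> \<psi> \<phi> t x + \<kappa> \<phi> * s)"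
      using assms t *(3) unfolding in_family_Suc[of n t p x] cut_out_def by (metis (no_types, lifting))
    also have "\<dots> \<longleftrightarrow> (\<exists>z::unit \<Rightarrow> real. \<forall>\<phi>\<in>\<Phi>. 0 \<le> \<psi> \<phi> t x + \<kappa> \<phi> * z ())"
    proof
      assume "\<exists>s. \<forall>\<phi>\<in>\<Phi>. 0 \<le> \<psi> \<phi> t x + \<kappa> \<phi> * s"
      then obtain s where "\<forall>\<phi>\<in>\<Phi>. 0 \<le> \<psi> \<phi> t x + \<kappa> \<phi> * s" ..
      then show "\<exists>z::unit \<Rightarrow> real. \<forall>\<phi>\<in>\<Phi>. 0 \<le> \<psi> \<phi> t x + \<kappa> \<phi> * z ()"
        by (intro exI[of _ "\<lambda>_. s"])
    qed blast
    also have "\<dots> \<longleftrightarrow> (\<exists>z. \<forall>(w, f)\<in>?K. (\<Sum>b\<in>UNIV. w b * z b) \<le> f (t, x))"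
      by (simp add: UNIV_unit, intro ex_cong1 ball_cong refl, linarith)
    also have "\<dots> \<longleftrightarrow> (\<forall>\<phi>\<in>\<Phi>'. 0 \<le> \<phi> t x)" by (rule \<Phi>'(3))
    finally show "in_family n t p x \<longleftrightarrow> (\<forall>\<phi>\<in>\<Phi>'. 0 \<le> \<phi> t x)" .
  qed (use \<Phi>' in auto)
  then show ?thesis by blast
qed

text \<open>Validity on the whole family forces validity on each summand: if the form were negative
  at a point of \<open>p i\<close>, a sufficiently large weight on this summand would make it
  negative on the family.\<close>

lemma cut_out_nonneg:
  assumes "cut_out n p \<Phi>" "\<And>i. p i \<noteq> {}" "\<phi> \<in> \<Phi>" "y \<in> p i"
  shows "0 \<le> \<phi> (axis i 1) y"
proof (rule ccontr)
  assume neg: "\<not> 0 \<le> \<phi> (axis i 1) y"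
  define w where "w = (\<lambda>j. if j = i then y else SOME z. z \<in> p j)"
  have w: "w j \<in> p j" for j
    using assms(2,4) by (auto simp: w_def some_in_eq)
  define C where "C = (\<Sum>j\<in>UNIV - {i}. \<phi> (axis j 1) (w j))"
  \<comment> \<open>Chosen so that the i-th term equals -(|C| + 1), which outweighs the contribution
    \<open>C\<close> of the other summands at weight 1.\<close>
  define T where "T = (\<bar>C\<bar> + 1) / - \<phi> (axis i 1) y"
  have T: "T > 0" "T * \<phi> (axis i 1) y = - (\<bar>C\<bar> + 1)"
    using neg by (auto simp: T_def field_simps intro!: divide_pos_pos)
  define t :: "real ^ 'a" where "t = (\<chi> j. if j = i then T else 1)"
  define x where "x = (\<lambda>k. \<Sum>j\<in>UNIV. t $ j * w j k)"
  have "in_family n t p x"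
    unfolding in_family_def using w by (auto simp: x_def)
  moreover have "\<forall>j. 0 < t $ j" using T by (simp add: t_def)
  ultimately have "0 \<le> \<phi> t x" using assms(1,3) unfolding cut_out_def by blast
  also have "\<phi> t x = (\<Sum>j\<in>UNIV. t $ j * \<phi> (axis j 1) (w j))"
    by (rule homogeneous_form_family[of n]) (use assms in \<open>auto simp: x_def cut_out_def\<close>)
  also have "\<dots> = T * \<phi> (axis i 1) y + (\<Sum>j\<in>UNIV - {i}. t $ j * \<phi> (axis j 1) (w j))"
    by (subst sum.remove[of _ i]) (auto simp: t_def w_def)
  also have "(\<Sum>j\<in>UNIV - {i}. t $ j * \<phi> (axis j 1) (w j)) = C"
    unfolding C_def by (rule sum.cong) (auto simp: t_def)
  finally show False using T(2) by linarith
qed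

definition family_face ::
  "('q::finite \<Rightarrow> (nat \<Rightarrow> real) set) \<Rightarrow> (real ^ 'q \<Rightarrow> (nat \<Rightarrow> real) \<Rightarrow> real) set \<Rightarrow>
    'q \<Rightarrow> (nat \<Rightarrow> real) set" where
  "family_face p S i = {y \<in> p i. \<forall>\<phi>\<in>S. \<phi> (axis i 1) y = 0}"

text \<open>At a point of the family the form is a sum of nonnegative terms
  \<open>t $ i * \<phi> (axis i 1) (y i)\<close>. As the weights are positive, it vanishes iff every
  term does, that is, iff each \<open>y i\<close> lies in a face that does not depend on t. For zero
  weights this would fail.\<close>

lemma in_family_face:
  assumes "cut_out n p \<Phi>" "S \<subseteq> \<Phi>" "\<And>i. 0 < t $ i"
  shows "in_family n t (family_face p S) x \<longleftrightarrow> in_family n t p x \<and> (\<forall>\<phi>\<in>S. \<phi> t x = 0)"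
proof
  assume "in_family n t (family_face p S) x"
  then obtain y where y: "\<And>i. y i \<in> family_face p S i" "\<And>j. j < n \<Longrightarrow> x j = (\<Sum>i\<in>UNIV. t $ i * y i j)"
    unfolding in_family_def by blast
  have "\<phi> t x = 0" if "\<phi> \<in> S" for \<phi>
  proof -
    have "\<phi> t x = (\<Sum>i\<in>UNIV. t $ i * \<phi> (axis i 1) (y i))"
      by (rule homogeneous_form_family[of n]) (use assms that y in \<open>auto simp: cut_out_def\<close>)
    also have "\<dots> = 0"
      using y(1) that by (intro sum.neutral) (simp add: family_face_def)
    finally show ?thesis .
  qed
  then show "in_family n t p x \<and> (\<forall>\<phi>\<in>S. \<phi> t x = 0)"
    using y unfolding in_family_def family_face_def by blast
next
  assume H: "in_family n t p x \<and> (\<forall>\<phi>\<in>S. \<phi> t x = 0)"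
  then obtain y where y: "\<And>i. y i \<in> p i" "\<And>j. j < n \<Longrightarrow> x j = (\<Sum>i\<in>UNIV. t $ i * y i j)"
    unfolding in_family_def by blast
  have "\<phi> (axis i 1) (y i) = 0" if "\<phi> \<in> S" for \<phi> i
  proof -
    have "\<phi> t x = (\<Sum>i\<in>UNIV. t $ i * \<phi> (axis i 1) (y i))"
      by (rule homogeneous_form_family[of n]) (use assms that y in \<open>auto simp: cut_out_def\<close>)
    moreover have "0 \<le> t $ i * \<phi> (axis i 1) (y i)" for i
      using cut_out_nonneg[OF assms(1) _ _ y(1)[of i], of \<phi>] y(1) assms(2,3) that
      by (metis empty_iff less_eq_real_def mult_nonneg_nonneg subsetD)
    ultimately have "\<forall>i\<in>UNIV. t $ i * \<phi> (axis i 1) (y i) = 0"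
      using H that by (subst sum_nonneg_eq_0_iff[symmetric]) auto
    then have "t $ i * \<phi> (axis i 1) (y i) = 0" by blast
    then show ?thesis using assms(3)[of i] by auto
  qed
  then show "in_family n t (family_face p S) x"
    using y unfolding in_family_def family_face_def by blast
qed

lemma cut_out_face:
  assumes "cut_out n p \<Phi>" "S \<subseteq> \<Phi>"
  shows "cut_out n (family_face p S) (\<Phi> \<union> (\<lambda>\<phi> t x. - 1 * \<phi> t x) ` S)"
  unfolding cut_out_def
proof (intro conjI allI impI)
  show "finite (\<Phi> \<union> (\<lambda>\<phi> t x. - 1 * \<phi> t x) ` S)"
    using assms by (auto simp: cut_out_def intro: finite_subset)
  show "\<forall>\<phi>\<in>\<Phi> \<union> (\<lambda>\<phi> t x. - 1 * \<phi> t x) ` S. homogeneous_form n \<phi>"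
    using assms homogeneous_form_scale[of n _ "-1"] by (auto simp: cut_out_def)
  fix t :: "real ^ 'a" and x assume t: "\<forall>i. 0 < t $ i"
  then have in_p: "in_family n t p x \<longleftrightarrow> (\<forall>\<phi>\<in>\<Phi>. 0 \<le> \<phi> t x)"
    using assms(1) by (simp add: cut_out_def)
  show "in_family n t (family_face p S) x \<longleftrightarrow>
      (\<forall>\<phi>\<in>\<Phi> \<union> (\<lambda>\<phi> t x. - 1 * \<phi> t x) ` S. 0 \<le> \<phi> t x)"
  proof -
    have "(\<forall>\<phi>\<in>S. \<phi> t x = 0) \<longleftrightarrow> (\<forall>\<phi>\<in>S. \<phi> t x \<le> 0)" if "\<forall>\<phi>\<in>\<Phi>. 0 \<le> \<phi> t x"
    proof (rule ball_cong[OF refl])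
      fix \<phi> assume "\<phi> \<in> S"
      then have "0 \<le> \<phi> t x" using that assms(2) by blast
      then show "\<phi> t x = 0 \<longleftrightarrow> \<phi> t x \<le> 0" by linarith
    qed
    with in_p show ?thesis
      unfolding in_family_face[OF assms t[rule_format]] by (simp add: ball_Un) blast
  qed
qed

definition coord_bounded :: "nat \<Rightarrow> ('q::finite \<Rightarrow> (nat \<Rightarrow> real) set) \<Rightarrow> bool" where
  "coord_bounded n p \<longleftrightarrow> (\<exists>B. \<forall>i. \<forall>y\<in>p i. \<forall>j<n. \<bar>y j\<bar> \<le> B)"

lemma coord_bounded_mono:
  "coord_bounded m p \<Longrightarrow> n \<le> m \<Longrightarrow> (\<And>i. p' i \<subseteq> p i) \<Longrightarrow> coord_bounded n p'"
  unfolding coord_bounded_def by (meson order_less_le_trans subsetD)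

lemma coord_bounded_family:
  assumes "coord_bounded n p"
  obtains R where "\<And>x j. in_family n t p x \<Longrightarrow> j < n \<Longrightarrow> \<bar>x j\<bar> \<le> R"
proof -
  from assms obtain B where B: "\<And>i y j. y \<in> p i \<Longrightarrow> j < n \<Longrightarrow> \<bar>y j\<bar> \<le> B"
    unfolding coord_bounded_def by blast
  have "\<bar>x j\<bar> \<le> (\<Sum>i\<in>UNIV. \<bar>t $ i\<bar> * B)" if "in_family n t p x" "j < n" for x j
  proof -
    from that obtain y where y: "\<And>i. y i \<in> p i" "x j = (\<Sum>i\<in>UNIV. t $ i * y i j)"
      unfolding in_family_def by blast
    show ?thesis
      unfolding y(2) using B[OF y(1) that(2)]
      by (intro order_trans[OF sum_abs] sum_mono) (auto simp: abs_mult intro!: mult_left_mono)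
  qed
  then show ?thesis by (rule that)
qed

subsection \<open>Closure properties of semi-quasi-polynomials\<close>

lemma semi_quasi_polynomial_const: "semi_quasi_polynomial (\<lambda>t. c)"
  by (rule semi_quasi_polynomial.polynomial, rule real_polynomial_function.intros(2))

lemma semi_quasi_polynomial_inner: "semi_quasi_polynomial (\<lambda>t. \<eta> \<bullet> t)"
  by (rule semi_quasi_polynomial.polynomial, rule real_polynomial_function.intros(1))
     (rule bounded_linear_inner_right)

lemma semi_quasi_polynomial_uminus:
  "semi_quasi_polynomial f \<Longrightarrow> semi_quasi_polynomial (\<lambda>t. - f t)"
  using semi_quasi_polynomial.mult[OF semi_quasi_polynomial_const[of "-1"]] by simp

lemma semi_quasi_polynomial_sum:
  "finite I \<Longrightarrow> (\<And>i. i \<in> I \<Longrightarrow> semi_quasi_polynomial (f i)) \<Longrightarrow>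
    semi_quasi_polynomial (\<lambda>t. \<Sum>i\<in>I. f i t)"
proof (induction I rule: finite_induct)
  case empty
  show ?case using semi_quasi_polynomial_const[of 0] by simp
next
  case (insert i I)
  then show ?case using semi_quasi_polynomial.add[of "f i" "\<lambda>t. \<Sum>i\<in>I. f i t"] by simp
qed

lemma semi_quasi_polynomial_prod:
  "finite I \<Longrightarrow> (\<And>i. i \<in> I \<Longrightarrow> semi_quasi_polynomial (f i)) \<Longrightarrow>
    semi_quasi_polynomial (\<lambda>t. \<Prod>i\<in>I. f i t)"
proof (induction I rule: finite_induct)
  case empty
  show ?case using semi_quasi_polynomial_const[of 1] by simp
next
  case (insert i I)
  then show ?case using semi_quasi_polynomial.mult[of "f i" "\<lambda>t. \<Prod>i\<in>I. f i t"] by simp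
qed

text \<open>The function \<open>a t = N * frac (\<eta> \<bullet> t) - frac (N * (\<eta> \<bullet> t))\<close> is the integer part of
  \<open>N * frac (\<eta> \<bullet> t)\<close>.  It takes finitely many values, so any function of it is a polynomial in it
  by Lagrange interpolation.\<close>

lemma semi_quasi_polynomial_digit:
  fixes N :: nat and w :: "int \<Rightarrow> real"
  assumes "N > 0"
  shows "semi_quasi_polynomial (\<lambda>t. w \<lfloor>real N * frac (\<eta> \<bullet> t)\<rfloor>)"
proof -
  define a where "a = (\<lambda>t. real N * frac (\<eta> \<bullet> t) + - frac ((real N *\<^sub>R \<eta>) \<bullet> t))"
  have a_eq: "a t = of_int \<lfloor>real N * frac (\<eta> \<bullet> t)\<rfloor>" for t
  proof -
    have "frac (real N * (\<eta> \<bullet> t)) = frac (real N * frac (\<eta> \<bullet> t) + of_int (int N * \<lfloor>\<eta> \<bullet> t\<rfloor>))"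
      by (simp add: frac_def[of "\<eta> \<bullet> t"] algebra_simps)
    also have "\<dots> = frac (real N * frac (\<eta> \<bullet> t))"
      by (simp only: frac_add_of_int_right)
    finally show ?thesis by (simp add: a_def frac_def)
  qed
  have sa: "semi_quasi_polynomial a"
    unfolding a_def
    by (rule semi_quasi_polynomial.add[OF semi_quasi_polynomial.mult[OF semi_quasi_polynomial_const
          semi_quasi_polynomial.fractional_part] semi_quasi_polynomial_uminus[OF
          semi_quasi_polynomial.fractional_part]])
  let ?I = "{0..<int N}"
  define l where "l = (\<lambda>m t. \<Prod>j\<in>?I - {m}. (a t + - of_int j) * (1 / of_int (m - j)))"
  have w_eq: "w \<lfloor>real N * frac (\<eta> \<bullet> t)\<rfloor> = (\<Sum>m\<in>?I. w m * l m t)" for t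
  proof -
    let ?d = "\<lfloor>real N * frac (\<eta> \<bullet> t)\<rfloor>"
    have d: "?d \<in> ?I"
      using assms frac_lt_1[of "\<eta> \<bullet> t"] frac_ge_0[of "\<eta> \<bullet> t"] by (simp add: floor_less_iff)
    have "l m t = (if m = ?d then 1 else 0)" if "m \<in> ?I" for m
    proof (cases "m = ?d")
      case True
      have "l m t = 1"
        unfolding l_def a_eq True[symmetric] by (rule prod.neutral) auto
      with True show ?thesis by simp
    next
      case False
      then have "l m t = 0"
        unfolding l_def a_eq using d by (intro prod_zero bexI[of _ ?d]) auto
      with False show ?thesis by simp
    qed
    then have "(\<Sum>m\<in>?I. w m * l m t) = (\<Sum>m\<in>?I. if m = ?d then w m else 0)"
      by (intro sum.cong refl) simp
    also have "\<dots> = w ?d" using d by (simp add: sum.delta)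
    finally show ?thesis ..
  qed
  have "semi_quasi_polynomial (l m)" for m
    unfolding l_def
    by (rule semi_quasi_polynomial_prod, simp,
        rule semi_quasi_polynomial.mult[OF _ semi_quasi_polynomial_const],
        rule semi_quasi_polynomial.add[OF sa semi_quasi_polynomial_const])
  then have "semi_quasi_polynomial (\<lambda>t. \<Sum>m\<in>?I. w m * l m t)"
    by (intro semi_quasi_polynomial_sum semi_quasi_polynomial.mult[OF semi_quasi_polynomial_const]) auto
  then show ?thesis by (simp only: w_eq)
qed

text \<open>The algebra is generated by fractional parts of linear forms without constant term, so
  shifts have to be expressed. For q = b / n the integer part of {u} + q is (d + b) div n with d the
  integer part of n {u}, hence a function of the digit d alone.\<close>

lemma semi_quasi_polynomial_frac_shift:
  assumes "q \<in> \<rat>"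
  shows "semi_quasi_polynomial (\<lambda>t. frac (\<eta> \<bullet> t + q))"
proof -
  obtain b N where q: "q = of_int b / of_int N" "N > 0"
    using assms by (metis Rats_cases')
  define n where "n = nat N"
  have n: "n > 0" "q = of_int b / real n" using q by (auto simp: n_def)
  define \<eta>' where "\<eta>' = (1 / real n) *\<^sub>R \<eta>"
  define d where "d = (\<lambda>t. \<lfloor>real n * frac (\<eta> \<bullet> t)\<rfloor>)"
  have "frac (\<eta> \<bullet> t + q) = frac (\<eta> \<bullet> t) + q - of_int ((d t + b) div int n)" for t
  proof -
    have "frac (\<eta> \<bullet> t) + q = (real n * frac (\<eta> \<bullet> t) + of_int b) / real n"
      using n(1) unfolding n(2) by (simp add: add_divide_distrib)
    then have "\<lfloor>frac (\<eta> \<bullet> t) + q\<rfloor> = \<lfloor>(real n * frac (\<eta> \<bullet> t) + of_int b) / real n\<rfloor>"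
      by simp
    also have "\<dots> = (d t + b) div int n"
      using floor_divide_real_eq_div[of "int n" "real n * frac (\<eta> \<bullet> t) + of_int b"]
      by (simp add: d_def)
    finally have "frac (frac (\<eta> \<bullet> t) + q) = frac (\<eta> \<bullet> t) + q - of_int ((d t + b) div int n)"
      by (simp only: frac_def[of "frac (\<eta> \<bullet> t) + q"])
    moreover have "frac (\<eta> \<bullet> t + q) = frac (frac (\<eta> \<bullet> t) + q)"
    proof -
      have "\<eta> \<bullet> t + q = (frac (\<eta> \<bullet> t) + q) + of_int \<lfloor>\<eta> \<bullet> t\<rfloor>"
        by (simp add: frac_def)
      then show ?thesis by (subst \<open>\<eta> \<bullet> t + q = _\<close>) (rule frac_add_of_int_right)
    qed
    ultimately show ?thesis by (rule trans[rotated])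
  qed
  moreover have "semi_quasi_polynomial
      (\<lambda>t. frac (\<eta> \<bullet> t) + q + - of_int ((d t + b) div int n))"
    unfolding d_def
    by (intro semi_quasi_polynomial.add semi_quasi_polynomial_uminus
        semi_quasi_polynomial.fractional_part semi_quasi_polynomial_const
        semi_quasi_polynomial_digit[OF n(1)])
  ultimately show ?thesis by simp
qed

lemma qpoly_0_semi_quasi_polynomial:
  assumes "qpoly k 0 f"
  shows "semi_quasi_polynomial (\<lambda>t. f t x)"
  using assms
proof (induction rule: qpoly.induct)
  case (const c)
  show ?case by (rule semi_quasi_polynomial_const)
next
  case (form \<phi>)
  then obtain \<eta> q where "\<phi> = (\<lambda>t x. \<eta> \<bullet> t + q)"
    by (auto simp: rational_form_def)
  then show ?case
    using semi_quasi_polynomial.add[OF semi_quasi_polynomial_inner semi_quasi_polynomial_const] by simp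
next
  case (frac \<phi>)
  then obtain \<eta> q where "\<phi> = (\<lambda>t x. \<eta> \<bullet> t + q)" "q \<in> \<rat>"
    by (auto simp: rational_form_def)
  then show ?case using semi_quasi_polynomial_frac_shift by simp
qed (auto intro: semi_quasi_polynomial.intros)

section \<open>One-sided limits of semi-quasi-polynomials\<close>

lemma tendsto_frac_right:
  fixes y c :: real
  assumes "0 \<le> c"
  shows "((\<lambda>\<epsilon>. frac (y + \<epsilon> * c)) \<longlongrightarrow> frac y) (at_right 0)"
proof -
  have lim: "((\<lambda>\<epsilon>. frac y + \<epsilon> * c) \<longlongrightarrow> frac y + 0 * c) (at_right 0)"
    by (intro tendsto_add tendsto_mult tendsto_const tendsto_ident_at)
  then have "eventually (\<lambda>\<epsilon>. frac y + \<epsilon> * c < 1) (at_right 0)"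
    using frac_lt_1[of y] by (intro order_tendstoD(2)) auto
  moreover have "eventually (\<lambda>\<epsilon>::real. \<epsilon> > 0) (at_right 0)"
    by (simp add: eventually_at_right_less)
  ultimately have "eventually (\<lambda>\<epsilon>. frac (y + \<epsilon> * c) = frac y + \<epsilon> * c) (at_right 0)"
  proof eventually_elim
    case (elim \<epsilon>)
    have "frac (y + \<epsilon> * c) = frac (frac y + \<epsilon> * c + of_int \<lfloor>y\<rfloor>)"
      by (simp add: frac_def[of y] algebra_simps)
    also have "\<dots> = frac (frac y + \<epsilon> * c)" by (simp only: frac_add_of_int_right)
    also have "\<dots> = frac y + \<epsilon> * c"
      by (rule frac_eq[THEN iffD2]) (use elim assms frac_ge_0[of y] in auto)
    finally show ?case .
  qed
  then show ?thesis using tendsto_cong lim by fastforce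
qed

text \<open>The left limit of the fractional part is 1 at integers and {y} elsewhere; 1 - {-y}
  describes both cases at once and is again built from a fractional part.\<close>

lemma tendsto_frac_left:
  fixes y c :: real
  assumes "c < 0"
  shows "((\<lambda>\<epsilon>. frac (y + \<epsilon> * c)) \<longlongrightarrow> 1 - frac (- y)) (at_right 0)"
proof -
  have lim: "((\<lambda>\<epsilon>. 1 - frac (- y) + \<epsilon> * c) \<longlongrightarrow> 1 - frac (- y) + 0 * c) (at_right 0)"
    by (intro tendsto_add tendsto_mult tendsto_const tendsto_ident_at)
  then have "eventually (\<lambda>\<epsilon>. 1 - frac (- y) + \<epsilon> * c > 0) (at_right 0)"
    using frac_lt_1[of "- y"] by (intro order_tendstoD(1)) auto
  moreover have "eventually (\<lambda>\<epsilon>::real. \<epsilon> > 0) (at_right 0)"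
    by (simp add: eventually_at_right_less)
  ultimately have "eventually (\<lambda>\<epsilon>. frac (y + \<epsilon> * c) = 1 - frac (- y) + \<epsilon> * c) (at_right 0)"
  proof eventually_elim
    case (elim \<epsilon>)
    have "frac (y + \<epsilon> * c) = frac (1 - frac (- y) + \<epsilon> * c + of_int (- \<lfloor>- y\<rfloor> - 1))"
      by (simp add: frac_def[of "- y"] algebra_simps)
    also have "\<dots> = frac (1 - frac (- y) + \<epsilon> * c)" by (simp only: frac_add_of_int_right)
    also have "\<dots> = 1 - frac (- y) + \<epsilon> * c"
    proof -
      have "\<epsilon> * c < 0" using elim(2) assms by (rule mult_pos_neg)
      then have "1 - frac (- y) + \<epsilon> * c < 1" using frac_ge_0[of "- y"] by linarith
      then show ?thesis using elim(1) by (simp add: frac_eq)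
    qed
    finally show ?case .
  qed
  then show ?thesis using tendsto_cong lim by fastforce
qed

text \<open>Since the direction \<open>w\<close> is the same for all t, the sign of
  \<open>\<eta> \<bullet> w\<close> decides uniformly in t from which side the argument of each
  fractional part is approached. Precomposition with \<open>A\<close> replaces \<open>\<eta>\<close>
  by its image under the adjoint.\<close>

lemma semi_quasi_polynomial_ray_limit:
  fixes A :: "'v::euclidean_space \<Rightarrow> 'w::euclidean_space"
  assumes "semi_quasi_polynomial f" "linear A"
  shows "\<exists>g. semi_quasi_polynomial g \<and> (\<forall>t. ((\<lambda>\<epsilon>. f (A t + \<epsilon> *\<^sub>R w)) \<longlongrightarrow> g t) (at_right 0))"
  using assms(1)
proof (induction rule: semi_quasi_polynomial.induct)
  case (polynomial f)
  have "real_polynomial_function (f \<circ> A)"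
    using polynomial assms(2)
    by (intro real_polynomial_function_compose polynomial_function_bounded_linear)
       (auto simp: linear_conv_bounded_linear)
  moreover have "((\<lambda>\<epsilon>. f (A t + \<epsilon> *\<^sub>R w)) \<longlongrightarrow> f (A t)) (at_right 0)" for t
  proof -
    have "isCont f (A t)" by (rule continuous_real_polymonial_function[OF polynomial])
    moreover have "((\<lambda>\<epsilon>. A t + \<epsilon> *\<^sub>R w) \<longlongrightarrow> A t + 0 *\<^sub>R w) (at_right 0)"
      by (intro tendsto_intros)
    ultimately show ?thesis by (auto intro: isCont_tendsto_compose)
  qed
  ultimately show ?case
    using semi_quasi_polynomial.polynomial[of "f \<circ> A"] by (intro exI[of _ "f \<circ> A"]) (auto simp: o_def)
next
  case (fractional_part \<eta>)
  have inner: "\<eta> \<bullet> (A t + \<epsilon> *\<^sub>R w) = adjoint A \<eta> \<bullet> t + \<epsilon> * (\<eta> \<bullet> w)" for t \<epsilon>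
    by (simp add: inner_add_right adjoint_works[OF assms(2)] inner_commute)
  show ?case
  proof (cases "\<eta> \<bullet> w \<ge> 0")
    case True
    then show ?thesis
      unfolding inner using tendsto_frac_right
      by (intro exI[of _ "\<lambda>t. frac (adjoint A \<eta> \<bullet> t)"]) (auto intro: semi_quasi_polynomial.intros)
  next
    case False
    have "semi_quasi_polynomial (\<lambda>t. 1 + - frac ((- adjoint A \<eta>) \<bullet> t))"
      by (intro semi_quasi_polynomial.add semi_quasi_polynomial_const semi_quasi_polynomial_uminus
          semi_quasi_polynomial.fractional_part)
    then show ?thesis
      unfolding inner using tendsto_frac_left[of "\<eta> \<bullet> w"] False
      by (intro exI[of _ "\<lambda>t. 1 + - frac ((- adjoint A \<eta>) \<bullet> t)"]) auto
  qed
next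
  case (add f g)
  then obtain f' g' where *: "semi_quasi_polynomial f'" "semi_quasi_polynomial g'"
    "\<And>t. ((\<lambda>\<epsilon>. f (A t + \<epsilon> *\<^sub>R w)) \<longlongrightarrow> f' t) (at_right 0)"
    "\<And>t. ((\<lambda>\<epsilon>. g (A t + \<epsilon> *\<^sub>R w)) \<longlongrightarrow> g' t) (at_right 0)" by blast
  show ?case
    using semi_quasi_polynomial.add[OF *(1,2)] tendsto_add[OF *(3,4)]
    by (intro exI[of _ "\<lambda>t. f' t + g' t"]) blast
next
  case (mult f g)
  then obtain f' g' where *: "semi_quasi_polynomial f'" "semi_quasi_polynomial g'"
    "\<And>t. ((\<lambda>\<epsilon>. f (A t + \<epsilon> *\<^sub>R w)) \<longlongrightarrow> f' t) (at_right 0)"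
    "\<And>t. ((\<lambda>\<epsilon>. g (A t + \<epsilon> *\<^sub>R w)) \<longlongrightarrow> g' t) (at_right 0)" by blast
  show ?case
    using semi_quasi_polynomial.mult[OF *(1,2)] tendsto_mult[OF *(3,4)]
    by (intro exI[of _ "\<lambda>t. f' t * g' t"]) blast
qed

subsection \<open>Integration over Minkowski families\<close>

lemma product_sigma_finite_coord_measure: "product_sigma_finite (coord_measure k)"
proof (rule product_sigma_finite.intro)
  fix j
  have "countable (\<int> :: real set)" by (simp add: Ints_def)
  then show "sigma_finite_measure (coord_measure k j)"
    by (simp add: coord_measure_def sigma_finite_lborel sigma_finite_measure_count_space_countable)
qed

lemma measurable_coord:
  assumes "j < n"
  shows "(\<lambda>x. x j) \<in> borel_measurable (PiM {..<n} (coord_measure k))"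
proof -
  have "(\<lambda>x. x j) \<in> measurable (PiM {..<n} (coord_measure k)) (coord_measure k j)"
    by (rule measurable_component_singleton) (use assms in simp)
  moreover have "(\<lambda>x. x) \<in> measurable (coord_measure k j) borel"
    by (simp add: coord_measure_def)
  ultimately show ?thesis by (rule measurable_compose)
qed

lemma rational_form_measurable:
  assumes "rational_form n \<phi>"
  shows "\<phi> t \<in> borel_measurable (PiM {..<n} (coord_measure k))"
proof -
  obtain \<eta> \<kappa> q where \<phi>: "\<phi> = (\<lambda>t x. \<eta> \<bullet> t + (\<Sum>j<n. \<kappa> j * x j) + q)"
    using assms unfolding rational_form_def by blast
  show ?thesis
    unfolding \<phi>
    by (intro borel_measurable_add borel_measurable_const borel_measurable_sum
        borel_measurable_times measurable_coord) auto
qed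

lemma qpoly_measurable:
  assumes "qpoly l n f"
  shows "f t \<in> borel_measurable (PiM {..<n} (coord_measure k))"
  using assms
proof (induction rule: qpoly.induct)
  case (form \<phi>)
  then show ?case by (rule rational_form_measurable)
next
  case (frac \<phi>)
  then have "\<phi> t \<in> borel_measurable (PiM {..<n} (coord_measure k))"
    by (intro rational_form_measurable)
  then show ?case
    unfolding frac_def
    by (intro borel_measurable_diff measurable_compose[OF _ borel_measurable_real_floor])
qed auto

lemma qpoly_bounded:
  assumes "qpoly k n f"
  shows "\<exists>C. \<forall>x. (\<forall>j<n. \<bar>x j\<bar> \<le> R) \<longrightarrow> \<bar>f t x\<bar> \<le> C"
  using assms
proof (induction rule: qpoly.induct)
  case (form \<phi>)
  then obtain \<eta> \<kappa> q where \<phi>: "\<phi> = (\<lambda>t x. \<eta> \<bullet> t + (\<Sum>j<n. \<kappa> j * x j) + q)"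
    unfolding rational_form_def by blast
  have "\<bar>\<phi> t x\<bar> \<le> \<bar>\<eta> \<bullet> t\<bar> + (\<Sum>j<n. \<bar>\<kappa> j\<bar> * R) + \<bar>q\<bar>" if "\<forall>j<n. \<bar>x j\<bar> \<le> R" for x
  proof -
    have "\<bar>\<Sum>j<n. \<kappa> j * x j\<bar> \<le> (\<Sum>j<n. \<bar>\<kappa> j\<bar> * R)"
      using that by (intro order_trans[OF sum_abs] sum_mono) (auto simp: abs_mult intro!: mult_left_mono)
    then show ?thesis unfolding \<phi> by linarith
  qed
  then show ?case by blast
next
  case (frac \<phi>)
  have "\<bar>frac (\<phi> t x)\<bar> \<le> 1" for x
    using frac_lt_1[of "\<phi> t x"] frac_ge_0[of "\<phi> t x"] by linarith
  then show ?case by blast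
next
  case (add f g)
  then obtain C D where *: "\<And>x. (\<forall>j<n. \<bar>x j\<bar> \<le> R) \<Longrightarrow> \<bar>f t x\<bar> \<le> C"
    "\<And>x. (\<forall>j<n. \<bar>x j\<bar> \<le> R) \<Longrightarrow> \<bar>g t x\<bar> \<le> D" by blast
  have "\<bar>f t x + g t x\<bar> \<le> C + D" if "\<forall>j<n. \<bar>x j\<bar> \<le> R" for x
    using *[OF that] by linarith
  then show ?case by blast
next
  case (mult f g)
  then obtain C D where *: "\<And>x. (\<forall>j<n. \<bar>x j\<bar> \<le> R) \<Longrightarrow> \<bar>f t x\<bar> \<le> C"
    "\<And>x. (\<forall>j<n. \<bar>x j\<bar> \<le> R) \<Longrightarrow> \<bar>g t x\<bar> \<le> D" by blast
  have "\<bar>f t x * g t x\<bar> \<le> C * D" if "\<forall>j<n. \<bar>x j\<bar> \<le> R" for x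
    unfolding abs_mult using *[OF that] abs_ge_zero[of "f t x"] by (intro mult_mono) auto
  then show ?case by blast
qed auto

lemma finite_Icc_Int_Ints: "finite ({a..b::real} \<inter> \<int>)"
proof -
  have "{a..b} \<inter> \<int> \<subseteq> of_int ` {\<lceil>a\<rceil>..\<lfloor>b\<rfloor>}"
    by (auto elim!: Ints_cases simp: ceiling_le_iff le_floor_iff)
  then show ?thesis by (rule finite_subset) auto
qed

lemma finite_measure_coord_box:
  "(\<Prod>j<n. emeasure (coord_measure k j) ({-R..R} \<inter> space (coord_measure k j))) < \<infinity>"
proof -
  have "emeasure (coord_measure k j) ({-R..R} \<inter> space (coord_measure k j)) < \<infinity>" for j
  proof (cases "j < k")
    case True
    have "finite ({-R..R} \<inter> \<int>)" by (rule finite_Icc_Int_Ints)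
    with True show ?thesis by (simp add: coord_measure_def of_nat_less_top)
  next
    case False
    then show ?thesis by (cases "R \<ge> 0") (auto simp: coord_measure_def)
  qed
  then show ?thesis by (induction n) (auto simp: ennreal_mult_less_top less_top)
qed

lemma in_family_sets:
  assumes "cut_out n p \<Phi>" "\<And>i. 0 < t $ i"
  shows "{x \<in> space (PiM {..<n} (coord_measure k)). in_family n t p x} \<in> sets (PiM {..<n} (coord_measure k))"
proof -
  have "{x \<in> space (PiM {..<n} (coord_measure k)). in_family n t p x} =
      {x \<in> space (PiM {..<n} (coord_measure k)). \<forall>\<phi>\<in>\<Phi>. 0 \<le> \<phi> t x}"
    using assms unfolding cut_out_def by blast
  also have "\<dots> \<in> sets (PiM {..<n} (coord_measure k))"
  proof (rule sets.sets_Collect_finite_All)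
    show "finite \<Phi>" using assms(1) by (simp add: cut_out_def)
    fix \<phi> assume "\<phi> \<in> \<Phi>"
    then have [measurable]: "\<phi> t \<in> borel_measurable (PiM {..<n} (coord_measure k))"
      using assms(1) by (auto simp: cut_out_def intro!: rational_form_measurable homogeneous_form_rational)
    show "{x \<in> space (PiM {..<n} (coord_measure k)). 0 \<le> \<phi> t x} \<in> sets (PiM {..<n} (coord_measure k))"
      by measurable
  qed
  finally show ?thesis .
qed

lemma integrable_on_coord_bounded:
  assumes "qpoly l n f"
    and "{x \<in> space (PiM {..<n} (coord_measure k)). Q x} \<in> sets (PiM {..<n} (coord_measure k))"
    and "\<And>x j. Q x \<Longrightarrow> j < n \<Longrightarrow> \<bar>x j\<bar> \<le> R"
  shows "integrable (PiM {..<n} (coord_measure k)) (\<lambda>x. f t x * of_bool (Q x))"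
proof -
  interpret product_sigma_finite "coord_measure k" by (rule product_sigma_finite_coord_measure)
  let ?M = "PiM {..<n} (coord_measure k)"
  let ?A = "PiE {..<n} (\<lambda>j. {-R..R} \<inter> space (coord_measure k j))"
  have sets: "{-R..R} \<inter> space (coord_measure k j) \<in> sets (coord_measure k j)" for j
    by (simp add: coord_measure_def)
  obtain C where C: "\<And>x. \<forall>j<n. \<bar>x j\<bar> \<le> R \<Longrightarrow> \<bar>f t x\<bar> \<le> C"
    using qpoly_bounded[OF assms(1), of R t] by blast
  show ?thesis
  proof (rule integrableI_bounded_set)
    show "?A \<in> sets ?M" using sets by (intro sets_PiM_I_finite) auto
    show "(\<lambda>x. f t x * of_bool (Q x)) \<in> borel_measurable ?M"
      unfolding of_bool_def
      by (intro borel_measurable_times qpoly_measurable[OF assms(1)] measurable_If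
          borel_measurable_const assms(2))
    show "emeasure ?M ?A < \<infinity>"
      using sets finite_measure_coord_box[where n = n and k = k and R = R] by (subst emeasure_PiM) auto
    show "AE x in ?M. x \<in> ?A \<longrightarrow> norm (f t x * of_bool (Q x)) \<le> \<bar>C\<bar>"
    proof (intro AE_I2 impI)
      fix x assume "x \<in> ?A"
      then have "\<forall>j<n. \<bar>x j\<bar> \<le> R" by (force simp: PiE_iff abs_le_iff)
      from C[OF this] show "norm (f t x * of_bool (Q x)) \<le> \<bar>C\<bar>" by (auto simp: of_bool_def)
    qed
    show "AE x in ?M. x \<notin> ?A \<longrightarrow> f t x * of_bool (Q x) = 0"
    proof (intro AE_I2 impI)
      fix x assume x: "x \<in> space ?M" "x \<notin> ?A"
      have "\<not> Q x"
      proof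
        assume "Q x"
        then have "x \<in> ?A" using x(1) assms(3) by (force simp: space_PiM PiE_iff abs_le_iff)
        with x(2) show False ..
      qed
      then show "f t x * of_bool (Q x) = 0" by simp
    qed
  qed
qed

lemma integrable_family:
  assumes "cut_out n p \<Phi>" "coord_bounded n p" "qpoly l n f" "\<And>i. 0 < t $ i"
  shows "integrable (PiM {..<n} (coord_measure k)) (\<lambda>x. f t x * of_bool (in_family n t p x))"
proof -
  obtain R where "\<And>x j. in_family n t p x \<Longrightarrow> j < n \<Longrightarrow> \<bar>x j\<bar> \<le> R"
    using coord_bounded_family[OF assms(2)] by metis
  then show ?thesis
    by (rule integrable_on_coord_bounded[OF assms(3) in_family_sets[OF assms(1,4)]])
qed

text \<open>Pairing S with \<open>insert a S\<close> for a fixed element a of \<open>A\<close>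
  cancels the sum over all subsets of \<open>A\<close>; leaving out the empty set, which contributes
  -1, gives 1.\<close>

lemma sum_alternating_subsets:
  assumes "finite U" "A \<subseteq> U" "A \<noteq> {}"
  shows "(\<Sum>S\<in>Pow U - {{}}. (- 1 :: real) ^ (card S + 1) * of_bool (S \<subseteq> A)) = 1"
proof -
  have finA: "finite A" using assms finite_subset by blast
  obtain a where a: "a \<in> A" using assms by blast
  let ?B = "A - {a}"
  have "Pow A = Pow ?B \<union> insert a ` Pow ?B"
    using a by (metis Pow_insert insert_Diff)
  then have "(\<Sum>S\<in>Pow A. (- 1 :: real) ^ (card S + 1)) =
      (\<Sum>S\<in>Pow ?B. (- 1) ^ (card S + 1)) + (\<Sum>S\<in>insert a ` Pow ?B. (- 1) ^ (card S + 1))"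
    using finA by (simp only:) (rule sum.union_disjoint, auto)
  also have "(\<Sum>S\<in>insert a ` Pow ?B. (- 1 :: real) ^ (card S + 1)) =
      (\<Sum>S\<in>Pow ?B. (- 1) ^ (card (insert a S) + 1))"
    by (subst sum.reindex) (auto simp: inj_on_def)
  also have "\<dots> = (\<Sum>S\<in>Pow ?B. - ((- 1) ^ (card S + 1)))"
  proof (rule sum.cong[OF refl])
    fix S assume "S \<in> Pow ?B"
    then have "finite S" "a \<notin> S" using finA by (auto intro: finite_subset)
    then show "(- 1 :: real) ^ (card (insert a S) + 1) = - ((- 1) ^ (card S + 1))" by simp
  qed
  finally have zero: "(\<Sum>S\<in>Pow A. (- 1 :: real) ^ (card S + 1)) = 0"
    by (simp add: sum_negf)
  have "(\<Sum>S\<in>Pow U - {{}}. (- 1 :: real) ^ (card S + 1) * of_bool (S \<subseteq> A)) =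
      (\<Sum>S\<in>Pow A - {{}}. (- 1) ^ (card S + 1))"
    using assms by (intro sum.mono_neutral_cong_right) auto
  also have "\<dots> = (\<Sum>S\<in>Pow A. (- 1) ^ (card S + 1)) - (- 1)"
    using finA by (subst sum_diff) auto
  finally show ?thesis using zero by simp
qed

text \<open>Let A be the set of indices attaining \<open>r\<close>. A term survives iff
  \<open>P\<close> holds and S is contained in A, and then its chosen index \<open>c S\<close> also
  attains \<open>r\<close>, so every surviving term carries the same value \<open>G r\<close>. The
  signs sum to 1. The gain is that each term involves a fixed index, although the attaining set
  varies.\<close>

lemma envelope_expansion:
  fixes \<rho> :: "'f \<Rightarrow> real" and G :: "real \<Rightarrow> real"
  assumes "finite U" "P \<Longrightarrow> r \<in> \<rho> ` U"
    and Q: "\<And>S. S \<subseteq> U \<Longrightarrow> S \<noteq> {} \<Longrightarrow> Q S \<longleftrightarrow> P \<and> (\<forall>\<phi>\<in>S. \<rho> \<phi> = r)"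
    and c: "\<And>S. S \<noteq> {} \<Longrightarrow> c S \<in> S"
  shows "of_bool P * G r =
    (\<Sum>S\<in>Pow U - {{}}. (- 1) ^ (card S + 1) * (G (\<rho> (c S)) * of_bool (Q S)))"
proof (cases P)
  case True
  define A where "A = {\<phi> \<in> U. \<rho> \<phi> = r}"
  have "(\<Sum>S\<in>Pow U - {{}}. (- 1) ^ (card S + 1) * (G (\<rho> (c S)) * of_bool (Q S))) =
      (\<Sum>S\<in>Pow U - {{}}. G r * ((- 1) ^ (card S + 1) * of_bool (S \<subseteq> A)))"
  proof (rule sum.cong[OF refl])
    fix S assume "S \<in> Pow U - {{}}"
    then have S: "S \<subseteq> U" "S \<noteq> {}" by auto
    then have "Q S \<longleftrightarrow> S \<subseteq> A" using Q[OF S] True by (auto simp: A_def)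
    moreover have "\<rho> (c S) = r" if "S \<subseteq> A" using that c[OF S(2)] by (auto simp: A_def)
    ultimately show "(- 1) ^ (card S + 1) * (G (\<rho> (c S)) * of_bool (Q S)) =
        G r * ((- 1) ^ (card S + 1) * of_bool (S \<subseteq> A))"
      by (cases "S \<subseteq> A") auto
  qed
  also have "\<dots> = G r * 1"
    unfolding sum_distrib_left[symmetric]
    by (subst sum_alternating_subsets) (use assms(1,2) True in \<open>auto simp: A_def\<close>)
  finally show ?thesis using True by simp
next
  case False
  then have "\<not> Q S" if "S \<subseteq> U" "S \<noteq> {}" for S using Q that by blast
  with False show ?thesis by (simp add: sum.neutral)
qed

text \<open>Induction on the number of coordinates. Integrating the last one leaves values at two
  envelopes, and each term of their expansion is an integral of the same kind over a projected face.
  The statement is therefore needed for all families and all \<open>qpoly\<close> integrands at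
  once.\<close>

lemma family_integral:
  fixes p :: "'q::finite \<Rightarrow> (nat \<Rightarrow> real) set"
    and f :: "real ^ 'q \<Rightarrow> (nat \<Rightarrow> real) \<Rightarrow> real"
  assumes "cut_out n p \<Phi>" "coord_bounded n p" "qpoly k n f"
  shows "\<exists>E. semi_quasi_polynomial E \<and> (\<forall>t. (\<forall>i. 0 < t $ i) \<longrightarrow>
    has_bochner_integral (PiM {..<n} (coord_measure k))
      (\<lambda>x. f t x * of_bool (in_family n t p x)) (E t))"
  using assms
proof (induction n arbitrary: p \<Phi> f)
  case 0
  \<comment> \<open>The product over the empty index set is a unit mass at the function that is
    \<open>undefined\<close> everywhere.\<close>
  let ?u = "\<lambda>_::nat. undefined :: real"
  have iff: "in_family 0 t p x \<longleftrightarrow> (\<forall>i. p i \<noteq> {})" for t x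
    unfolding in_family_def ex_in_conv[symmetric] choice_iff by simp
  have "has_bochner_integral (PiM {..<0} (coord_measure k))
      (\<lambda>x. f t x * of_bool (in_family 0 t p x)) (f t ?u * of_bool (\<forall>i. p i \<noteq> {}))"
    if "\<forall>i. 0 < t $ i" for t
    using integrable_family[OF 0, of t k] that
    by (simp add: has_bochner_integral_iff PiM_empty lebesgue_integral_count_space_finite iff)
  moreover have "semi_quasi_polynomial (\<lambda>t. f t ?u * of_bool (\<forall>i. p i \<noteq> {}))"
    by (intro semi_quasi_polynomial.mult qpoly_0_semi_quasi_polynomial[OF 0(3)]
        semi_quasi_polynomial_const)
  ultimately show ?case by blast
next
  case (Suc n)
  let ?M = "coord_measure k"
  show ?case
  proof (cases "\<forall>i. p i \<noteq> {}")
    case False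
    then have "\<not> in_family (Suc n) t p x" for t x by (auto simp: in_family_def)
    then show ?thesis
      by (intro exI[of _ "\<lambda>_. 0"]) (simp add: semi_quasi_polynomial_const has_bochner_integral_zero)
  next
    case True
    have "\<forall>\<phi>\<in>\<Phi>. \<exists>\<psi> \<kappa>. homogeneous_form n \<psi> \<and> \<kappa> \<in> \<rat> \<and> (\<forall>t x s. \<phi> t (x(n := s)) = \<psi> t x + \<kappa> * s)"
      using Suc.prems(1) homogeneous_form_Suc unfolding cut_out_def by blast
    then obtain \<psi> \<kappa> where psi: "\<And>\<phi>. \<phi> \<in> \<Phi> \<Longrightarrow> homogeneous_form n (\<psi> \<phi>)"
      "\<And>\<phi>. \<phi> \<in> \<Phi> \<Longrightarrow> \<kappa> \<phi> \<in> \<rat>"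
      "\<And>\<phi> t x s. \<phi> \<in> \<Phi> \<Longrightarrow> \<phi> t (x(n := s)) = \<psi> \<phi> t x + \<kappa> \<phi> * s"
      by metis
    define U where "U = {\<phi> \<in> \<Phi>. \<kappa> \<phi> < 0}"
    define L where "L = {\<phi> \<in> \<Phi>. \<kappa> \<phi> > 0}"
    define \<rho> where "\<rho> = (\<lambda>\<phi> t x. (- 1 / \<kappa> \<phi>) * \<psi> \<phi> t x)"
    have sub: "U \<subseteq> \<Phi>" "L \<subseteq> \<Phi>" and finPhi: "finite \<Phi>"
      using Suc.prems(1) by (auto simp: U_def L_def cut_out_def)
    have fin: "finite U" "finite L" using sub finPhi finite_subset by blast+
    have rho_form: "rational_form n (\<rho> \<phi>)" if "\<phi> \<in> \<Phi>" for \<phi>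
      unfolding \<rho>_def using psi(1,2)[OF that]
      by (intro rational_form_scale homogeneous_form_rational Rats_divide) auto
    have zero_iff: "\<phi> t (x(n := s)) = 0 \<longleftrightarrow> s = \<rho> \<phi> t x" if "\<phi> \<in> U \<union> L" for \<phi> t x s
      using that psi(3)[of \<phi> t x s] sub
      by (auto simp: U_def L_def \<rho>_def field_simps simp del: fun_upd_apply)
    have upper: "0 \<le> \<phi> t (x(n := s)) \<longleftrightarrow> s \<le> \<rho> \<phi> t x" if "\<phi> \<in> U" for \<phi> t x s
      using that psi(3)[of \<phi> t x s]
      by (auto simp: U_def \<rho>_def field_simps simp del: fun_upd_apply)
    have lower: "0 \<le> \<phi> t (x(n := s)) \<longleftrightarrow> \<rho> \<phi> t x \<le> s" if "\<phi> \<in> L" for \<phi> t x s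
      using that psi(3)[of \<phi> t x s]
      by (auto simp: L_def \<rho>_def field_simps simp del: fun_upd_apply)
    have mem: "in_family (Suc n) t p (x(n := s)) \<longleftrightarrow> (\<forall>\<phi>\<in>\<Phi>. 0 \<le> \<phi> t (x(n := s)))"
      if "\<forall>i. 0 < t $ i" for t x s
      using Suc.prems(1) that by (simp add: cut_out_def)
    \<comment> \<open>Forms with coefficient 0 at the last coordinate do not see s, so their
      validity carries over from the given point; the others are governed by the two families of
      bounds.\<close>
    have change: "in_family (Suc n) t p (x(n := s'))"
      if t: "\<forall>i. 0 < t $ i" and s: "in_family (Suc n) t p (x(n := s))"
        and "\<forall>\<phi>\<in>U. s' \<le> \<rho> \<phi> t x" "\<forall>\<phi>\<in>L. \<rho> \<phi> t x \<le> s'" for t x s s'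
      unfolding mem[OF t]
    proof
      fix \<phi> assume phi: "\<phi> \<in> \<Phi>"
      consider "\<phi> \<in> U" | "\<phi> \<in> L" | "\<kappa> \<phi> = 0" using phi by (force simp: U_def L_def)
      then show "0 \<le> \<phi> t (x(n := s'))"
      proof cases
        case 3
        then have "\<phi> t (x(n := s')) = \<phi> t (x(n := s))" using psi(3)[OF phi] by simp
        with s phi show ?thesis unfolding mem[OF t] by simp
      qed (use that upper lower in blast)+
    qed
    have range: "in_family (Suc n) t p (x(n := s')) \<longleftrightarrow>
        (\<forall>\<phi>\<in>U. s' \<le> \<rho> \<phi> t x) \<and> (\<forall>\<phi>\<in>L. \<rho> \<phi> t x \<le> s')"
      if t: "\<forall>i. 0 < t $ i" and "in_family (Suc n) t p (x(n := s))" for t x s s'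
      using change[OF that] mem[OF t] upper lower sub by blast
    \<comment> \<open>Without upper bounds the last coordinate could be raised beyond the bound
      \<open>R\<close>, and similarly downwards. One positive t is enough to see this, because
      \<open>U\<close> and \<open>L\<close> do not depend on t.\<close>
    have ne: "U \<noteq> {}" "L \<noteq> {}"
    proof -
      define t :: "real ^ 'q" where "t = (\<chi> i. 1)"
      have t: "\<forall>i. 0 < t $ i" by (simp add: t_def)
      obtain R where R: "\<And>x j. in_family (Suc n) t p x \<Longrightarrow> j < Suc n \<Longrightarrow> \<bar>x j\<bar> \<le> R"
        using coord_bounded_family[OF Suc.prems(2)] by metis
      define y where "y = (\<lambda>i. SOME z. z \<in> p i)"
      define x where "x = (\<lambda>j. \<Sum>i\<in>UNIV. t $ i * y i j)"
      have "\<And>i. y i \<in> p i" using True by (simp add: y_def some_in_eq)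
      then have "in_family (Suc n) t p x" unfolding in_family_def x_def by blast
      then have x: "in_family (Suc n) t p (x(n := x n))" by simp
      show "U \<noteq> {}"
      proof
        assume "U = {}"
        then have "in_family (Suc n) t p (x(n := Max (insert (R + 1) ((\<lambda>\<phi>. \<rho> \<phi> t x) ` L))))"
          unfolding range[OF t x] using fin by simp
        from R[OF this, of n] have "\<bar>Max (insert (R + 1) ((\<lambda>\<phi>. \<rho> \<phi> t x) ` L))\<bar> \<le> R" by simp
        moreover have "R + 1 \<le> Max (insert (R + 1) ((\<lambda>\<phi>. \<rho> \<phi> t x) ` L))"
          using fin by (intro Max_ge) auto
        ultimately show False by linarith
      qed
      show "L \<noteq> {}"
      proof
        assume "L = {}"
        then have "in_family (Suc n) t p (x(n := Min (insert (- R - 1) ((\<lambda>\<phi>. \<rho> \<phi> t x) ` U))))"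
          unfolding range[OF t x] using fin by simp
        from R[OF this, of n] have "\<bar>Min (insert (- R - 1) ((\<lambda>\<phi>. \<rho> \<phi> t x) ` U))\<bar> \<le> R" by simp
        moreover have "Min (insert (- R - 1) ((\<lambda>\<phi>. \<rho> \<phi> t x) ` U)) \<le> - R - 1"
          using fin by (intro Min_le) auto
        ultimately show False by linarith
      qed
    qed
    define up where "up = (\<lambda>t x. Min ((\<lambda>\<phi>. \<rho> \<phi> t x) ` U))"
    define lo where "lo = (\<lambda>t x. Max ((\<lambda>\<phi>. \<rho> \<phi> t x) ` L))"
    have interval: "in_family (Suc n) t p (x(n := s)) \<longleftrightarrow> in_family n t p x \<and> s \<in> {lo t x..up t x}"
      if t: "\<forall>i. 0 < t $ i" for t x s
    proof (cases "in_family n t p x")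
      case True
      then obtain s0 where "in_family (Suc n) t p (x(n := s0))" using in_family_Suc by blast
      from range[OF t this] True show ?thesis
        using fin ne by (auto simp: up_def lo_def)
    next
      case False
      then show ?thesis using in_family_Suc by blast
    qed
    have lo_up: "lo t x \<le> up t x" if "\<forall>i. 0 < t $ i" "in_family n t p x" for t x
      using interval[OF that(1)] that(2) in_family_Suc[of n t p x] by force
    have up_mem: "up t x \<in> (\<lambda>\<phi>. \<rho> \<phi> t x) ` U" and lo_mem: "lo t x \<in> (\<lambda>\<phi>. \<rho> \<phi> t x) ` L" for t x
      using fin ne by (auto simp: up_def lo_def intro!: Min_in Max_in)
    \<comment> \<open>A form of S vanishes at (x, s) iff its bound equals s. So the fibre of the
      face over x is a single point, the common value of the bounds, if it lies in the
      interval.\<close>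
    have face: "in_family n t (family_face p S) x \<longleftrightarrow>
        (\<exists>s. in_family n t p x \<and> s \<in> {lo t x..up t x} \<and> (\<forall>\<phi>\<in>S. \<rho> \<phi> t x = s))"
      if t: "\<forall>i. 0 < t $ i" and S: "S \<subseteq> U \<union> L" for t S x
    proof -
      have "in_family n t (family_face p S) x \<longleftrightarrow>
          (\<exists>s. in_family (Suc n) t p (x(n := s)) \<and> (\<forall>\<phi>\<in>S. \<phi> t (x(n := s)) = 0))"
        unfolding in_family_Suc[of n t "family_face p S" x]
        using in_family_face[OF Suc.prems(1), of S t] S sub t by blast
      also have "\<dots> \<longleftrightarrow> (\<exists>s. in_family n t p x \<and> s \<in> {lo t x..up t x} \<and> (\<forall>\<phi>\<in>S. \<rho> \<phi> t x = s))"
      proof -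
        have "(\<forall>\<phi>\<in>S. \<phi> t (x(n := s)) = 0) \<longleftrightarrow> (\<forall>\<phi>\<in>S. \<rho> \<phi> t x = s)" for s
          by (intro ball_cong refl) (use zero_iff S in auto)
        then show ?thesis unfolding interval[OF t] by (simp only: conj_assoc)
      qed
      finally show ?thesis .
    qed
    have face_up: "in_family n t (family_face p S) x \<longleftrightarrow> in_family n t p x \<and> (\<forall>\<phi>\<in>S. \<rho> \<phi> t x = up t x)"
      if t: "\<forall>i. 0 < t $ i" and S: "S \<subseteq> U" "S \<noteq> {}" for t S x
    proof -
      \<comment> \<open>The common value s of the bounds in S satisfies s \<le>
        \<open>up t x\<close> by membership in the family and \<open>up t x\<close> \<le> s because
        S consists of upper bounds. Nonemptiness of S is needed to have such a bound.\<close>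
      have SS: "S \<subseteq> U \<union> L" using S by blast
      have bound: "up t x \<le> \<rho> \<phi> t x" if "\<phi> \<in> S" for \<phi>
        using that S fin by (auto simp: up_def)
      show ?thesis
        unfolding face[OF t SS]
      proof safe
        fix s \<phi> assume s: "s \<in> {lo t x..up t x}" "\<forall>\<phi>\<in>S. \<rho> \<phi> t x = s" and phi: "\<phi> \<in> S"
        with bound[OF phi] show "\<rho> \<phi> t x = up t x" by simp
      next
        assume "in_family n t p x" "\<forall>\<phi>\<in>S. \<rho> \<phi> t x = up t x"
        then show "\<exists>s. in_family n t p x \<and> s \<in> {lo t x..up t x} \<and> (\<forall>\<phi>\<in>S. \<rho> \<phi> t x = s)"
          using lo_up[OF t, of x] by (intro exI[of _ "up t x"]) simp
      qed
    qed
    have face_lo: "in_family n t (family_face p S) x \<longleftrightarrow> in_family n t p x \<and> (\<forall>\<phi>\<in>S. \<rho> \<phi> t x = lo t x)"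
      if t: "\<forall>i. 0 < t $ i" and S: "S \<subseteq> L" "S \<noteq> {}" for t S x
    proof -
      have SS: "S \<subseteq> U \<union> L" using S by blast
      have bound: "\<rho> \<phi> t x \<le> lo t x" if "\<phi> \<in> S" for \<phi>
        using that S fin by (auto simp: lo_def)
      show ?thesis
        unfolding face[OF t SS]
      proof safe
        fix s \<phi> assume s: "s \<in> {lo t x..up t x}" "\<forall>\<phi>\<in>S. \<rho> \<phi> t x = s" and phi: "\<phi> \<in> S"
        with bound[OF phi] show "\<rho> \<phi> t x = lo t x" by simp
      next
        assume "in_family n t p x" "\<forall>\<phi>\<in>S. \<rho> \<phi> t x = lo t x"
        then show "\<exists>s. in_family n t p x \<and> s \<in> {lo t x..up t x} \<and> (\<forall>\<phi>\<in>S. \<rho> \<phi> t x = s)"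
          using lo_up[OF t, of x] by (intro exI[of _ "lo t x"]) simp
      qed
    qed
    obtain F G where F: "\<And>\<rho>. rational_form n \<rho> \<Longrightarrow> qpoly k n (\<lambda>t x. F t x (\<rho> t x))"
      and G: "\<And>\<rho>. rational_form n \<rho> \<Longrightarrow> qpoly k n (\<lambda>t x. G t x (\<rho> t x))"
      and FG: "\<And>t x l r. l \<le> r \<Longrightarrow>
        (\<integral>s. f t (x(n := s)) * indicator {l..r} s \<partial>?M n) = F t x r + G t x l"
      using integrate_last_coordinate[OF Suc.prems(3)] by blast
    define c :: "(real ^ 'q \<Rightarrow> (nat \<Rightarrow> real) \<Rightarrow> real) set \<Rightarrow> _" where "c = (\<lambda>S. SOME \<phi>. \<phi> \<in> S)"
    have c: "c S \<in> S" if "S \<noteq> {}" for S using that by (simp add: c_def some_in_eq)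
    \<comment> \<open>The face is first described with all \<open>Suc n\<close> coordinates, where
      its forms live, and only then projected; the result is a bounded family in n
      coordinates.\<close>
    have IH: "\<exists>E. semi_quasi_polynomial E \<and> (\<forall>t. (\<forall>i. 0 < t $ i) \<longrightarrow>
        has_bochner_integral (PiM {..<n} ?M)
          (\<lambda>x. H t x (\<rho> (c S) t x) * of_bool (in_family n t (family_face p S) x)) (E t))"
      if S: "S \<subseteq> \<Phi>" "S \<noteq> {}"
        and H: "\<And>\<rho>. rational_form n \<rho> \<Longrightarrow> qpoly k n (\<lambda>t x. H t x (\<rho> t x))" for S H
    proof -
      obtain \<Phi>' where "cut_out n (family_face p S) \<Phi>'"
        using cut_out_project[OF cut_out_face[OF Suc.prems(1) S(1)]] by blast
      moreover have "coord_bounded n (family_face p S)"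
        by (rule coord_bounded_mono[OF Suc.prems(2)]) (auto simp: family_face_def)
      moreover have "qpoly k n (\<lambda>t x. H t x (\<rho> (c S) t x))"
        using c[OF S(2)] S(1) by (intro H rho_form) auto
      ultimately show ?thesis by (rule Suc.IH)
    qed
    have "\<forall>S\<in>Pow U - {{}}. \<exists>E. semi_quasi_polynomial E \<and> (\<forall>t. (\<forall>i. 0 < t $ i) \<longrightarrow>
        has_bochner_integral (PiM {..<n} ?M)
          (\<lambda>x. F t x (\<rho> (c S) t x) * of_bool (in_family n t (family_face p S) x)) (E t))"
    proof
      fix S assume "S \<in> Pow U - {{}}"
      with sub have "S \<subseteq> \<Phi>" "S \<noteq> {}" by auto
      then show "\<exists>E. semi_quasi_polynomial E \<and> (\<forall>t. (\<forall>i. 0 < t $ i) \<longrightarrow>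
        has_bochner_integral (PiM {..<n} ?M)
          (\<lambda>x. F t x (\<rho> (c S) t x) * of_bool (in_family n t (family_face p S) x)) (E t))"
        by (rule IH[OF _ _ F])
    qed
    from bchoice[OF this] obtain EU where EU: "\<And>S. S \<in> Pow U - {{}} \<Longrightarrow> semi_quasi_polynomial (EU S)"
      "\<And>S t. S \<in> Pow U - {{}} \<Longrightarrow> (\<forall>i. 0 < t $ i) \<Longrightarrow> has_bochner_integral (PiM {..<n} ?M)
          (\<lambda>x. F t x (\<rho> (c S) t x) * of_bool (in_family n t (family_face p S) x)) (EU S t)"
      by blast
    have "\<forall>S\<in>Pow L - {{}}. \<exists>E. semi_quasi_polynomial E \<and> (\<forall>t. (\<forall>i. 0 < t $ i) \<longrightarrow>
        has_bochner_integral (PiM {..<n} ?M)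
          (\<lambda>x. G t x (\<rho> (c S) t x) * of_bool (in_family n t (family_face p S) x)) (E t))"
    proof
      fix S assume "S \<in> Pow L - {{}}"
      with sub have "S \<subseteq> \<Phi>" "S \<noteq> {}" by auto
      then show "\<exists>E. semi_quasi_polynomial E \<and> (\<forall>t. (\<forall>i. 0 < t $ i) \<longrightarrow>
        has_bochner_integral (PiM {..<n} ?M)
          (\<lambda>x. G t x (\<rho> (c S) t x) * of_bool (in_family n t (family_face p S) x)) (E t))"
        by (rule IH[OF _ _ G])
    qed
    from bchoice[OF this] obtain EL where EL: "\<And>S. S \<in> Pow L - {{}} \<Longrightarrow> semi_quasi_polynomial (EL S)"
      "\<And>S t. S \<in> Pow L - {{}} \<Longrightarrow> (\<forall>i. 0 < t $ i) \<Longrightarrow> has_bochner_integral (PiM {..<n} ?M)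
          (\<lambda>x. G t x (\<rho> (c S) t x) * of_bool (in_family n t (family_face p S) x)) (EL S t)"
      by blast
    define E where "E = (\<lambda>t. (\<Sum>S\<in>Pow U - {{}}. (- 1) ^ (card S + 1) * EU S t) +
      (\<Sum>S\<in>Pow L - {{}}. (- 1) ^ (card S + 1) * EL S t))"
    have "semi_quasi_polynomial E"
      unfolding E_def using fin
      by (intro semi_quasi_polynomial.add semi_quasi_polynomial_sum
          semi_quasi_polynomial.mult[OF semi_quasi_polynomial_const] EU(1) EL(1)) auto
    moreover have "has_bochner_integral (PiM {..<Suc n} ?M)
        (\<lambda>x. f t x * of_bool (in_family (Suc n) t p x)) (E t)" if t: "\<forall>i. 0 < t $ i" for t
    proof -
      interpret product_sigma_finite ?M by (rule product_sigma_finite_coord_measure)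
      have inner: "(\<integral>s. f t (x(n := s)) * of_bool (in_family (Suc n) t p (x(n := s))) \<partial>?M n) =
          (\<Sum>S\<in>Pow U - {{}}. (- 1) ^ (card S + 1) *
            (F t x (\<rho> (c S) t x) * of_bool (in_family n t (family_face p S) x))) +
          (\<Sum>S\<in>Pow L - {{}}. (- 1) ^ (card S + 1) *
            (G t x (\<rho> (c S) t x) * of_bool (in_family n t (family_face p S) x)))" for x
      proof -
        have "(\<integral>s. f t (x(n := s)) * of_bool (in_family (Suc n) t p (x(n := s))) \<partial>?M n) =
            of_bool (in_family n t p x) * (F t x (up t x) + G t x (lo t x))"
        proof (cases "in_family n t p x")
          case True
          have "of_bool (in_family (Suc n) t p (x(n := s))) = (indicator {lo t x..up t x} s :: real)" for s
            unfolding interval[OF t] using True by (simp add: indicator_def)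
          then show ?thesis using FG[OF lo_up[OF t True]] True by simp
        next
          case False
          then show ?thesis unfolding interval[OF t] by simp
        qed
        also have "\<dots> = of_bool (in_family n t p x) * F t x (up t x) +
            of_bool (in_family n t p x) * G t x (lo t x)"
          by (rule distrib_left)
        also have "of_bool (in_family n t p x) * F t x (up t x) =
          (\<Sum>S\<in>Pow U - {{}}. (- 1) ^ (card S + 1) *
            (F t x (\<rho> (c S) t x) * of_bool (in_family n t (family_face p S) x)))"
          by (rule envelope_expansion[where \<rho> = "\<lambda>\<phi>. \<rho> \<phi> t x"]) (use fin up_mem face_up t c in auto)
        also have "of_bool (in_family n t p x) * G t x (lo t x) =
          (\<Sum>S\<in>Pow L - {{}}. (- 1) ^ (card S + 1) *
            (G t x (\<rho> (c S) t x) * of_bool (in_family n t (family_face p S) x)))"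
          by (rule envelope_expansion[where \<rho> = "\<lambda>\<phi>. \<rho> \<phi> t x"]) (use fin lo_mem face_lo t c in auto)
        finally show ?thesis .
      qed
      \<comment> \<open>Joint integrability, required by Fubini, comes from boundedness of the
        family and not from the iterated integral.\<close>
      have int: "integrable (PiM {..<Suc n} ?M) (\<lambda>x. f t x * of_bool (in_family (Suc n) t p x))"
        using integrable_family[OF Suc.prems] t by blast
      then have "integrable (PiM (insert n {..<n}) ?M) (\<lambda>x. f t x * of_bool (in_family (Suc n) t p x))"
        by (simp only: lessThan_Suc)
      from product_integral_insert[OF _ _ this]
      have "(\<integral>x. f t x * of_bool (in_family (Suc n) t p x) \<partial>PiM {..<Suc n} ?M) =
        (\<integral>x. (\<integral>s. f t (x(n := s)) * of_bool (in_family (Suc n) t p (x(n := s))) \<partial>?M n) \<partial>PiM {..<n} ?M)"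
        by (simp only: lessThan_Suc) simp
      also have "\<dots> = E t"
        unfolding inner E_def
        by (intro has_bochner_integral_integral_eq has_bochner_integral_add has_bochner_integral_sum
            has_bochner_integral_mult_right EU(2) EL(2) t)
      finally show ?thesis using int by (simp add: has_bochner_integral_iff)
    qed
    ultimately show ?thesis by blast
  qed
qed

subsection \<open>Lattice bases adapted to a rational subspace\<close>

lemma lattice_basis_finite: "lattice_basis B \<Gamma> W \<Longrightarrow> finite B"
  by (auto simp: lattice_basis_def intro: independent_imp_finite)

lemma lattice_basis_mem:
  assumes "lattice_basis B \<Gamma> W"
  shows "v \<in> \<Gamma> \<longleftrightarrow> (\<exists>c :: 'a::euclidean_space \<Rightarrow> int. v = (\<Sum>b\<in>B. of_int (c b) *\<^sub>R b))"
  using assms unfolding lattice_basis_def by auto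

lemma lattice_basis_subset:
  fixes B :: "'a::euclidean_space set"
  assumes "lattice_basis B \<Gamma> W" "b \<in> B"
  shows "b \<in> \<Gamma>"
proof -
  have "(\<Sum>c\<in>B. of_int (if c = b then 1 else 0) *\<^sub>R c) = b"
    using assms lattice_basis_finite[OF assms(1)]
    by (simp add: if_distrib[of "\<lambda>x. x *\<^sub>R _"] if_distrib[of of_int] cong: if_cong)
  then show ?thesis
    unfolding lattice_basis_mem[OF assms(1)] by (intro exI[of _ "\<lambda>c. if c = b then 1 else 0"]) simp
qed

lemma lattice_add:
  fixes \<Gamma> :: "'a::euclidean_space set"
  assumes "lattice_basis B \<Gamma> W" "v \<in> \<Gamma>" "w \<in> \<Gamma>"
  shows "v + of_int m *\<^sub>R w \<in> \<Gamma>"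
proof -
  from assms(2,3) obtain c d :: "'a \<Rightarrow> int" where
    "v = (\<Sum>b\<in>B. of_int (c b) *\<^sub>R b)" "w = (\<Sum>b\<in>B. of_int (d b) *\<^sub>R b)"
    unfolding lattice_basis_mem[OF assms(1)] by blast
  then have "v + of_int m *\<^sub>R w = (\<Sum>b\<in>B. of_int (c b + m * d b) *\<^sub>R b)"
    by (simp add: scaleR_sum_right sum.distrib[symmetric] scaleR_add_left)
  then show ?thesis unfolding lattice_basis_mem[OF assms(1)] by (rule exI[of _ "\<lambda>b. c b + m * d b"])
qed

text \<open>The coefficient functions with respect to the lattice basis are linear, hence bounded on
  \<open>S\<close>, so the integer coefficient vectors of lattice points in \<open>S\<close> lie in
  a finite box.\<close>

lemma lattice_bounded_finite:
  fixes \<Lambda> :: "'a::euclidean_space set"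
  assumes "lattice_basis B \<Lambda> UNIV" "bounded S"
  shows "finite (\<Lambda> \<inter> S)"
proof -
  have ind: "independent B" and span: "span B = UNIV" and fin: "finite B"
    using assms(1) lattice_basis_finite by (auto simp: lattice_basis_def)
  have lin: "linear (\<lambda>v. representation B v b)" for b
    by (rule linearI) (simp_all add: real_vector.representation_add real_vector.representation_scale
      ind span)
  obtain R where R: "\<And>v. v \<in> S \<Longrightarrow> norm v \<le> R" using assms(2) by (auto simp: bounded_iff)
  have "\<exists>K. \<forall>v\<in>S. \<bar>representation B v b\<bar> \<le> K" for b
  proof -
    obtain C where "\<And>v. norm (representation B v b) \<le> C * norm v"
      using linear_bounded[OF lin] by blast
    then have C: "\<bar>representation B v b\<bar> \<le> C * norm v" for v by simp
    have "\<bar>representation B v b\<bar> \<le> \<bar>C\<bar> * R" if "v \<in> S" for v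
    proof -
      have "C * norm v \<le> \<bar>C\<bar> * norm v" by (intro mult_right_mono) auto
      also have "\<dots> \<le> \<bar>C\<bar> * R" using R[OF that] by (intro mult_left_mono) auto
      finally show ?thesis using C[of v] by linarith
    qed
    then show ?thesis by blast
  qed
  then obtain K where K: "\<And>v b. v \<in> S \<Longrightarrow> \<bar>representation B v b\<bar> \<le> K b" by metis
  let ?F = "PiE B (\<lambda>b. {- \<lceil>K b\<rceil>..\<lceil>K b\<rceil>})"
  have "\<Lambda> \<inter> S \<subseteq> (\<lambda>c. \<Sum>b\<in>B. of_int (c b) *\<^sub>R b) ` ?F"
  proof
    fix v assume v: "v \<in> \<Lambda> \<inter> S"
    then obtain c :: "'a \<Rightarrow> int" where c: "v = (\<Sum>b\<in>B. of_int (c b) *\<^sub>R b)"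
      unfolding Int_iff lattice_basis_mem[OF assms(1)] by blast
    have "representation B v b = of_int (c b)" if "b \<in> B" for b
      unfolding c using that fin
      by (simp add: linear_sum[OF lin] linear_cmul[OF lin] real_vector.representation_basis[OF ind]
          mult_delta_right)
    then have cK: "\<bar>of_int (c b)\<bar> \<le> K b" if "b \<in> B" for b
      using K[of v b] v that by simp
    have "restrict c B \<in> ?F"
    proof (rule restrict_PiE_iff[THEN iffD2, rule_format])
      fix b assume "b \<in> B"
      from cK[OF this] show "c b \<in> {- \<lceil>K b\<rceil>..\<lceil>K b\<rceil>}"
        unfolding atLeastAtMost_iff by linarith
    qed
    from imageI[OF this, of "\<lambda>c. \<Sum>b\<in>B. of_int (c b) *\<^sub>R b"]
    show "v \<in> (\<lambda>c. \<Sum>b\<in>B. of_int (c b) *\<^sub>R b) ` ?F" unfolding c by simp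
  qed
  moreover have "finite ?F" using fin by (intro finite_PiE) auto
  ultimately show ?thesis by (blast intro: finite_subset)
qed

text \<open>The new basis vector is a lattice vector with the least positive coefficient at \<open>c\<close>.  It
  exists since reduction modulo \<open>B\<close> brings the candidates into a bounded set.\<close>

lemma lattice_basis_extend_step:
  fixes \<Lambda> :: "'a::euclidean_space set"
  assumes \<Lambda>: "lattice_basis A \<Lambda> UNIV" and B: "lattice_basis B (S \<inter> \<Lambda>) S"
    and c: "c \<in> \<Lambda>" "c \<notin> S"
  shows "\<exists>b. b \<notin> B \<and> lattice_basis (insert b B) (span (insert c S) \<inter> \<Lambda>) (span (insert c S))"
proof -
  have indB: "independent B" and spanB: "span B = S" and finB: "finite B"
    using B lattice_basis_finite by (auto simp: lattice_basis_def)
  have subS: "subspace S" using spanB subspace_span by metis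
  define T where "T = span (insert c S)"
  have subT: "subspace T" by (simp add: T_def subspace_span)
  have cT: "c \<in> T" by (simp add: T_def span_base)
  have ST: "S \<subseteq> T" by (auto simp: T_def intro: span_base)
  have uniq: "k = l" if "v - k *\<^sub>R c \<in> S" "v - l *\<^sub>R c \<in> S" for v k l
  proof (rule ccontr)
    assume "k \<noteq> l"
    have "(v - k *\<^sub>R c) - (v - l *\<^sub>R c) \<in> S" by (rule subspace_diff[OF subS that])
    then have "(l - k) *\<^sub>R c \<in> S" by (simp add: scaleR_diff_left)
    then have "(1 / (l - k)) *\<^sub>R (l - k) *\<^sub>R c \<in> S" by (rule subspace_scale[OF subS])
    with \<open>k \<noteq> l\<close> c(2) show False by simp
  qed
  have ex: "\<exists>k. v - k *\<^sub>R c \<in> S" if "v \<in> T" for v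
    using that unfolding T_def span_breakdown_eq by (simp add: span_eq_iff[THEN iffD2, OF subS])
  \<comment> \<open>The coefficients at \<open>c\<close>, modulo S, of lattice vectors, restricted
    to (0, 1]. The vector \<open>c\<close> itself contributes 1, so a least element exists once
    finiteness is shown.\<close>
  define D where "D = {k. 0 < k \<and> k \<le> 1 \<and> (\<exists>v\<in>\<Lambda>. v - k *\<^sub>R c \<in> S)}"
  have "finite D"
  proof -
    \<comment> \<open>After subtraction of the integer parts of the S-component, the vector is k c
      plus a combination of \<open>B\<close> with coefficients in [0, 1); with 0 < k \<le> 1 its
      norm is at most this.\<close>
    let ?R = "norm c + (\<Sum>b\<in>B. norm b)"
    have "\<exists>v\<in>\<Lambda> \<inter> cball 0 ?R. v - k *\<^sub>R c \<in> S" if k: "k \<in> D" for k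
    proof -
      from k obtain v where v: "v \<in> \<Lambda>" "v - k *\<^sub>R c \<in> S" "0 < k" "k \<le> 1"
        by (auto simp: D_def)
      then have "v - k *\<^sub>R c \<in> span B" by (simp add: spanB)
      then obtain u where u: "v - k *\<^sub>R c = (\<Sum>b\<in>B. u b *\<^sub>R b)"
        using finB by (auto simp: span_finite)
      define s where "s = (\<Sum>b\<in>B. of_int \<lfloor>u b\<rfloor> *\<^sub>R b)"
      have s: "s \<in> S \<inter> \<Lambda>"
        unfolding lattice_basis_mem[OF B] s_def by (rule exI[of _ "\<lambda>b. \<lfloor>u b\<rfloor>"]) simp
      have "v - s = k *\<^sub>R c + (\<Sum>b\<in>B. frac (u b) *\<^sub>R b)"
        using u by (simp add: s_def frac_def scaleR_diff_left sum_subtractf algebra_simps)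
      also have "norm \<dots> \<le> norm (k *\<^sub>R c) + (\<Sum>b\<in>B. norm (frac (u b) *\<^sub>R b))"
        by (intro norm_triangle_mono order_refl sum_norm_le)
      also have "\<dots> \<le> ?R"
      proof (intro add_mono sum_mono)
        show "norm (k *\<^sub>R c) \<le> norm c" using v(3,4) by (simp add: mult_left_le_one_le)
        show "norm (frac (u b) *\<^sub>R b) \<le> norm b" for b
          using frac_lt_1[of "u b"] frac_ge_0[of "u b"] by (simp add: mult_left_le_one_le)
      qed
      finally have "v - s \<in> cball 0 ?R" by simp
      moreover have "v - s \<in> \<Lambda>" using lattice_add[OF \<Lambda> v(1), of s "- 1"] s by simp
      moreover have "(v - s) - k *\<^sub>R c \<in> S"
      proof -
        have "(v - k *\<^sub>R c) - s \<in> S" using subspace_diff[OF subS v(2)] s by blast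
        then show ?thesis by (simp add: algebra_simps)
      qed
      ultimately show ?thesis by blast
    qed
    then have ex_v: "\<exists>v\<in>\<Lambda> \<inter> cball 0 ?R. v - k *\<^sub>R c \<in> S" if "k \<in> D" for k
      using that by blast
    have "D \<subseteq> (\<lambda>v. THE k. v - k *\<^sub>R c \<in> S) ` (\<Lambda> \<inter> cball 0 ?R)"
    proof
      fix k assume "k \<in> D"
      then obtain v where v: "v \<in> \<Lambda> \<inter> cball 0 ?R" "v - k *\<^sub>R c \<in> S" using ex_v by blast
      have "(THE k. v - k *\<^sub>R c \<in> S) = k"
        by (rule the_equality) (use v(2) uniq in blast)+
      with v(1) show "k \<in> (\<lambda>v. THE k. v - k *\<^sub>R c \<in> S) ` (\<Lambda> \<inter> cball 0 ?R)" by blast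
    qed
    moreover have "finite (\<Lambda> \<inter> cball 0 ?R)" by (rule lattice_bounded_finite[OF \<Lambda> bounded_cball])
    ultimately show ?thesis using finite_surj by blast
  qed
  have "1 \<in> D" using c(1) subspace_0[OF subS] by (auto simp: D_def intro!: bexI[of _ c])
  define k0 where "k0 = Min D"
  have k0: "k0 \<in> D" "\<And>k. k \<in> D \<Longrightarrow> k0 \<le> k"
    using \<open>finite D\<close> \<open>1 \<in> D\<close> by (auto simp: k0_def intro!: Min_in)
  then obtain b where b: "b \<in> \<Lambda>" "b - k0 *\<^sub>R c \<in> S" and pos: "0 < k0" "k0 \<le> 1"
    by (auto simp: D_def)
  have bT: "b \<in> T"
    using subspace_add[OF subT subsetD[OF ST b(2)] subspace_scale[OF subT cT, of k0]] by simp
  have bS: "b \<notin> S"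
  proof
    assume "b \<in> S"
    then have "b - 0 *\<^sub>R c \<in> S" by simp
    from uniq[OF this b(2)] pos show False by simp
  qed
  have decomp: "\<exists>m::int. v - of_int m *\<^sub>R b \<in> S \<inter> \<Lambda>" if v: "v \<in> T" "v \<in> \<Lambda>" for v
  proof -
    obtain k where k: "v - k *\<^sub>R c \<in> S" using ex[OF v(1)] by blast
    \<comment> \<open>Division with remainder by the least coefficient. A nonzero remainder would be
      a smaller element of \<open>D\<close>, so it is 0 and v is an integer multiple of
      \<open>b\<close> modulo S.\<close>
    define m where "m = \<lfloor>k / k0\<rfloor>"
    define r where "r = k - of_int m * k0"
    have r: "0 \<le> r" "r < k0"
    proof -
      have "of_int m \<le> k / k0" "k / k0 < of_int m + 1" by (auto simp: m_def)
      then show "0 \<le> r" "r < k0" using pos by (auto simp: r_def field_simps)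
    qed
    have L: "v - of_int m *\<^sub>R b \<in> \<Lambda>" using lattice_add[OF \<Lambda> v(2) b(1), of "- m"] by simp
    have "(v - k *\<^sub>R c) - of_int m *\<^sub>R (b - k0 *\<^sub>R c) \<in> S"
      by (intro subspace_diff[OF subS] k subspace_scale[OF subS] b)
    then have S: "(v - of_int m *\<^sub>R b) - r *\<^sub>R c \<in> S"
      by (simp add: r_def algebra_simps)
    have "r = 0"
    proof (rule ccontr)
      assume "r \<noteq> 0"
      then have "r \<in> D" using r pos L S by (auto simp: D_def)
      from k0(2)[OF this] r show False by simp
    qed
    with S L show ?thesis by auto
  qed
  have spanT: "span (insert b B) = T"
  proof
    show "span (insert b B) \<subseteq> T"
      using bT ST span_superset[of B] subT by (intro span_minimal) (auto simp: spanB)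
    have S_sub: "S \<subseteq> span (insert b B)" using span_mono[of B "insert b B"] spanB by auto
    have "b - (b - k0 *\<^sub>R c) \<in> span (insert b B)"
      by (rule span_diff[OF span_base]) (use S_sub b(2) in blast)+
    then have "k0 *\<^sub>R c \<in> span (insert b B)" by simp
    from span_scale[OF this, of "1 / k0"] have "c \<in> span (insert b B)" using pos by simp
    then show "T \<subseteq> span (insert b B)"
      unfolding T_def using S_sub by (intro span_minimal subspace_span) auto
  qed
  have bB: "b \<notin> B" using bS span_superset[of B] spanB by auto
  have "independent (insert b B)" using indB bS bB by (simp add: independent_insert spanB)
  moreover have "v \<in> T \<inter> \<Lambda> \<longleftrightarrow> (\<exists>d :: 'a \<Rightarrow> int. v = (\<Sum>a\<in>insert b B. of_int (d a) *\<^sub>R a))" for v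
  proof
    assume "v \<in> T \<inter> \<Lambda>"
    then obtain m :: int where "v - of_int m *\<^sub>R b \<in> S \<inter> \<Lambda>" using decomp by blast
    then obtain d :: "'a \<Rightarrow> int" where d: "v - of_int m *\<^sub>R b = (\<Sum>a\<in>B. of_int (d a) *\<^sub>R a)"
      unfolding lattice_basis_mem[OF B] by blast
    have "(\<Sum>a\<in>B. of_int ((d(b := m)) a) *\<^sub>R a) = (\<Sum>a\<in>B. of_int (d a) *\<^sub>R a)"
      by (rule sum.cong) (use bB in auto)
    then have "v = (\<Sum>a\<in>insert b B. of_int ((d(b := m)) a) *\<^sub>R a)"
      using finB bB d by (simp add: algebra_simps)
    then show "\<exists>d :: 'a \<Rightarrow> int. v = (\<Sum>a\<in>insert b B. of_int (d a) *\<^sub>R a)" by blast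
  next
    assume "\<exists>d :: 'a \<Rightarrow> int. v = (\<Sum>a\<in>insert b B. of_int (d a) *\<^sub>R a)"
    then obtain d :: "'a \<Rightarrow> int" where d: "v = (\<Sum>a\<in>insert b B. of_int (d a) *\<^sub>R a)" by blast
    have "(\<Sum>a\<in>B. of_int (d a) *\<^sub>R a) \<in> S \<inter> \<Lambda>" unfolding lattice_basis_mem[OF B] by blast
    then have "(\<Sum>a\<in>B. of_int (d a) *\<^sub>R a) + of_int (d b) *\<^sub>R b \<in> T \<inter> \<Lambda>"
      using ST bT subT by (auto intro!: lattice_add[OF \<Lambda>] b(1) subspace_add subspace_scale)
    then show "v \<in> T \<inter> \<Lambda>" using d finB bB by (simp add: add.commute)
  qed
  then have "T \<inter> \<Lambda> = range (\<lambda>d :: 'a \<Rightarrow> int. \<Sum>a\<in>insert b B. of_int (d a) *\<^sub>R a)" by blast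
  ultimately show ?thesis
    using bB spanT unfolding lattice_basis_def T_def by blast
qed

text \<open>The vectors of the given basis \<open>A\<close> are adjoined one at a time. Those
  already in the span are skipped, the others enlarge the basis by one vector, and at the end the
  span is everything.\<close>

lemma lattice_basis_extend:
  fixes \<Lambda> :: "'a::euclidean_space set"
  assumes \<Lambda>: "lattice_basis A \<Lambda> UNIV" and B: "lattice_basis B (L \<inter> \<Lambda>) L"
  shows "\<exists>C. B \<subseteq> C \<and> lattice_basis C \<Lambda> UNIV"
proof -
  have step: "\<exists>C. B \<subseteq> C \<and> lattice_basis C (span (B \<union> T) \<inter> \<Lambda>) (span (B \<union> T))"
    if "finite T" "T \<subseteq> \<Lambda>" for T
    using that
  proof (induction T rule: finite_induct)
    case empty
    have "span B = L" using B by (simp add: lattice_basis_def)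
    then show ?case using B by auto
  next
    case (insert c T)
    then obtain C where C: "B \<subseteq> C" "lattice_basis C (span (B \<union> T) \<inter> \<Lambda>) (span (B \<union> T))" by auto
    have eq: "span (insert c (span (B \<union> T))) = span (B \<union> insert c T)"
      by (simp only: Un_insert_right span_insert span_span)
    show ?case
    proof (cases "c \<in> span (B \<union> T)")
      case True
      then have "span (B \<union> insert c T) = span (B \<union> T)" by (simp add: span_redundant)
      then show ?thesis using C by auto
    next
      case False
      from lattice_basis_extend_step[OF \<Lambda> C(2) _ False] insert.prems C(1) show ?thesis
        unfolding eq by blast
    qed
  qed
  have A: "finite A" "A \<subseteq> \<Lambda>" "span A = UNIV"
    using lattice_basis_finite[OF \<Lambda>] lattice_basis_subset[OF \<Lambda>] \<Lambda> by (auto simp: lattice_basis_def)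
  have "span (B \<union> A) = UNIV" using span_mono[of A "B \<union> A"] A(3) by blast
  then show ?thesis using step[OF A(1,2)] by (simp only: Int_UNIV_left)
qed

subsection \<open>Rational inequalities for semi-rational polytopes\<close>

locale coordinates =
  fixes e :: "nat \<Rightarrow> 'a::euclidean_space"
  assumes inj_e: "inj_on e {..<DIM('a)}" and indep_e: "independent (e ` {..<DIM('a)})"
begin

definition coord :: "'a \<Rightarrow> nat \<Rightarrow> real" where
  "coord v j = representation (e ` {..<DIM('a)}) v (e j)"

definition comb :: "(nat \<Rightarrow> real) \<Rightarrow> 'a" where
  "comb x = (\<Sum>j<DIM('a). x j *\<^sub>R e j)"

lemma span_e: "span (e ` {..<DIM('a)}) = UNIV"
proof -
  have "UNIV \<subseteq> span (e ` {..<DIM('a)})"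
    by (rule card_ge_dim_independent) (use indep_e inj_e in \<open>auto simp: card_image\<close>)
  then show ?thesis by blast
qed

lemma linear_coord: "linear (\<lambda>v. coord v j)"
  unfolding coord_def
  by (rule linearI) (simp_all add: real_vector.representation_add real_vector.representation_scale
      indep_e span_e)

lemma comb_coord: "comb (coord v) = v"
proof -
  have "(\<Sum>b\<in>e ` {..<DIM('a)}. representation (e ` {..<DIM('a)}) v b *\<^sub>R b) = v"
    by (rule real_vector.sum_representation_eq[OF indep_e]) (auto simp: span_e)
  then show ?thesis by (simp add: sum.reindex[OF inj_e] comb_def coord_def)
qed

lemma coord_comb: "j < DIM('a) \<Longrightarrow> coord (comb x) j = x j"
proof -
  assume j: "j < DIM('a)"
  have "coord (e i) j = (if i = j then 1 else 0)" if "i < DIM('a)" for i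
    using that j inj_onD[OF inj_e, of j i]
    by (auto simp: coord_def real_vector.representation_basis[OF indep_e])
  then show ?thesis
    using j by (simp add: comb_def linear_sum[OF linear_coord] linear_cmul[OF linear_coord]
        mult_delta_right)
qed

lemma comb_cong: "(\<And>j. j < DIM('a) \<Longrightarrow> x j = y j) \<Longrightarrow> comb x = comb y"
  unfolding comb_def by (intro sum.cong) auto

lemma comb_sum: "comb (\<lambda>j. \<Sum>i\<in>I. c i * y i j) = (\<Sum>i\<in>I. c i *\<^sub>R comb (y i))"
  unfolding comb_def scaleR_sum_left scaleR_sum_right by (subst sum.swap) simp

definition functional :: "(nat \<Rightarrow> real) \<Rightarrow> 'a \<Rightarrow> real" where
  "functional u v = (\<Sum>j<DIM('a). u j * coord v j)"

lemma linear_functional: "linear (functional u)"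
proof -
  have "linear (\<lambda>v. u j * coord v j)" for j
    using linear_compose_scale_right[OF linear_coord, of "u j" j] by simp
  then show ?thesis unfolding functional_def by (intro linear_compose_sum) auto
qed

lemma functional_comb: "functional u (comb x) = (\<Sum>j<DIM('a). u j * x j)"
  unfolding functional_def by (intro sum.cong) (auto simp: coord_comb)

text \<open>Rational normals but arbitrary real right-hand sides: this is semi-rationality in
  coordinates, as only the directions of the bounding hyperplanes are rational.\<close>

definition rational_cut :: "'a set \<Rightarrow> bool" where
  "rational_cut P \<longleftrightarrow> (\<exists>K. finite K \<and> (\<forall>(u, b)\<in>K. \<forall>j. u j \<in> \<rat>) \<and>
     (\<forall>v. v \<in> P \<longleftrightarrow> (\<forall>(u, b)\<in>K. functional u v \<le> b)))"

lemma rational_cut_Int: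
  assumes "rational_cut P" "rational_cut Q"
  shows "rational_cut (P \<inter> Q)"
proof -
  from assms(1) obtain K where K: "finite K" "\<forall>(u, b)\<in>K. \<forall>j. u j \<in> \<rat>"
    "\<forall>v. v \<in> P \<longleftrightarrow> (\<forall>(u, b)\<in>K. functional u v \<le> b)"
    unfolding rational_cut_def by blast
  from assms(2) obtain K' where K': "finite K'" "\<forall>(u, b)\<in>K'. \<forall>j. u j \<in> \<rat>"
    "\<forall>v. v \<in> Q \<longleftrightarrow> (\<forall>(u, b)\<in>K'. functional u v \<le> b)"
    unfolding rational_cut_def by blast
  show ?thesis
    unfolding rational_cut_def using K K' by (intro exI[of _ "K \<union> K'"]) (simp add: ball_Un)
qed

lemma rational_cut_UNIV: "rational_cut UNIV"
  unfolding rational_cut_def by (rule exI[of _ "{}"]) simp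

lemma rational_cut_Inter:
  assumes "finite I" "\<And>i. i \<in> I \<Longrightarrow> rational_cut (P i)"
  shows "rational_cut (\<Inter>i\<in>I. P i)"
  using assms by (induction I rule: finite_induct) (auto intro: rational_cut_Int rational_cut_UNIV)

lemma rational_cut_halfspace:
  "(\<And>j. u j \<in> \<rat>) \<Longrightarrow> rational_cut {v. functional u v \<le> b}"
  unfolding rational_cut_def by (rule exI[of _ "{(u, b)}"]) simp

text \<open>Membership in the span means solvability of a linear system in the coefficients;
  Fourier-Motzkin elimination of these leaves rational inequalities. A subspace is closed under
  negation, so each of them holds with equality.\<close>

lemma rational_subspace_equations:
  assumes "\<And>b j. b \<in> B \<Longrightarrow> j < DIM('a) \<Longrightarrow> coord b j \<in> \<rat>" "finite B"
  shows "\<exists>U. finite U \<and> (\<forall>u\<in>U. \<forall>j. u j \<in> \<rat>) \<and> (\<forall>v. v \<in> span B \<longleftrightarrow> (\<forall>u\<in>U. functional u v = 0))"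
proof -
  let ?F = "functional ` {u. \<forall>j. u j \<in> \<rat>}"
  have smult: "(\<lambda>v. q * functional u v) = functional (\<lambda>j. q * u j)" for q u
    by (simp add: fun_eq_iff functional_def sum_distrib_left mult.assoc)
  \<comment> \<open>The value 0 outside the relevant indices makes all coefficients rational, as the
    elimination lemma requires them at every index and not only on \<open>B\<close>.\<close>
  define c where "c = (\<lambda>j b. if j < DIM('a) \<and> b \<in> B then coord b j else 0)"
  let ?K = "(\<lambda>j. (c j, \<lambda>v. coord v j)) ` {..<DIM('a)} \<union>
    (\<lambda>j. (\<lambda>b. - c j b, \<lambda>v. - coord v j)) ` {..<DIM('a)}"
  have coordF: "(\<lambda>v. coord v j) = functional (\<lambda>i. if i = j then 1 else 0)" if "j < DIM('a)" for j
    using that by (simp add: fun_eq_iff functional_def if_distrib[of "\<lambda>x. x * _"] cong: if_cong)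
  have "\<exists>G. finite G \<and> G \<subseteq> ?F \<and>
    (\<forall>v. (\<exists>z. \<forall>(w, f)\<in>?K. (\<Sum>b\<in>B. w b * z b) \<le> f v) \<longleftrightarrow> (\<forall>g\<in>G. 0 \<le> g v))"
  proof (rule fourier_motzkin)
    show "(\<lambda>\<tau>. f \<tau> + g \<tau>) \<in> ?F" if fg: "f \<in> ?F" "g \<in> ?F" for f g
    proof -
      from fg obtain u u' where "f = functional u" "g = functional u'" "\<forall>j. u j \<in> \<rat>" "\<forall>j. u' j \<in> \<rat>"
        by blast
      then show ?thesis
        by (intro image_eqI[of _ _ "\<lambda>j. u j + u' j"])
           (auto simp: functional_def fun_eq_iff sum.distrib distrib_right)
    qed
    show scale: "(\<lambda>\<tau>. q * f \<tau>) \<in> ?F" if qf: "q \<in> \<rat>" "f \<in> ?F" for q f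
    proof -
      from qf obtain u where "f = functional u" "\<forall>j. u j \<in> \<rat>" by blast
      with qf show ?thesis
        by (intro image_eqI[of _ _ "\<lambda>j. q * u j"]) (auto simp: smult)
    qed
    show "f \<in> ?F \<and> (\<forall>b. w b \<in> \<rat>)" if wf: "(w, f) \<in> ?K" for w f
    proof -
      from wf obtain j where j: "j < DIM('a)"
        and "(w = c j \<and> f = (\<lambda>v. coord v j)) \<or> (w = (\<lambda>b. - c j b) \<and> f = (\<lambda>v. - coord v j))"
        by blast
      moreover have F1: "(\<lambda>v. coord v j) \<in> ?F" unfolding coordF[OF j] by (intro imageI) auto
      moreover have "(\<lambda>v. - coord v j) \<in> ?F" using scale[OF _ F1, of "- 1"] by simp
      ultimately show ?thesis using assms(1) by (auto simp: c_def)
    qed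
  qed (use assms in auto)
  then obtain G where G: "finite G" "G \<subseteq> ?F"
    "\<And>v. (\<exists>z. \<forall>(w, f)\<in>?K. (\<Sum>b\<in>B. w b * z b) \<le> f v) \<longleftrightarrow> (\<forall>g\<in>G. 0 \<le> g v)"
    by auto
  then obtain U where U: "finite U" "U \<subseteq> {u. \<forall>j. u j \<in> \<rat>}" "G = functional ` U"
    using finite_subset_image[OF G(1,2)] by blast
  have span: "v \<in> span B \<longleftrightarrow> (\<forall>u\<in>U. 0 \<le> functional u v)" for v
  proof -
    have "v \<in> span B \<longleftrightarrow> (\<exists>z. v = (\<Sum>b\<in>B. z b *\<^sub>R b))"
      using assms(2) by (auto simp: span_finite)
    also have "\<dots> \<longleftrightarrow> (\<exists>z. \<forall>j<DIM('a). coord v j = (\<Sum>b\<in>B. z b * coord b j))"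
    proof (rule ex_cong1)
      fix z
      have "coord (\<Sum>b\<in>B. z b *\<^sub>R b) j = (\<Sum>b\<in>B. z b * coord b j)" for j
        by (simp add: linear_sum[OF linear_coord] linear_cmul[OF linear_coord])
      moreover have "v = w \<longleftrightarrow> (\<forall>j<DIM('a). coord v j = coord w j)" for w
      proof
        assume "\<forall>j<DIM('a). coord v j = coord w j"
        then have "comb (coord v) = comb (coord w)" by (intro comb_cong) blast
        then show "v = w" by (simp add: comb_coord)
      qed simp
      ultimately show "v = (\<Sum>b\<in>B. z b *\<^sub>R b) \<longleftrightarrow>
          (\<forall>j<DIM('a). coord v j = (\<Sum>b\<in>B. z b * coord b j))"
        by simp
    qed
    also have "\<dots> \<longleftrightarrow> (\<exists>z. \<forall>(w, f)\<in>?K. (\<Sum>b\<in>B. w b * z b) \<le> f v)"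
    proof (rule ex_cong1)
      fix z
      have "(\<Sum>b\<in>B. c j b * z b) = (\<Sum>b\<in>B. z b * coord b j)" if "j < DIM('a)" for j
        using that by (intro sum.cong) (auto simp: c_def)
      moreover have "(\<Sum>b\<in>B. - c j b * z b) = - (\<Sum>b\<in>B. c j b * z b)" for j
        by (simp add: sum_negf)
      ultimately have "(\<Sum>b\<in>B. c j b * z b) \<le> coord v j \<and> (\<Sum>b\<in>B. - c j b * z b) \<le> - coord v j \<longleftrightarrow>
          coord v j = (\<Sum>b\<in>B. z b * coord b j)" if "j < DIM('a)" for j
        using that by (simp only:) linarith
      moreover have "(\<forall>(w, f)\<in>?K. (\<Sum>b\<in>B. w b * z b) \<le> f v) \<longleftrightarrow>
          (\<forall>j<DIM('a). (\<Sum>b\<in>B. c j b * z b) \<le> coord v j \<and> (\<Sum>b\<in>B. - c j b * z b) \<le> - coord v j)"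
        by (simp only: ball_Un ball_simps prod.case)
          (simp only: lessThan_iff Ball_def all_conj_distrib imp_conjR)
      ultimately show "(\<forall>j<DIM('a). coord v j = (\<Sum>b\<in>B. z b * coord b j)) \<longleftrightarrow>
          (\<forall>(w, f)\<in>?K. (\<Sum>b\<in>B. w b * z b) \<le> f v)"
        by simp
    qed
    also have "\<dots> \<longleftrightarrow> (\<forall>u\<in>U. 0 \<le> functional u v)"
      unfolding G(3) U(3) by simp
    finally show ?thesis .
  qed
  have "v \<in> span B \<longleftrightarrow> (\<forall>u\<in>U. functional u v = 0)" for v
  proof
    assume v: "v \<in> span B"
    then have "- v \<in> span B" by (simp add: span_neg)
    with v show "\<forall>u\<in>U. functional u v = 0"
      unfolding span by (force simp: linear_neg[OF linear_functional])
  qed (simp add: span)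
  with U show ?thesis by blast
qed

lemma rational_cut_subspace:
  assumes "finite U" "\<And>u j. u \<in> U \<Longrightarrow> u j \<in> \<rat>" "\<And>v. v \<in> W \<longleftrightarrow> (\<forall>u\<in>U. functional u v = 0)"
  shows "rational_cut {v. v - a \<in> W}"
proof -
  have neg: "functional (\<lambda>j. - u j) v = - functional u v" for u v
    by (simp add: functional_def sum_negf)
  have "{v. v - a \<in> W} = (\<Inter>u\<in>U. {v. functional u v \<le> functional u a} \<inter>
      {v. functional (\<lambda>j. - u j) v \<le> functional (\<lambda>j. - u j) a})"
  proof (rule set_eqI)
    fix v
    have "v - a \<in> W \<longleftrightarrow> (\<forall>u\<in>U. functional u v = functional u a)"
      by (simp add: assms(3) linear_diff[OF linear_functional])
    then show "v \<in> {v. v - a \<in> W} \<longleftrightarrow> v \<in> (\<Inter>u\<in>U. {v. functional u v \<le> functional u a} \<inter>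
      {v. functional (\<lambda>j. - u j) v \<le> functional (\<lambda>j. - u j) a})"
      unfolding neg by (auto intro: antisym)
  qed
  then show ?thesis
    using assms(1,2) by (auto intro!: rational_cut_Inter rational_cut_Int rational_cut_halfspace)
qed

end

lemma affine_parallel_subspace_iff:
  assumes "affine_parallel A W" "a \<in> A" "subspace W"
  shows "v \<in> A \<longleftrightarrow> v - a \<in> W"
proof -
  from assms(1) obtain c where W: "W = (\<lambda>x. c + x) ` A"
    unfolding affine_parallel_def by blast
  have ca: "c + a \<in> W" using assms(2) W by blast
  have "v \<in> A \<longleftrightarrow> c + v \<in> W" unfolding W by auto
  also have "\<dots> \<longleftrightarrow> (c + v) - (c + a) \<in> W"
    using subspace_diff[OF assms(3) _ ca, of "c + v"]
      subspace_add[OF assms(3) _ ca, of "(c + v) - (c + a)"]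
    unfolding diff_add_cancel by blast
  finally show ?thesis by simp
qed

locale lattice_coordinates = coordinates e for e :: "nat \<Rightarrow> 'a::euclidean_space" +
  fixes \<Lambda> :: "'a set"
  assumes lattice_e: "\<And>v. v \<in> \<Lambda> \<longleftrightarrow> (\<forall>j<DIM('a). coord v j \<in> \<int>)"
begin

lemma rational_subspace_functionals:
  assumes "rational_subspace \<Lambda> W"
  shows "\<exists>U. finite U \<and> (\<forall>u\<in>U. \<forall>j. u j \<in> \<rat>) \<and> (\<forall>v. v \<in> W \<longleftrightarrow> (\<forall>u\<in>U. functional u v = 0))"
proof -
  from assms obtain B where B: "lattice_basis B (W \<inter> \<Lambda>) W"
    unfolding rational_subspace_def lattice_in_def by blast
  then have fin: "finite B" and W: "span B = W"
    by (auto simp: lattice_basis_def intro: independent_imp_finite)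
  have "b \<in> W \<inter> \<Lambda>" if "b \<in> B" for b
    using lattice_basis_subset[OF B that] .
  then have "coord b j \<in> \<rat>" if "b \<in> B" "j < DIM('a)" for b j
    using that lattice_e Ints_subset_Rats by blast
  from rational_subspace_equations[OF this fin] show ?thesis unfolding W .
qed

text \<open>The Euclidean normal \<open>n\<close> need not have rational coordinates, but on W it is
  a multiple of a rational functional: both vanish on W \<inter> H, which has codimension 1 in W,
  and some functional defining H does not vanish on W.\<close>

lemma facet_halfspace:
  assumes P: "\<And>v. v \<in> affine hull P \<longleftrightarrow> v - a \<in> W" "subspace W" "affine_parallel (affine hull P) W"
    and C: "C facet_of P" "C \<subseteq> {x. n \<bullet> x = b}"
    and H: "rational_hyperplane \<Lambda> H" "affine_parallel (affine hull C) (W \<inter> H)"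
  shows "\<exists>u b'. (\<forall>j. u j \<in> \<rat>) \<and> (\<forall>v\<in>affine hull P. n \<bullet> v \<le> b \<longleftrightarrow> functional u v \<le> b')"
proof -
  let ?D = "W \<inter> H"
  have subH: "subspace H" "rational_subspace \<Lambda> H"
    using H(1) by (auto simp: rational_hyperplane_def rational_subspace_def)
  have subD: "subspace ?D" by (rule subspace_inter[OF P(2) subH(1)])
  obtain f where f: "f \<in> C" using C(1) by (auto simp: facet_of_def)
  then have fP: "f \<in> affine hull P"
    using C(1) by (meson facet_of_imp_subset hull_subset subsetD)
  have "P \<noteq> {}" using C(1) f facet_of_imp_subset by blast
  then have "int (dim ?D) = int (dim W) - 1"
    using aff_dim_parallel_subspace[OF _ subD H(2)] aff_dim_parallel_subspace[OF _ P(2,3)] C(1) f fP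
    by (auto simp: facet_of_def)
  then have dimD: "dim W = dim ?D + 1" by linarith
  then obtain w where w: "w \<in> W" "w \<notin> H"
    by (metis Int_absorb2 add_eq_self_zero one_neq_zero subsetI)
  obtain U where U: "\<And>u j. u \<in> U \<Longrightarrow> u j \<in> \<rat>" "\<And>v. v \<in> H \<longleftrightarrow> (\<forall>u\<in>U. functional u v = 0)"
    using rational_subspace_functionals[OF subH(2)] by blast
  then obtain u where u: "u \<in> U" "functional u w \<noteq> 0" using w by blast
  have "span (insert w ?D) = W"
  proof (rule subspace_dim_equal)
    show "span (insert w ?D) \<subseteq> W" using w P(2) by (intro span_minimal) auto
    show "dim W \<le> dim (span (insert w ?D))"
      using w dimD subD by (simp add: dim_insert span_eq_iff[THEN iffD2])
  qed (use P in auto)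
  then have decomp: "\<exists>k. v - k *\<^sub>R w \<in> ?D" if "v \<in> W" for v
    using that subD by (metis span_breakdown_eq span_eq_iff)
  have nD: "n \<bullet> d = 0" if "d \<in> ?D" for d
  proof -
    have "f + d \<in> affine hull C"
      using affine_parallel_subspace_iff[OF H(2) _ subD, of f "f + d"] f that by (simp add: hull_inc)
    moreover have "affine hull C \<subseteq> {x. n \<bullet> x = b}"
      using C(2) by (intro hull_minimal affine_hyperplane)
    ultimately have "n \<bullet> (f + d) = b" "n \<bullet> f = b" using f C(2) by auto
    then show ?thesis by (simp add: inner_add_right)
  qed
  define l where "l = (n \<bullet> w) / functional u w"
  have n_eq: "n \<bullet> v = l * functional u v" if v: "v \<in> W" for v
  proof -
    obtain k where "v - k *\<^sub>R w \<in> ?D" using decomp[OF v] by blast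
    then have "n \<bullet> (v - k *\<^sub>R w) = 0" "functional u (v - k *\<^sub>R w) = 0"
      using nD U(2) u(1) by auto
    then show ?thesis
      using u(2) by (simp add: l_def inner_diff_right linear_diff[OF linear_functional]
          linear_cmul[OF linear_functional])
  qed
  \<comment> \<open>Multiplying by the real factor \<open>l\<close> would destroy rationality; its
    sign suffices for the inequality. If \<open>l\<close> is 0, then \<open>n\<close> is constant on
    the affine hull and both inequalities hold trivially.\<close>
  let ?u = "\<lambda>j. sgn l * u j"
  have fu: "functional ?u v = sgn l * functional u v" for v
    by (simp add: functional_def sum_distrib_left mult.assoc)
  have "n \<bullet> v \<le> b \<longleftrightarrow> functional ?u v \<le> functional ?u f" if v: "v \<in> affine hull P" for v
  proof -
    have "v - f \<in> W"
      using subspace_diff[OF P(2), of "v - a" "f - a"] v fP unfolding P(1) by simp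
    from n_eq[OF this] have "n \<bullet> v - b = l * (functional u v - functional u f)"
      using f C(2) by (auto simp: inner_diff_right linear_diff[OF linear_functional])
    then have "n \<bullet> v \<le> b \<longleftrightarrow> l * (functional u v - functional u f) \<le> 0" by linarith
    also have "\<dots> \<longleftrightarrow> sgn l * (functional u v - functional u f) \<le> 0"
      by (auto simp: sgn_if mult_le_0_iff)
    finally show ?thesis by (simp add: fu right_diff_distrib)
  qed
  moreover have "?u j \<in> \<rat>" for j
    using U(1)[OF u(1), of j] by (auto simp: sgn_if)
  ultimately show ?thesis by (intro exI[of _ ?u] exI[of _ "functional ?u f"]) blast
qed

text \<open>In an irredundant description inside the affine hull, every half-space defines a facet,
  so its normal can be replaced by a rational one. The affine hull itself is given by the rational
  equations of W.\<close>

lemma rational_cut_semi_rational_polytope: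
  assumes "semi_rational_polytope \<Lambda> P"
  shows "rational_cut P"
proof (cases "P = {}")
  case True
  have "rational_cut {v. functional (\<lambda>_. 0) v \<le> - 1}" by (rule rational_cut_halfspace) simp
  then show ?thesis using True by (simp add: functional_def)
next
  case False
  with assms obtain W where W: "rational_subspace \<Lambda> W" "affine_parallel (affine hull P) W"
    and facets: "\<And>F. F facet_of P \<Longrightarrow>
      \<exists>H. rational_hyperplane \<Lambda> H \<and> affine_parallel (affine hull F) (W \<inter> H)"
    and "polytope P"
    unfolding semi_rational_polytope_def by blast
  have subW: "subspace W" using W(1) by (simp add: rational_subspace_def)
  obtain a where a: "a \<in> P" using False by blast
  have aff: "v \<in> affine hull P \<longleftrightarrow> v - a \<in> W" for v
    by (rule affine_parallel_subspace_iff[OF W(2) _ subW]) (simp add: a hull_inc)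
  have "polyhedron P" using \<open>polytope P\<close> by (rule polytope_imp_polyhedron)
  then obtain F where F: "finite F" "P = affine hull P \<inter> \<Inter>F"
    "\<forall>h\<in>F. \<exists>a b. a \<noteq> 0 \<and> h = {x. a \<bullet> x \<le> b}"
    "\<And>F'. F' \<subset> F \<Longrightarrow> P \<subset> affine hull P \<inter> \<Inter>F'"
    unfolding polyhedron_Int_affine_minimal by blast
  from F(3) obtain n b where nb: "\<And>h. h \<in> F \<Longrightarrow> n h \<noteq> 0 \<and> h = {x. n h \<bullet> x \<le> b h}"
    by metis
  have "\<exists>u b'. (\<forall>j. u j \<in> \<rat>) \<and> (\<forall>v\<in>affine hull P. v \<in> h \<longleftrightarrow> functional u v \<le> b')"
    if h: "h \<in> F" for h
  proof -
    have "P \<inter> {x. n h \<bullet> x = b h} facet_of P"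
      using facet_of_polyhedron_explicit[OF F(1,2) nb F(4)] h by blast
    moreover from facets[OF this] obtain H where "rational_hyperplane \<Lambda> H"
      "affine_parallel (affine hull (P \<inter> {x. n h \<bullet> x = b h})) (W \<inter> H)" by blast
    ultimately have "\<exists>u b'. (\<forall>j. u j \<in> \<rat>) \<and>
        (\<forall>v\<in>affine hull P. n h \<bullet> v \<le> b h \<longleftrightarrow> functional u v \<le> b')"
      by (intro facet_halfspace[OF aff subW W(2)]) auto
    then show ?thesis using nb[OF h] by blast
  qed
  then obtain u b' where ub: "\<And>h j. h \<in> F \<Longrightarrow> u h j \<in> \<rat>"
    "\<And>h v. h \<in> F \<Longrightarrow> v \<in> affine hull P \<Longrightarrow> v \<in> h \<longleftrightarrow> functional (u h) v \<le> b' h"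
    by metis
  have "P = {v. v - a \<in> W} \<inter> (\<Inter>h\<in>F. {v. functional (u h) v \<le> b' h})"
    using ub(2) aff by (subst F(2)) blast
  moreover have "rational_cut {v. v - a \<in> W}"
    using rational_subspace_functionals[OF W(1)] rational_cut_subspace by blast
  moreover have "rational_cut (\<Inter>h\<in>F. {v. functional (u h) v \<le> b' h})"
    using ub(1) F(1) by (intro rational_cut_Inter rational_cut_halfspace)
  ultimately show ?thesis using rational_cut_Int by (simp only:)
qed

end

subsection \<open>Minkowski families of rational polyhedra\<close>

text \<open>Substituting \<open>z (i, j)\<close> for the product of \<open>t $ i\<close> and the
  j-th coordinate of the i-th point makes the description of the family linear in z, t and x
  together. Eliminating all z leaves homogeneous forms in (t, x).\<close>

lemma cut_out_minkowski:
  fixes p :: "'q::finite \<Rightarrow> (nat \<Rightarrow> real) set"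
  assumes "\<And>i. \<exists>K. finite K \<and> (\<forall>(u, b)\<in>K. \<forall>j. u j \<in> \<rat>) \<and>
    (\<forall>y. y \<in> p i \<longleftrightarrow> (\<forall>(u, b)\<in>K. (\<Sum>j<n. u j * y j) \<le> b))"
  shows "\<exists>\<Phi>. cut_out n p \<Phi>"
proof -
  have "\<forall>i. \<exists>K. finite K \<and> (\<forall>(u, b)\<in>K. \<forall>j. u j \<in> \<rat>) \<and>
    (\<forall>y. y \<in> p i \<longleftrightarrow> (\<forall>(u, b)\<in>K. (\<Sum>j<n. u j * y j) \<le> b))"
    using assms by blast
  from choice[OF this] obtain K where K0: "\<And>i. finite (K i) \<and> (\<forall>(u, b)\<in>K i. \<forall>j. u j \<in> \<rat>) \<and>
    (\<forall>y. y \<in> p i \<longleftrightarrow> (\<forall>(u, b)\<in>K i. (\<Sum>j<n. u j * y j) \<le> b))"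
    by blast
  have K: "\<And>i. finite (K i)" "\<And>i u b j. (u, b) \<in> K i \<Longrightarrow> u j \<in> \<rat>"
    "\<And>i y. y \<in> p i \<longleftrightarrow> (\<forall>(u, b)\<in>K i. (\<Sum>j<n. u j * y j) \<le> b)"
    using K0 by blast+
  define B :: "('q \<times> nat) set" where "B = UNIV \<times> {..<n}"
  define row :: "'q \<Rightarrow> (nat \<Rightarrow> real) \<Rightarrow> 'q \<times> nat \<Rightarrow> real"
    where "row = (\<lambda>i u (i', j). if i' = i then u j else 0)"
  define col :: "real \<Rightarrow> nat \<Rightarrow> 'q \<times> nat \<Rightarrow> real"
    where "col = (\<lambda>c j (i, j'). if j' = j then c else 0)"
  \<comment> \<open>\<open>K1\<close> contains the inequalities of the dilated summands, with
    right-hand side b t_i; \<open>K2\<close> and \<open>K3\<close> are the two halves of the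
    equation expressing x as the sum of the z.\<close>
  define K1 :: "(('q \<times> nat \<Rightarrow> real) \<times> ((real ^ 'q) \<times> (nat \<Rightarrow> real) \<Rightarrow> real)) set"
    where "K1 = (\<Union>i. (\<lambda>(u, b). (row i u, \<lambda>(t, x). b * t $ i)) ` K i)"
  define K2 :: "(('q \<times> nat \<Rightarrow> real) \<times> ((real ^ 'q) \<times> (nat \<Rightarrow> real) \<Rightarrow> real)) set"
    where "K2 = (\<lambda>j. (col 1 j, \<lambda>(t, x). x j)) ` {..<n}"
  define K3 :: "(('q \<times> nat \<Rightarrow> real) \<times> ((real ^ 'q) \<times> (nat \<Rightarrow> real) \<Rightarrow> real)) set"
    where "K3 = (\<lambda>j. (col (- 1) j, \<lambda>(t, x). - 1 * x j)) ` {..<n}"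
  have hom_t: "homogeneous_form n (\<lambda>(t::real ^ 'q) x. b * t $ i)" for b i
    unfolding homogeneous_form_def
    by (intro exI[of _ "b *\<^sub>R axis i 1"] exI[of _ "\<lambda>_. 0"]) (simp add: inner_axis')
  have hom_x: "homogeneous_form n (\<lambda>(t::real ^ 'q) x. x j)" if "j < n" for j
    unfolding homogeneous_form_def using that
    by (intro exI[of _ 0] exI[of _ "\<lambda>i. if i = j then 1 else 0"]) (auto simp: mult_delta_left)
  have row_sum: "(\<Sum>b\<in>B. row i u b * z b) = (\<Sum>j<n. u j * z (i, j))" for i u z
  proof -
    have "(\<Sum>b\<in>B. row i u b * z b) = (\<Sum>i'\<in>UNIV. \<Sum>j<n. row i u (i', j) * z (i', j))"
      unfolding B_def by (simp add: sum.cartesian_product)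
    also have "\<dots> = (\<Sum>i'\<in>UNIV. if i' = i then (\<Sum>j<n. u j * z (i, j)) else 0)"
      by (rule sum.cong) (auto simp: row_def)
    finally show ?thesis by simp
  qed
  have col_sum: "(\<Sum>b\<in>B. col c j b * z b) = c * (\<Sum>i\<in>UNIV. z (i, j))" if "j < n" for c j z
  proof -
    have "(\<Sum>b\<in>B. col c j b * z b) = (\<Sum>i\<in>UNIV. \<Sum>j'<n. col c j (i, j') * z (i, j'))"
      unfolding B_def by (simp add: sum.cartesian_product)
    also have "\<dots> = (\<Sum>i\<in>UNIV. c * z (i, j))"
      using that by (intro sum.cong) (auto simp: col_def mult_delta_left)
    finally show ?thesis by (simp add: sum_distrib_left)
  qed
  have "\<exists>\<Phi>. finite \<Phi> \<and> (\<forall>\<phi>\<in>\<Phi>. homogeneous_form n \<phi>) \<and> (\<forall>t x.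
    (\<exists>z. \<forall>(w, f)\<in>K1 \<union> K2 \<union> K3. (\<Sum>b\<in>B. w b * z b) \<le> f (t, x)) \<longleftrightarrow> (\<forall>\<phi>\<in>\<Phi>. 0 \<le> \<phi> t x))"
  proof (rule fourier_motzkin_homogeneous)
    show "finite B" by (simp add: B_def)
    show "finite (K1 \<union> K2 \<union> K3)" using K(1) by (auto simp: K1_def K2_def K3_def)
    show "(\<exists>\<phi>. homogeneous_form n \<phi> \<and> f = (\<lambda>(t, x). \<phi> t x)) \<and> (\<forall>b. w b \<in> \<rat>)"
      if wf: "(w, f) \<in> K1 \<union> K2 \<union> K3" for w f
    proof -
      consider "(w, f) \<in> K1" | "(w, f) \<in> K2" | "(w, f) \<in> K3" using wf by blast
      then show ?thesis
      proof cases
        case 1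
        then obtain i u b where *: "(u, b) \<in> K i" "w = row i u" "f = (\<lambda>(t, x). b * t $ i)"
          by (auto simp: K1_def)
        have "\<forall>b. w b \<in> \<rat>" using * K(2) by (auto simp: row_def)
        moreover have "\<exists>\<phi>. homogeneous_form n \<phi> \<and> f = (\<lambda>(t, x). \<phi> t x)" unfolding *(3) using hom_t by blast
        ultimately show ?thesis by blast
      next
        case 2
        then obtain j where *: "j < n" "w = col 1 j" "f = (\<lambda>(t, x). x j)"
          by (auto simp: K2_def)
        have "\<forall>b. w b \<in> \<rat>" using * by (auto simp: col_def)
        moreover have "\<exists>\<phi>. homogeneous_form n \<phi> \<and> f = (\<lambda>(t, x). \<phi> t x)" unfolding *(3) using hom_x[OF *(1)] by blast
        ultimately show ?thesis by blast
      next
        case 3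
        then obtain j where *: "j < n" "w = col (- 1) j" "f = (\<lambda>(t, x). - 1 * x j)"
          by (auto simp: K3_def)
        have "\<forall>b. w b \<in> \<rat>" using * by (auto simp: col_def)
        moreover have "\<exists>\<phi>. homogeneous_form n \<phi> \<and> f = (\<lambda>(t, x). \<phi> t x)"
          unfolding *(3) using homogeneous_form_scale[OF hom_x[OF *(1)], of "- 1"] by auto
        ultimately show ?thesis by blast
      qed
    qed
  qed
  then obtain \<Phi> where \<Phi>: "finite \<Phi>" "\<And>\<phi>. \<phi> \<in> \<Phi> \<Longrightarrow> homogeneous_form n \<phi>"
    "\<And>t x. (\<exists>z. \<forall>(w, f)\<in>K1 \<union> K2 \<union> K3. (\<Sum>b\<in>B. w b * z b) \<le> f (t, x)) \<longleftrightarrow> (\<forall>\<phi>\<in>\<Phi>. 0 \<le> \<phi> t x)"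
    by blast
  have "cut_out n p \<Phi>"
    unfolding cut_out_def
  proof (intro conjI allI impI)
    fix t :: "real ^ 'q" and x assume t: "\<forall>i. 0 < t $ i"
    have "in_family n t p x \<longleftrightarrow> (\<exists>z. (\<forall>i. \<forall>(u, b)\<in>K i. (\<Sum>j<n. u j * z (i, j)) \<le> b * t $ i) \<and>
        (\<forall>j<n. x j = (\<Sum>i\<in>UNIV. z (i, j))))" (is "_ \<longleftrightarrow> (\<exists>z. ?A z)")
    proof
      assume "in_family n t p x"
      then obtain y where y: "\<And>i. y i \<in> p i" "\<And>j. j < n \<Longrightarrow> x j = (\<Sum>i\<in>UNIV. t $ i * y i j)"
        unfolding in_family_def by blast
      have "(\<Sum>j<n. u j * (t $ i * y i j)) \<le> b * t $ i" if "(u, b) \<in> K i" for i u b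
      proof -
        have "(\<Sum>j<n. u j * (t $ i * y i j)) = t $ i * (\<Sum>j<n. u j * y i j)"
          by (simp add: sum_distrib_left mult_ac)
        also have "\<dots> \<le> t $ i * b"
          using y(1)[of i] that t by (intro mult_left_mono) (auto simp: K(3) less_imp_le)
        finally show ?thesis by (simp add: mult.commute)
      qed
      then have "?A (\<lambda>(i, j). t $ i * y i j)" using y(2) by auto
      then show "\<exists>z. ?A z" by blast
    next
      assume "\<exists>z. ?A z"
      then obtain z where z: "?A z" by blast
      \<comment> \<open>Undoing the substitution divides by \<open>t $ i\<close>, which is where
        positivity is used.\<close>
      have "(\<lambda>j. z (i, j) / t $ i) \<in> p i" for i
        unfolding K(3)
      proof safe
        fix u b assume "(u, b) \<in> K i"
        with z have "(\<Sum>j<n. u j * z (i, j)) \<le> b * t $ i" by blast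
        then have "(\<Sum>j<n. u j * z (i, j)) / t $ i \<le> b"
          using t by (simp add: pos_divide_le_eq)
        then show "(\<Sum>j<n. u j * (z (i, j) / t $ i)) \<le> b" by (simp add: sum_divide_distrib)
      qed
      moreover have "x j = (\<Sum>i\<in>UNIV. t $ i * (z (i, j) / t $ i))" if "j < n" for j
        using z that t by (simp add: less_imp_neq[THEN not_sym])
      ultimately show "in_family n t p x"
        unfolding in_family_def by (intro exI[of _ "\<lambda>i j. z (i, j) / t $ i"]) blast
    qed
    also have "\<dots> \<longleftrightarrow> (\<exists>z. \<forall>(w, f)\<in>K1 \<union> K2 \<union> K3. (\<Sum>b\<in>B. w b * z b) \<le> f (t, x))"
    proof (rule ex_cong1)
      fix z
      have "(\<forall>(w, f)\<in>K1. (\<Sum>b\<in>B. w b * z b) \<le> f (t, x)) \<longleftrightarrow>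
          (\<forall>i. \<forall>(u, b)\<in>K i. (\<Sum>j<n. u j * z (i, j)) \<le> b * t $ i)"
        by (simp add: K1_def row_sum split_def)
      moreover have "(\<forall>(w, f)\<in>K2. (\<Sum>b\<in>B. w b * z b) \<le> f (t, x)) \<longleftrightarrow>
          (\<forall>j<n. (\<Sum>i\<in>UNIV. z (i, j)) \<le> x j)"
        by (auto simp: K2_def col_sum)
      moreover have "(\<forall>(w, f)\<in>K3. (\<Sum>b\<in>B. w b * z b) \<le> f (t, x)) \<longleftrightarrow>
          (\<forall>j<n. x j \<le> (\<Sum>i\<in>UNIV. z (i, j)))"
        by (auto simp: K3_def col_sum)
      moreover have "(\<forall>j<n. x j = (\<Sum>i\<in>UNIV. z (i, j))) \<longleftrightarrow>
          (\<forall>j<n. (\<Sum>i\<in>UNIV. z (i, j)) \<le> x j) \<and> (\<forall>j<n. x j \<le> (\<Sum>i\<in>UNIV. z (i, j)))"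
        by (auto intro: antisym)
      ultimately show "?A z \<longleftrightarrow> (\<forall>(w, f)\<in>K1 \<union> K2 \<union> K3. (\<Sum>b\<in>B. w b * z b) \<le> f (t, x))"
        by (simp only: ball_Un conj_assoc)
    qed
    also have "\<dots> \<longleftrightarrow> (\<forall>\<phi>\<in>\<Phi>. 0 \<le> \<phi> t x)" by (rule \<Phi>(3))
    finally show "in_family n t p x \<longleftrightarrow> (\<forall>\<phi>\<in>\<Phi>. 0 \<le> \<phi> t x)" .
  qed (use \<Phi> in auto)
  then show ?thesis by blast
qed

subsection \<open>Intermediate sums as iterated integrals\<close>

lemma measurable_reindex_shift:
  assumes "bij_betw e J B"
  shows "(\<lambda>y. \<lambda>b\<in>B. y (inv_into J e b) + a b)
    \<in> measurable (PiM J (\<lambda>_. lborel)) (PiM B (\<lambda>_. lborel :: real measure))"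
proof (rule measurable_restrict)
  fix b assume "b \<in> B"
  then have "inv_into J e b \<in> J" using assms by (auto simp: bij_betw_def inv_into_into)
  then have "(\<lambda>y. y (inv_into J e b)) \<in> borel_measurable (PiM J (\<lambda>_. lborel :: real measure))"
    using measurable_component_singleton[of "inv_into J e b" J "\<lambda>_. lborel :: real measure"] by simp
  then show "(\<lambda>y. y (inv_into J e b) + a b) \<in> measurable (PiM J (\<lambda>_. lborel)) lborel"
    by simp
qed

text \<open>Translation invariance of Lebesgue measure in each factor, checked on boxes. It removes
  the arbitrary base point from the coset measure and turns indexing by basis vectors into indexing
  by numbers.\<close>

lemma distr_PiM_lborel_reindex_shift:
  fixes a :: "'b \<Rightarrow> real"
  assumes "finite J" "bij_betw e J B"
  shows "distr (PiM J (\<lambda>_. lborel)) (PiM B (\<lambda>_. lborel)) (\<lambda>y. \<lambda>b\<in>B. y (inv_into J e b) + a b) =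
    PiM B (\<lambda>_. lborel :: real measure)"
proof -
  interpret J: product_sigma_finite "\<lambda>_. lborel :: real measure" by standard
  let ?T = "\<lambda>y. \<lambda>b\<in>B. y (inv_into J e b) + a b"
  have inv: "inv_into J e b \<in> J" "e (inv_into J e b) = b" if "b \<in> B" for b
    using assms(2) that by (auto simp: bij_betw_def inv_into_into f_inv_into_f)
  have inv': "e j \<in> B" "inv_into J e (e j) = j" if "j \<in> J" for j
    using assms(2) that by (auto simp: bij_betw_def)
  show ?thesis
  proof (rule J.PiM_eqI)
    show "finite B" using assms bij_betw_finite by blast
    fix A :: "'b \<Rightarrow> real set" assume A: "\<And>i. i \<in> B \<Longrightarrow> A i \<in> sets lborel"
    let ?A = "\<lambda>j. (\<lambda>s. a (e j) + s) -` A (e j)"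
    have A': "?A j \<in> sets lborel" if "j \<in> J" for j
      using measurable_sets[of "\<lambda>s. a (e j) + s" lborel lborel "A (e j)"] A[OF inv'(1)[OF that]] by simp
    have "emeasure (distr (PiM J (\<lambda>_. lborel)) (PiM B (\<lambda>_. lborel)) ?T) (PiE B A) =
        emeasure (PiM J (\<lambda>_. lborel)) (?T -` PiE B A \<inter> space (PiM J (\<lambda>_. lborel)))"
      using A \<open>finite B\<close> by (intro emeasure_distr measurable_reindex_shift[OF assms(2)] sets_PiM_I_finite) auto
    also have "?T -` PiE B A \<inter> space (PiM J (\<lambda>_. lborel)) = PiE J ?A"
    proof (rule set_eqI)
      fix y
      have "B = e ` J" using assms(2) by (simp add: bij_betw_def)
      then have "(\<forall>b\<in>B. y (inv_into J e b) + a b \<in> A b) \<longleftrightarrow> (\<forall>j\<in>J. a (e j) + y j \<in> A (e j))"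
        using inv'(2) by (simp add: add.commute)
      then show "y \<in> ?T -` PiE B A \<inter> space (PiM J (\<lambda>_. lborel)) \<longleftrightarrow> y \<in> PiE J ?A"
        by (simp add: space_PiM PiE_iff)
    qed
    also have "emeasure (PiM J (\<lambda>_. lborel)) (PiE J ?A) = (\<Prod>j\<in>J. emeasure lborel (?A j))"
      using A' assms(1) by (intro J.emeasure_PiM) auto
    also have "\<dots> = (\<Prod>j\<in>J. emeasure lborel (A (e j)))"
    proof (rule prod.cong[OF refl])
      fix j assume j: "j \<in> J"
      have "emeasure lborel (A (e j)) = emeasure (distr lborel borel ((+) (a (e j)))) (A (e j))"
        by (simp add: lborel_distr_plus)
      also have "\<dots> = emeasure lborel (?A j)"
        using A[OF inv'(1)[OF j]] by (subst emeasure_distr) auto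
      finally show "emeasure lborel (?A j) = emeasure lborel (A (e j))" ..
    qed
    also have "\<dots> = (\<Prod>b\<in>B. emeasure lborel (A b))"
      by (rule prod.reindex_bij_betw[OF assms(2)])
    finally show "emeasure (distr (PiM J (\<lambda>_. lborel)) (PiM B (\<lambda>_. lborel)) ?T) (PiE B A) =
      (\<Prod>b\<in>B. emeasure lborel (A b))" .
  qed simp
qed

text \<open>The last vectors of \<open>e\<close> enumerate the very basis that
  \<open>coset_measure\<close> selects, so no change of lattice basis enters the comparison of
  measures.\<close>

locale adapted_coordinates = lattice_coordinates e \<Lambda> for e :: "nat \<Rightarrow> 'a::euclidean_space" and \<Lambda> +
  fixes L :: "'a set" and k :: nat
  assumes k_le: "k \<le> DIM('a)"
    and subspace_L: "\<And>v. v \<in> L \<longleftrightarrow> (\<forall>j<k. coord v j = 0)"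
    and bij_B: "bij_betw e {k..<DIM('a)} (SOME B. lattice_basis B (L \<inter> \<Lambda>) L)"
begin

abbreviation M :: "nat \<Rightarrow> real measure" where "M \<equiv> coord_measure k"

definition lattice_part :: "(nat \<Rightarrow> real) \<Rightarrow> 'a" where
  "lattice_part x = (\<Sum>j<k. x j *\<^sub>R e j)"

definition subspace_part :: "(nat \<Rightarrow> real) \<Rightarrow> 'a" where
  "subspace_part y = (\<Sum>j\<in>{k..<DIM('a)}. y j *\<^sub>R e j)"

lemma comb_split: "comb x = lattice_part x + subspace_part x"
proof -
  have "{..<DIM('a)} = {..<k} \<union> {k..<DIM('a)}" using k_le by auto
  then show ?thesis
    unfolding comb_def lattice_part_def subspace_part_def by (simp add: sum.union_disjoint ivl_disj_int)
qed

lemma comb_merge: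
  "comb (merge {..<k} {k..<DIM('a)} (x, y)) = lattice_part x + subspace_part y"
  unfolding comb_split lattice_part_def subspace_part_def
  by (intro arg_cong2[of _ _ _ _ "(+)"] sum.cong) (auto simp: merge_def)

lemma lattice_part_comb: "lattice_part x = comb (\<lambda>i. if i < k then x i else 0)"
  unfolding comb_split lattice_part_def subspace_part_def by simp

lemma coord_lattice_part: "j < k \<Longrightarrow> coord (lattice_part x) j = x j"
  using k_le by (simp add: lattice_part_comb coord_comb)

lemma subspace_part_mem: "subspace_part y \<in> L"
proof -
  have "subspace_part y = comb (\<lambda>i. if i < k then 0 else y i)"
    unfolding comb_split lattice_part_def subspace_part_def by simp
  then show ?thesis using k_le by (simp add: subspace_L coord_comb)
qed

lemma subspace_L': "subspace L"
  by (simp add: subspace_def Ball_def subspace_L linear_0[OF linear_coord] linear_add[OF linear_coord] linear_cmul[OF linear_coord])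

lemma comb_measurable: "comb \<in> borel_measurable (PiM {..<DIM('a)} M)"
  unfolding comb_def by (intro borel_measurable_sum borel_measurable_scaleR measurable_coord) auto

lemma mem_coset_iff: "w \<in> {v} + L \<longleftrightarrow> w - v \<in> L"
  by (auto simp: set_plus_def) (metis add.commute diff_add_cancel)

lemma lattice_part_coset_iff: "v \<in> {lattice_part x} + L \<longleftrightarrow> (\<forall>j<k. coord v j = x j)"
  by (simp add: mem_coset_iff subspace_L linear_diff[OF linear_coord] coord_lattice_part)

text \<open>A coset of L is determined by its first k coordinates. They are integers for a lattice
  vector, and integer values padded with zeros give a lattice vector.\<close>

lemma bij_quotient_lattice:
  "bij_betw (\<lambda>x. {lattice_part x} + L) (PiE {..<k} (\<lambda>_. \<int>)) (quotient_lattice \<Lambda> L)"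
  unfolding bij_betw_def
proof
  show "inj_on (\<lambda>x. {lattice_part x} + L) (PiE {..<k} (\<lambda>_. \<int>))"
  proof (rule inj_onI)
    fix x y :: "nat \<Rightarrow> real"
    assume xy: "x \<in> PiE {..<k} (\<lambda>_. \<int>)" "y \<in> PiE {..<k} (\<lambda>_. \<int>)"
      and eq: "{lattice_part x} + L = {lattice_part y} + L"
    have "lattice_part x \<in> {lattice_part x} + L" by (simp add: lattice_part_coset_iff coord_lattice_part)
    then have "\<forall>j<k. x j = y j" unfolding eq lattice_part_coset_iff by (simp add: coord_lattice_part)
    then show "x = y" using xy by (intro PiE_ext) auto
  qed
  show "(\<lambda>x. {lattice_part x} + L) ` PiE {..<k} (\<lambda>_. \<int>) = quotient_lattice \<Lambda> L"
  proof (intro equalityI subsetI)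
    fix Y assume "Y \<in> (\<lambda>x. {lattice_part x} + L) ` PiE {..<k} (\<lambda>_. \<int>)"
    then obtain x where x: "x \<in> PiE {..<k} (\<lambda>_. \<int>)" "Y = {lattice_part x} + L" by blast
    have "lattice_part x \<in> \<Lambda>"
      using x(1) k_le by (auto simp: lattice_e coord_comb lattice_part_comb)
    then show "Y \<in> quotient_lattice \<Lambda> L" using x(2) by (auto simp: quotient_lattice_def)
  next
    fix Y assume "Y \<in> quotient_lattice \<Lambda> L"
    then obtain v where v: "v \<in> \<Lambda>" "Y = {v} + L" by (auto simp: quotient_lattice_def)
    let ?x = "restrict (coord v) {..<k}"
    have "w \<in> Y \<longleftrightarrow> w - v \<in> L" for w
      unfolding v(2) by (rule mem_coset_iff)
    then have "Y = {lattice_part ?x} + L"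
      by (auto simp: lattice_part_coset_iff subspace_L linear_diff[OF linear_coord])
    moreover have "?x \<in> PiE {..<k} (\<lambda>_. \<int>)" using v(1) k_le by (auto simp: lattice_e)
    ultimately show "Y \<in> (\<lambda>x. {lattice_part x} + L) ` PiE {..<k} (\<lambda>_. \<int>)" by blast
  qed
qed

text \<open>The base point chosen inside \<open>coset_measure\<close> differs from
  \<open>lattice_part x\<close> by an element of L, whose coordinates are absorbed by a translation
  of the integration variables.\<close>

lemma coset_integral:
  fixes h :: "'a \<Rightarrow> real"
  assumes P: "P \<in> sets borel" and h: "h \<in> borel_measurable borel"
  shows "(LINT v:P \<inter> ({lattice_part x} + L)|coset_measure \<Lambda> L ({lattice_part x} + L). h v) =
    (\<integral>y. indicator P (lattice_part x + subspace_part y) * h (lattice_part x + subspace_part y)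
      \<partial>PiM {k..<DIM('a)} (\<lambda>_. lborel))"
proof -
  define B where "B = (SOME B. lattice_basis B (L \<inter> \<Lambda>) L)"
  define Y where "Y = {lattice_part x} + L"
  define y where "y = (SOME y. y \<in> Y)"
  let ?J = "{k..<DIM('a)}"
  let ?\<nu> = "PiM B (\<lambda>_. lborel :: real measure)"
  have bij: "bij_betw e ?J B" using bij_B by (simp add: B_def)
  have "lattice_part x \<in> Y"
    by (simp add: Y_def lattice_part_coset_iff coord_lattice_part)
  then have yY: "y \<in> Y" unfolding y_def by (rule someI)
  have Y_iff: "v \<in> Y \<longleftrightarrow> v - lattice_part x \<in> L" for v
    unfolding Y_def by (rule mem_coset_iff)
  define l where "l = y - lattice_part x"
  have l: "l \<in> L" using yY Y_iff by (simp add: l_def)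
  define a where "a = (\<lambda>b. coord l (inv_into ?J e b))"
  have reindex: "(\<Sum>b\<in>B. u (inv_into ?J e b) *\<^sub>R b) = subspace_part u" for u
  proof -
    have "(\<Sum>b\<in>B. u (inv_into ?J e b) *\<^sub>R b) = (\<Sum>j\<in>?J. u (inv_into ?J e (e j)) *\<^sub>R e j)"
      by (rule sum.reindex_bij_betw[OF bij, symmetric])
    also have "\<dots> = subspace_part u"
      unfolding subspace_part_def
      by (rule sum.cong) (use bij in \<open>auto simp: bij_betw_def\<close>)
    finally show ?thesis .
  qed
  have la: "l = (\<Sum>b\<in>B. a b *\<^sub>R b)"
  proof -
    have "lattice_part (coord l) = 0" using l by (simp add: lattice_part_def subspace_L)
    then show ?thesis
      using comb_split[of "coord l"] by (simp add: a_def reindex comb_coord)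
  qed
  have sumL: "(\<Sum>b\<in>B. c b *\<^sub>R b) \<in> L" for c
  proof -
    have "(\<Sum>b\<in>B. c b *\<^sub>R b) = (\<Sum>b\<in>B. (c \<circ> e) (inv_into ?J e b) *\<^sub>R b)"
      by (rule sum.cong) (use bij in \<open>auto simp: bij_betw_def f_inv_into_f\<close>)
    then show ?thesis by (simp only: reindex subspace_part_mem)
  qed
  define g where "g = (\<lambda>c. y + (\<Sum>b\<in>B. c b *\<^sub>R b))"
  have g: "g \<in> borel_measurable ?\<nu>"
    unfolding g_def
    by (intro borel_measurable_add borel_measurable_const borel_measurable_sum borel_measurable_scaleR)
       (auto intro: measurable_component_singleton[of _ B "\<lambda>_. lborel :: real measure", simplified])
  have gY: "g c \<in> Y" for c
    unfolding Y_iff g_def using subspace_add[OF subspace_L' l sumL[of c]] by (simp add: l_def algebra_simps)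
  have Ysets: "Y \<in> sets borel"
  proof -
    have "Y = (+) (lattice_part x) ` L" by (auto simp: Y_def set_plus_def)
    then have "closed Y" using closed_subspace[OF subspace_L'] closed_translation by metis
    then show ?thesis by (rule borel_closed)
  qed
  let ?f = "\<lambda>v. indicator (P \<inter> Y) v *\<^sub>R h v"
  have f: "?f \<in> borel_measurable borel"
    using P Ysets h by (intro borel_measurable_scaleR borel_measurable_indicator) auto
  have "(LINT v:P \<inter> Y|coset_measure \<Lambda> L Y. h v) = integral\<^sup>L (distr ?\<nu> borel g) ?f"
    unfolding set_lebesgue_integral_def coset_measure_def B_def[symmetric] y_def[symmetric] Let_def g_def ..
  also have "\<dots> = (\<integral>c. ?f (g c) \<partial>?\<nu>)"
    by (rule integral_distr[OF g f])
  also have "\<dots> = (\<integral>c. indicator P (g c) * h (g c) \<partial>?\<nu>)"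
    using gY by (simp add: indicator_def)
  also have "?\<nu> = distr (PiM ?J (\<lambda>_. lborel)) ?\<nu> (\<lambda>y. \<lambda>b\<in>B. y (inv_into ?J e b) + - a b)"
    using distr_PiM_lborel_reindex_shift[OF _ bij, of "\<lambda>b. - a b"] by simp
  also have "(\<integral>c. indicator P (g c) * h (g c)
        \<partial>distr (PiM ?J (\<lambda>_. lborel)) ?\<nu> (\<lambda>y. \<lambda>b\<in>B. y (inv_into ?J e b) + - a b)) =
      (\<integral>z. indicator P (g (\<lambda>b\<in>B. z (inv_into ?J e b) + - a b)) *
        h (g (\<lambda>b\<in>B. z (inv_into ?J e b) + - a b)) \<partial>PiM ?J (\<lambda>_. lborel))"
  proof (rule integral_distr[OF measurable_reindex_shift[OF bij]])
    have "(\<lambda>v. indicator P v * h v) \<in> borel_measurable borel"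
      using P h by (intro borel_measurable_times borel_measurable_indicator) auto
    from measurable_compose[OF g this]
    show "(\<lambda>c. indicator P (g c) * h (g c)) \<in> borel_measurable ?\<nu>" .
  qed
  finally have eq: "(LINT v:P \<inter> Y|coset_measure \<Lambda> L Y. h v) =
      (\<integral>z. indicator P (g (\<lambda>b\<in>B. z (inv_into ?J e b) + - a b)) *
        h (g (\<lambda>b\<in>B. z (inv_into ?J e b) + - a b)) \<partial>PiM ?J (\<lambda>_. lborel))" .
  have "g (\<lambda>b\<in>B. z (inv_into ?J e b) + - a b) = lattice_part x + subspace_part z" for z
  proof -
    have "(\<Sum>b\<in>B. (\<lambda>b\<in>B. z (inv_into ?J e b) + - a b) b *\<^sub>R b) =
        (\<Sum>b\<in>B. z (inv_into ?J e b) *\<^sub>R b) - (\<Sum>b\<in>B. a b *\<^sub>R b)"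
      by (simp add: scaleR_diff_left sum_subtractf)
    then show ?thesis
      unfolding g_def reindex la[symmetric] by (simp add: l_def)
  qed
  with eq show ?thesis by (simp only: Y_def)
qed

text \<open>Fubini splits off the first k coordinates, whose product measure is the counting measure
  on integer vectors. As P is bounded, only finitely many cosets contribute, so the integral for
  this measure agrees with \<open>infsum\<close>.\<close>

lemma intermediate_sum_eq:
  fixes h :: "'a \<Rightarrow> real"
  assumes P: "P \<in> sets borel" "bounded P" and h: "h \<in> borel_measurable borel"
    and int: "integrable (PiM {..<DIM('a)} M) (\<lambda>x. indicator P (comb x) * h (comb x))"
  shows "intermediate_sum \<Lambda> L P h =
    (\<integral>x. indicator P (comb x) * h (comb x) \<partial>PiM {..<DIM('a)} M)"
proof -
  interpret product_sigma_finite M by (rule product_sigma_finite_coord_measure)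
  let ?I = "{..<k}" and ?J = "{k..<DIM('a)}" and ?Z = "PiE {..<k} (\<lambda>_. \<int>) :: (nat \<Rightarrow> real) set"
  have IJ: "?I \<union> ?J = {..<DIM('a)}" "?I \<inter> ?J = {}" using k_le by auto
  define G where "G = (\<lambda>x. \<integral>y. indicator P (lattice_part x + subspace_part y) *
    h (lattice_part x + subspace_part y) \<partial>PiM ?J (\<lambda>_. lborel))"
  have PJ: "PiM ?J M = PiM ?J (\<lambda>_. lborel)"
    by (rule PiM_cong) (auto simp: coord_measure_def)
  have "countable (\<int> :: real set)" by (simp add: Ints_def)
  then have PI: "PiM ?I M = count_space ?Z"
    using count_space_PiM_finite[of ?I "\<lambda>_. \<int> :: real set"] PiM_cong[of ?I ?I M "\<lambda>_. count_space \<int>"]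
    by (simp add: coord_measure_def)
  have "(\<integral>x. indicator P (comb x) * h (comb x) \<partial>PiM {..<DIM('a)} M) =
      (\<integral>x. (\<integral>y. indicator P (comb (merge ?I ?J (x, y))) * h (comb (merge ?I ?J (x, y)))
        \<partial>PiM ?J M) \<partial>PiM ?I M)"
    using product_integral_fold[OF IJ(2), of "\<lambda>x. indicator P (comb x) * h (comb x)"] int
    unfolding IJ(1) by simp
  also have "\<dots> = (\<integral>x. G x \<partial>count_space ?Z)"
    unfolding comb_merge PJ PI G_def ..
  also have "\<dots> = infsum G ?Z"
  proof -
    obtain R where R: "\<And>v j. v \<in> P \<Longrightarrow> \<bar>coord v j\<bar> \<le> R j"
    proof -
      have "\<exists>R. \<forall>v\<in>P. \<bar>coord v j\<bar> \<le> R" for j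
        using bounded_linear_image[OF P(2), of "\<lambda>v. coord v j"] linear_coord
        by (auto simp: bounded_iff linear_conv_bounded_linear)
      then show thesis using that by metis
    qed
    have sub: "{x \<in> ?Z. G x \<noteq> 0} \<subseteq> PiE ?I (\<lambda>j. {-R j..R j} \<inter> \<int>)"
    proof
      fix x assume x: "x \<in> {x \<in> ?Z. G x \<noteq> 0}"
      have "\<exists>y. lattice_part x + subspace_part y \<in> P"
      proof (rule ccontr)
        assume "\<nexists>y. lattice_part x + subspace_part y \<in> P"
        then have "G x = 0" by (simp add: G_def)
        with x show False by simp
      qed
      then obtain y where y: "lattice_part x + subspace_part y \<in> P" by blast
      have "\<bar>x j\<bar> \<le> R j" if "j < k" for j
        using R[OF y, of j] that subspace_part_mem[of y]
        by (simp add: linear_add[OF linear_coord] coord_lattice_part subspace_L)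
      with x show "x \<in> PiE ?I (\<lambda>j. {-R j..R j} \<inter> \<int>)"
        by (force simp: PiE_iff abs_le_iff)
    qed
    have fin: "finite {x \<in> ?Z. G x \<noteq> 0}"
      by (intro finite_subset[OF sub] finite_PiE finite_Icc_Int_Ints) auto
    have "(\<integral>x. G x \<partial>count_space ?Z) = sum G {x \<in> ?Z. G x \<noteq> 0}"
      using lebesgue_integral_count_space_finite_support[OF fin] by simp
    also have "\<dots> = infsum G {x \<in> ?Z. G x \<noteq> 0}" using fin by simp
    also have "\<dots> = infsum G ?Z" by (rule infsum_cong_neutral) auto
    finally show ?thesis .
  qed
  also have "\<dots> = infsum (\<lambda>x. LINT v:P \<inter> ({lattice_part x} + L)|coset_measure \<Lambda> L ({lattice_part x} + L). h v) ?Z"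
    unfolding G_def by (intro infsum_cong coset_integral[symmetric] P h)
  also have "\<dots> = intermediate_sum \<Lambda> L P h"
    unfolding intermediate_sum_def
    by (rule infsum_reindex_bij_betw[OF bij_quotient_lattice])
  finally show ?thesis ..
qed

end

text \<open>The selected basis of L \<inter> \<Lambda> is extended to a basis of \<Lambda>, and the
  added vectors are listed before it. The elimination runs from the highest index downwards, so this
  order puts the directions of L first.\<close>

lemma ex_adapted_coordinates:
  fixes \<Lambda> L :: "'a::euclidean_space set"
  assumes "lattice_in \<Lambda> UNIV" "rational_subspace \<Lambda> L"
  shows "\<exists>e k. adapted_coordinates e \<Lambda> L k"
proof -
  obtain A where A: "lattice_basis A \<Lambda> UNIV" using assms(1) by (auto simp: lattice_in_def)
  define B where "B = (SOME B. lattice_basis B (L \<inter> \<Lambda>) L)"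
  have B: "lattice_basis B (L \<inter> \<Lambda>) L"
    unfolding B_def using assms(2) by (auto simp: rational_subspace_def lattice_in_def intro: someI)
  obtain C where C: "B \<subseteq> C" "lattice_basis C \<Lambda> UNIV" using lattice_basis_extend[OF A B] by blast
  have finC: "finite C" and indC: "independent C" and spanC: "span C = UNIV"
    using C(2) lattice_basis_finite by (auto simp: lattice_basis_def)
  have spanB: "span B = L" using B by (simp add: lattice_basis_def)
  define k where "k = card (C - B)"
  have cardC: "card C = DIM('a)"
    using indC spanC by (metis dim_UNIV dim_span_eq_card_independent)
  have cardB: "card B = DIM('a) - k" and k_le: "k \<le> DIM('a)"
    using finC C(1) cardC card_mono[OF finC C(1)]
    by (auto simp: k_def card_Diff_subset finite_subset)
  obtain f where f: "bij_betw f {..<k} (C - B)"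
    using finC ex_bij_betw_nat_finite[of "C - B"] by (auto simp: k_def atLeast0LessThan)
  obtain g where g: "bij_betw g {..<DIM('a) - k} B"
    using finite_subset[OF C(1) finC] ex_bij_betw_nat_finite[of B] by (auto simp: cardB atLeast0LessThan)
  define e where "e = (\<lambda>j. if j < k then f j else g (j - k))"
  have e1: "bij_betw e {..<k} (C - B)"
    using f by (rule bij_betw_cong[THEN iffD1, rotated]) (simp add: e_def)
  have "bij_betw (\<lambda>j. j - k) {k..<DIM('a)} {..<DIM('a) - k}"
    by (rule bij_betw_byWitness[of _ "\<lambda>j. j + k"]) auto
  from bij_betw_trans[OF this g] have e2: "bij_betw e {k..<DIM('a)} B"
    by (rule bij_betw_cong[THEN iffD1, rotated]) (simp add: e_def)
  have split: "{..<DIM('a)} = {..<k} \<union> {k..<DIM('a)}" using k_le by auto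
  have "bij_betw e ({..<k} \<union> {k..<DIM('a)}) ((C - B) \<union> B)"
    by (rule bij_betw_combine[OF e1 e2]) auto
  then have e: "bij_betw e {..<DIM('a)} C"
    unfolding split using C(1) by (simp add: Un_absorb2)
  then have eC: "e ` {..<DIM('a)} = C" and inj: "inj_on e {..<DIM('a)}" by (auto simp: bij_betw_def)
  interpret coordinates e
    using inj indC eC by unfold_locales auto
  have lat: "v \<in> \<Lambda> \<longleftrightarrow> (\<forall>j<DIM('a). coord v j \<in> \<int>)" for v
  proof
    assume "v \<in> \<Lambda>"
    then obtain c :: "'a \<Rightarrow> int" where "v = (\<Sum>b\<in>C. of_int (c b) *\<^sub>R b)"
      unfolding lattice_basis_mem[OF C(2)] by blast
    also have "\<dots> = comb (\<lambda>j. of_int (c (e j)))"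
      unfolding comb_def by (rule sum.reindex_bij_betw[OF e, symmetric])
    finally show "\<forall>j<DIM('a). coord v j \<in> \<int>" by (simp add: coord_comb)
  next
    assume int: "\<forall>j<DIM('a). coord v j \<in> \<int>"
    define c where "c = (\<lambda>b. \<lfloor>coord v (inv_into {..<DIM('a)} e b)\<rfloor>)"
    have "v = comb (coord v)" by (simp add: comb_coord)
    also have "\<dots> = (\<Sum>j<DIM('a). of_int (c (e j)) *\<^sub>R e j)"
      unfolding comb_def
      by (rule sum.cong) (use int inj in \<open>auto simp: c_def elim!: Ints_cases\<close>)
    also have "\<dots> = (\<Sum>b\<in>C. of_int (c b) *\<^sub>R b)"
      by (rule sum.reindex_bij_betw[OF e])
    finally show "v \<in> \<Lambda>" unfolding lattice_basis_mem[OF C(2)] by blast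
  qed
  have L: "v \<in> L \<longleftrightarrow> (\<forall>j<k. coord v j = 0)" for v
  proof
    assume "v \<in> L"
    then obtain u where "v = (\<Sum>b\<in>B. u b *\<^sub>R b)"
      using finite_subset[OF C(1) finC] by (auto simp: spanB[symmetric] span_finite)
    also have "\<dots> = (\<Sum>j\<in>{k..<DIM('a)}. u (e j) *\<^sub>R e j)"
      by (rule sum.reindex_bij_betw[OF e2, symmetric])
    also have "\<dots> = comb (\<lambda>j. if j < k then 0 else u (e j))"
      unfolding comb_def split by (simp add: sum.union_disjoint ivl_disj_int)
    finally show "\<forall>j<k. coord v j = 0" using k_le by (simp add: coord_comb)
  next
    assume zero: "\<forall>j<k. coord v j = 0"
    have "v = comb (coord v)" by (simp add: comb_coord)
    also have "\<dots> = (\<Sum>j\<in>{k..<DIM('a)}. coord v j *\<^sub>R e j)"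
      unfolding comb_def split using zero by (simp add: sum.union_disjoint ivl_disj_int)
    also have "\<dots> \<in> L"
      unfolding spanB[symmetric] using e2
      by (intro span_sum span_scale span_base) (auto simp: bij_betw_def)
    finally show "v \<in> L" .
  qed
  have "adapted_coordinates e \<Lambda> L k"
    using lat L k_le e2 unfolding B_def by unfold_locales auto
  then show ?thesis by blast
qed

section \<open>Minkowski sums of polytopes and passage to the closed orthant\<close>

lemma mem_minkowski_combination:
  fixes P :: "'q::finite \<Rightarrow> 'a::real_vector set"
  shows "v \<in> (\<Sum>i\<in>UNIV. (\<lambda>x. t $ i *\<^sub>R x) ` P i) \<longleftrightarrow>
    (\<exists>y. (\<forall>i. y i \<in> P i) \<and> v = (\<Sum>i\<in>UNIV. t $ i *\<^sub>R y i))"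
proof
  assume "v \<in> (\<Sum>i\<in>UNIV. (\<lambda>x. t $ i *\<^sub>R x) ` P i)"
  then obtain s where s: "v = sum s UNIV" "\<forall>i. s i \<in> (\<lambda>x. t $ i *\<^sub>R x) ` P i"
    by (auto simp: set_sum_alt)
  then have "\<forall>i. \<exists>x. x \<in> P i \<and> s i = t $ i *\<^sub>R x" by blast
  from choice[OF this] obtain y where "\<And>i. y i \<in> P i" "\<And>i. s i = t $ i *\<^sub>R y i" by blast
  then show "\<exists>y. (\<forall>i. y i \<in> P i) \<and> v = (\<Sum>i\<in>UNIV. t $ i *\<^sub>R y i)"
    using s(1) by auto
next
  assume "\<exists>y. (\<forall>i. y i \<in> P i) \<and> v = (\<Sum>i\<in>UNIV. t $ i *\<^sub>R y i)"
  then obtain y where "\<And>i. y i \<in> P i" "v = (\<Sum>i\<in>UNIV. t $ i *\<^sub>R y i)" by blast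
  then show "v \<in> (\<Sum>i\<in>UNIV. (\<lambda>x. t $ i *\<^sub>R x) ` P i)"
    by (auto simp: set_sum_alt intro!: exI[of _ "\<lambda>i. t $ i *\<^sub>R y i"])
qed

lemma compact_set_sum:
  fixes S :: "'b \<Rightarrow> 'a::real_normed_vector set"
  assumes "finite I" "\<And>i. i \<in> I \<Longrightarrow> compact (S i)"
  shows "compact (\<Sum>i\<in>I. S i)"
  using assms
proof (induction I rule: finite_induct)
  case empty
  show ?case by (simp add: set_zero)
next
  case (insert i I)
  have "S i + (\<Sum>i\<in>I. S i) = {x + y | x y. x \<in> S i \<and> y \<in> (\<Sum>i\<in>I. S i)}"
    by (auto simp: set_plus_def)
  moreover have "compact \<dots>"
    using insert by (intro compact_sums) auto
  ultimately show ?case using insert.hyps by simp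
qed

text \<open>The coefficients of h may be irrational: they enter as constant factors, and only the
  coordinates themselves have to be rational forms.\<close>

lemma (in coordinates) qpoly_real_polynomial_function:
  assumes "real_polynomial_function h"
  shows "qpoly k DIM('a) (\<lambda>(t::'e::euclidean_space) x. h (comb x))"
  using assms
proof (induction rule: real_polynomial_function.induct)
  case (linear f)
  have "f (comb x) = (\<Sum>j<DIM('a). f (e j) * x j)" for x
    unfolding comb_def
    by (simp add: linear_sum[OF bounded_linear.linear[OF linear]] linear_cmul[OF bounded_linear.linear[OF linear]]
        mult.commute)
  moreover have "qpoly k DIM('a) (\<lambda>(t::'e) x. \<Sum>j<DIM('a). f (e j) * x j)"
  proof (intro qpoly_sum qpoly_scale qpoly.form)
    fix j assume "j \<in> {..<DIM('a)}"
    then show "rational_form DIM('a) (\<lambda>(t::'e) x. x j)"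
      unfolding rational_form_def
      by (intro exI[of _ 0] exI[of _ "\<lambda>i. if i = j then 1 else 0"]) (auto simp: mult_delta_left)
  qed simp
  ultimately show ?case by simp
qed (auto intro: qpoly.const qpoly.add qpoly.mult)

context adapted_coordinates
begin

text \<open>Adding a large cube with an infinitesimal coefficient makes all coefficients positive and lets
  the perturbed polytopes decrease to the given one, so that the positive case extends to the
  boundary of the orthant by dominated convergence.\<close>

lemma intermediate_sum_semi_quasi_polynomial:
  fixes P :: "'q::finite \<Rightarrow> 'a set"
  assumes P: "\<And>i. semi_rational_polytope \<Lambda> (P i)" and h: "real_polynomial_function h"
  shows "\<exists>E :: real ^ 'q \<Rightarrow> real. semi_quasi_polynomial E \<and> (\<forall>t. (\<forall>i. 0 \<le> t $ i) \<longrightarrow>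
    intermediate_sum \<Lambda> L (\<Sum>i\<in>UNIV. (\<lambda>x. t $ i *\<^sub>R x) ` P i) h = E t)"
proof -
  let ?N = "DIM('a)" and ?M = "PiM {..<DIM('a)} M"
  have compactP: "compact (P i)" for i
    using P[of i] by (auto simp: semi_rational_polytope_def intro: polytope_imp_compact)
  have "bounded (\<Union>i. P i)"
    using compactP compact_imp_bounded by (intro bounded_UN) auto
  then have "\<exists>R. \<forall>v\<in>(\<Union>i. P i). \<bar>coord v j\<bar> \<le> R" for j
    using bounded_linear_image[of "\<Union>i. P i" "\<lambda>v. coord v j"] linear_coord
    by (auto simp: bounded_iff linear_conv_bounded_linear)
  then obtain r where r: "\<And>i v j. v \<in> P i \<Longrightarrow> \<bar>coord v j\<bar> \<le> r j" by (metis UN_I UNIV_I)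
  define R where "R = (\<Sum>j<?N. \<bar>r j\<bar>)"
  have R: "\<bar>coord v j\<bar> \<le> R" if "v \<in> P i" "j < ?N" for i v j
  proof -
    have "\<bar>r j\<bar> \<le> R" unfolding R_def by (rule member_le_sum) (use that in auto)
    with r[OF that(1), of j] show ?thesis by linarith
  qed
  have R0: "0 \<le> R" by (simp add: R_def sum_nonneg)
  \<comment> \<open>Half the side of the cube, large enough to contain minus any sum of points taken
    one from each summand.\<close>
  define c where "c = real CARD('q) * R"
  \<comment> \<open>The index \<open>None\<close> stands for the auxiliary cube, given directly in
    coordinates.\<close>
  define p :: "'q option \<Rightarrow> (nat \<Rightarrow> real) set" where
    "p = (\<lambda>k. case k of None \<Rightarrow> {y. \<forall>j<?N. \<bar>y j\<bar> \<le> c} | Some i \<Rightarrow> {y. comb y \<in> P i})"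
  have "\<exists>K. finite K \<and> (\<forall>(u, b)\<in>K. \<forall>j. u j \<in> \<rat>) \<and>
      (\<forall>y. y \<in> p k \<longleftrightarrow> (\<forall>(u, b)\<in>K. (\<Sum>j<?N. u j * y j) \<le> b))" for k
  proof (cases k)
    case (Some i)
    obtain K where "finite K" "\<forall>(u, b)\<in>K. \<forall>j. u j \<in> \<rat>"
      "\<forall>v. v \<in> P i \<longleftrightarrow> (\<forall>(u, b)\<in>K. functional u v \<le> b)"
      using rational_cut_semi_rational_polytope[OF P[of i]] unfolding rational_cut_def by blast
    then show ?thesis
      by (intro exI[of _ K]) (simp add: p_def Some functional_comb)
  next
    case None
    let ?u = "\<lambda>s j i. if i = j then s else (0::real)"
    let ?K = "(\<lambda>j. (?u 1 j, c)) ` {..<?N} \<union> (\<lambda>j. (?u (- 1) j, c)) ` {..<?N}"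
    have sum: "(\<Sum>i<?N. ?u s j i * y i) = s * y j" if "j < ?N" for s j y
      using that by (simp add: mult_delta_left)
    have "(\<forall>(u, b)\<in>?K. (\<Sum>i<?N. u i * y i) \<le> b) \<longleftrightarrow>
        (\<forall>j<?N. (\<Sum>i<?N. ?u 1 j i * y i) \<le> c) \<and> (\<forall>j<?N. (\<Sum>i<?N. ?u (- 1) j i * y i) \<le> c)" for y
      by (simp only: ball_Un ball_simps prod.case) (simp only: Ball_def lessThan_iff)
    then have "(\<forall>(u, b)\<in>?K. (\<Sum>i<?N. u i * y i) \<le> b) \<longleftrightarrow> (\<forall>j<?N. \<bar>y j\<bar> \<le> c)" for y
      by (auto simp: sum abs_le_iff)
    then have "\<forall>y. y \<in> p k \<longleftrightarrow> (\<forall>(u, b)\<in>?K. (\<Sum>j<?N. u j * y j) \<le> b)"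
      by (simp only: p_def None option.case mem_Collect_eq) blast
    moreover have "\<forall>(u, b)\<in>?K. \<forall>j. u j \<in> \<rat>" "finite ?K" by auto
    ultimately show ?thesis by blast
  qed
  from cut_out_minkowski[of p ?N, OF this] obtain \<Phi> where \<Phi>: "cut_out ?N p \<Phi>" by blast
  have bound: "\<bar>y j\<bar> \<le> R + c" if "y \<in> p k" "j < ?N" for k y j
  proof (cases k)
    case None
    then show ?thesis using that R0 by (auto simp: p_def) 
  next
    case (Some i)
    then have "comb y \<in> P i" using that by (simp add: p_def)
    from R[OF this that(2)] that(2) R0 show ?thesis by (simp add: coord_comb c_def add_increasing2)
  qed
  then have bdd: "coord_bounded ?N p" unfolding coord_bounded_def by blast
  define f where "f = (\<lambda>(t :: real ^ 'q option) x. h (comb x))"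
  have f: "qpoly k ?N f" unfolding f_def by (rule qpoly_real_polynomial_function[OF h])
  from family_integral[OF \<Phi> bdd f] obtain E' where E': "semi_quasi_polynomial E'"
    "\<And>t. (\<forall>i. 0 < t $ i) \<Longrightarrow>
      has_bochner_integral ?M (\<lambda>x. f t x * of_bool (in_family ?N t p x)) (E' t)" by blast
  \<comment> \<open>\<open>A t\<close> gives the cube the coefficient 0; adding \<epsilon> times the
    all-ones vector \<open>w\<close> then yields t_i + \<epsilon> for the polytopes and \<epsilon>
    for the cube.\<close>
  define A :: "real ^ 'q \<Rightarrow> real ^ 'q option" where
    "A = (\<lambda>t. \<chi> k. case k of None \<Rightarrow> 0 | Some i \<Rightarrow> t $ i)"
  define w :: "real ^ 'q option" where "w = (\<chi> k. 1)"
  have "linear A"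
    by (rule linearI) (auto simp: A_def vec_eq_iff split: option.split)
  from semi_quasi_polynomial_ray_limit[OF E'(1) this, of w] obtain E where
    E: "semi_quasi_polynomial E" "\<And>t. ((\<lambda>\<epsilon>. E' (A t + \<epsilon> *\<^sub>R w)) \<longlongrightarrow> E t) (at_right 0)" by blast
  have "intermediate_sum \<Lambda> L (\<Sum>i\<in>UNIV. (\<lambda>x. t $ i *\<^sub>R x) ` P i) h = E t"
    if t: "\<forall>i. 0 \<le> t $ i" for t
  proof -
    define Pt where "Pt = (\<Sum>i\<in>UNIV. (\<lambda>x. t $ i *\<^sub>R x) ` P i)"
    have cPt: "compact Pt"
      unfolding Pt_def by (intro compact_set_sum compact_scaling compactP) simp
    define \<epsilon> where "\<epsilon> = (\<lambda>m. inverse (real (Suc m)))"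
    have eps: "0 < \<epsilon> m" "\<epsilon> m \<le> 1" for m by (auto simp: \<epsilon>_def inverse_le_1_iff)
    have eps_lim: "\<epsilon> \<longlonglongrightarrow> 0" unfolding \<epsilon>_def by (rule LIMSEQ_inverse_real_of_nat)
    define T where "T = (\<lambda>m. A t + \<epsilon> m *\<^sub>R w)"
    have T: "T m $ None = \<epsilon> m" "T m $ Some i = t $ i + \<epsilon> m" for m i
      by (auto simp: T_def A_def w_def)
    have Tpos: "\<forall>k. 0 < T m $ k" for m
    proof
      fix k show "0 < T m $ k" using t eps[of m] by (cases k) (auto simp: T add_nonneg_pos)
    qed
    have sum_option: "(\<Sum>k\<in>UNIV. F k) = F None + (\<Sum>i\<in>UNIV. F (Some i))" for F :: "'q option \<Rightarrow> 'b::comm_monoid_add"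
      by (simp add: UNIV_option_conv sum.reindex)
    have inside: "in_family ?N (T m) p x" if x: "comb x \<in> Pt" for m x
    proof -
      obtain v where v: "\<And>i. v i \<in> P i" "comb x = (\<Sum>i\<in>UNIV. t $ i *\<^sub>R v i)"
        using x unfolding Pt_def mem_minkowski_combination by blast
      \<comment> \<open>The cube component is minus the sum of the chosen points, so it cancels the
        excess produced by raising every coefficient by \<epsilon>.\<close>
      define y where "y = (\<lambda>k. case k of None \<Rightarrow> (\<lambda>j. - (\<Sum>i\<in>UNIV. coord (v i) j)) | Some i \<Rightarrow> coord (v i))"
      have "y k \<in> p k" for k
      proof (cases k)
        case None
        have "\<bar>\<Sum>i\<in>UNIV. coord (v i) j\<bar> \<le> c" if "j < ?N" for j
        proof -
          have "\<bar>\<Sum>i\<in>UNIV. coord (v i) j\<bar> \<le> (\<Sum>i\<in>(UNIV::'q set). R)"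
            using R[OF v(1) that] by (intro order_trans[OF sum_abs] sum_mono)
          then show ?thesis by (simp add: c_def)
        qed
        then show ?thesis by (simp add: None y_def p_def)
      qed (simp add: y_def p_def comb_coord v)
      moreover have "x j = (\<Sum>k\<in>UNIV. T m $ k * y k j)" if "j < ?N" for j
      proof -
        have "x j = coord (\<Sum>i\<in>UNIV. t $ i *\<^sub>R v i) j" using that by (simp add: v(2)[symmetric] coord_comb)
        also have "\<dots> = (\<Sum>i\<in>UNIV. t $ i * coord (v i) j)"
          by (simp add: linear_sum[OF linear_coord] linear_cmul[OF linear_coord])
        finally show ?thesis
          by (simp add: sum_option T y_def distrib_right sum.distrib sum_distrib_left)
      qed
      ultimately show ?thesis unfolding in_family_def by blast
    qed
    define D where "D = (\<Sum>j<?N. (R + c) * norm (e j))"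
    \<comment> \<open>The perturbation is \<epsilon> times a sum of one point from each of the
      CARD('q) + 1 sets, each of norm at most \<open>D\<close>.\<close>
    define C where "C = real (CARD('q) + 1) * D"
    have norm_D: "norm (comb y) \<le> D" if "y \<in> p k" for y k
      unfolding comb_def D_def
      by (intro sum_norm_le) (use bound[OF that] in \<open>auto intro: mult_right_mono\<close>)
    have near: "\<exists>u\<in>Pt. norm (comb x - u) \<le> \<epsilon> m * C" if x: "in_family ?N (T m) p x" for m x
    proof -
      obtain y where y: "\<And>k. y k \<in> p k" "\<And>j. j < ?N \<Longrightarrow> x j = (\<Sum>k\<in>UNIV. T m $ k * y k j)"
        using x unfolding in_family_def by blast
      have "comb x = comb (\<lambda>j. \<Sum>k\<in>UNIV. T m $ k * y k j)"
        by (rule comb_cong) (rule y(2))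
      also have "\<dots> = (\<Sum>k\<in>UNIV. T m $ k *\<^sub>R comb (y k))" by (rule comb_sum)
      also have "\<dots> = (\<Sum>i\<in>UNIV. t $ i *\<^sub>R comb (y (Some i))) + \<epsilon> m *\<^sub>R (\<Sum>k\<in>UNIV. comb (y k))"
        by (simp add: sum_option T scaleR_add_left sum.distrib scaleR_sum_right scaleR_add_right)
      finally have eq: "comb x - (\<Sum>i\<in>UNIV. t $ i *\<^sub>R comb (y (Some i))) = \<epsilon> m *\<^sub>R (\<Sum>k\<in>UNIV. comb (y k))"
        by simp
      have "norm (\<Sum>k\<in>UNIV. comb (y k)) \<le> (\<Sum>k\<in>(UNIV::'q option set). D)"
        using norm_D[OF y(1)] by (intro sum_norm_le)
      also have "\<dots> = C" by (simp add: C_def)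
      finally have "norm (comb x - (\<Sum>i\<in>UNIV. t $ i *\<^sub>R comb (y (Some i)))) \<le> \<epsilon> m * C"
        unfolding eq using eps[of m] by simp
      moreover have "comb (y (Some i)) \<in> P i" for i using y(1)[of "Some i"] by (simp add: p_def)
      then have "(\<Sum>i\<in>UNIV. t $ i *\<^sub>R comb (y (Some i))) \<in> Pt"
        unfolding Pt_def mem_minkowski_combination by (intro exI[of _ "\<lambda>i. comb (y (Some i))"]) simp
      ultimately show ?thesis by blast
    qed
    \<comment> \<open>Points of \<open>Pt\<close> belong to every perturbed family. A point outside
      the closed set \<open>Pt\<close> has positive distance from it and leaves the families once
      \<open>\<epsilon> m * C\<close> is below this distance.\<close>
    have lim: "(\<lambda>m. f (T m) x * of_bool (in_family ?N (T m) p x)) \<longlonglongrightarrow> indicator Pt (comb x) * h (comb x)" for x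
    proof (cases "comb x \<in> Pt")
      case True
      then show ?thesis using inside by (simp add: f_def)
    next
      case False
      have "open (- Pt)" using compact_imp_closed[OF cPt] by (simp add: open_Compl)
      with False obtain d where d: "d > 0" "ball (comb x) d \<subseteq> - Pt" by (auto elim: openE)
      have "(\<lambda>m. \<epsilon> m * C) \<longlonglongrightarrow> 0 * C" by (intro tendsto_mult eps_lim tendsto_const)
      then have "eventually (\<lambda>m. \<epsilon> m * C < d) sequentially" using d(1) by (intro order_tendstoD(2)) auto
      then have "eventually (\<lambda>m. f (T m) x * of_bool (in_family ?N (T m) p x) = 0) sequentially"
      proof eventually_elim
        case (elim m)
        have "\<not> in_family ?N (T m) p x"
        proof
          assume "in_family ?N (T m) p x"
          from near[OF this] obtain u where "u \<in> Pt" "norm (comb x - u) \<le> \<epsilon> m * C" by blast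
          with elim have "u \<in> ball (comb x) d" by (simp add: dist_norm)
          with d(2) \<open>u \<in> Pt\<close> show False by blast
        qed
        then show ?case by simp
      qed
      then show ?thesis using False by (simp add: tendsto_eventually)
    qed
    \<comment> \<open>The coefficients \<open>T m\<close> are largest at m = 0, so this bound holds
      for all m and supplies the box for the dominating function.\<close>
    define R1 where "R1 = (\<Sum>k\<in>UNIV. (T 0 $ k) * (R + c))"
    have R1: "\<bar>x j\<bar> \<le> R1" if x: "in_family ?N (T m) p x" "j < ?N" for m x j
    proof -
      obtain y where y: "\<And>k. y k \<in> p k" "x j = (\<Sum>k\<in>UNIV. T m $ k * y k j)"
        using x unfolding in_family_def by blast
      have T_le: "T m $ k \<le> T 0 $ k" for k
        using eps(2)[of m] by (cases k) (auto simp: T \<epsilon>_def)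
      have "\<bar>T m $ k * y k j\<bar> \<le> T 0 $ k * (R + c)" for k
        unfolding abs_mult abs_of_pos[OF Tpos[rule_format]]
        using bound[OF y(1) x(2), of k] T_le[of k] Tpos[of 0]
        by (intro mult_mono) (auto intro: less_imp_le)
      then show ?thesis
        unfolding y(2) R1_def by (intro order_trans[OF sum_abs] sum_mono)
    qed
    have box_int: "integrable ?M (\<lambda>x. f 0 x * of_bool (\<forall>j<?N. \<bar>x j\<bar> \<le> R1))"
    proof (rule integrable_on_coord_bounded[OF f, where R = R1])
      have "{x \<in> space ?M. \<forall>j\<in>{..<?N}. \<bar>x j\<bar> \<le> R1} \<in> sets ?M"
      proof (rule sets.sets_Collect_finite_All)
        fix j assume "j \<in> {..<?N}"
        then have "(\<lambda>x. x j) \<in> borel_measurable ?M" by (intro measurable_coord) simp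
        then show "{x \<in> space ?M. \<bar>x j\<bar> \<le> R1} \<in> sets ?M"
          by (intro borel_measurable_le borel_measurable_abs borel_measurable_const)
      qed simp
      then show "{x \<in> space ?M. \<forall>j<?N. \<bar>x j\<bar> \<le> R1} \<in> sets ?M"
        unfolding Ball_def lessThan_iff .
    qed blast
    have h_borel: "h \<in> borel_measurable borel"
      using continuous_on_polymonial_function[of h UNIV] h
      by (intro borel_measurable_continuous_onI) (simp add: real_polynomial_function_eq)
    have Pt_borel: "Pt \<in> sets borel" using compact_imp_closed[OF cPt] by (rule borel_closed)
    have meas: "(\<lambda>x. indicator Pt (comb x) * h (comb x)) \<in> borel_measurable ?M"
    proof -
      have "(\<lambda>v. indicator Pt v * h v) \<in> borel_measurable borel"
        using Pt_borel h_borel by (intro borel_measurable_times borel_measurable_indicator)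
      from measurable_compose[OF comb_measurable this] show ?thesis .
    qed
    have hb: "has_bochner_integral ?M (\<lambda>x. f (T m) x * of_bool (in_family ?N (T m) p x)) (E' (T m))" for m
      by (rule E'(2)[OF Tpos])
    have dom: "norm (f (T m) x * of_bool (in_family ?N (T m) p x)) \<le>
        \<bar>f 0 x * of_bool (\<forall>j<?N. \<bar>x j\<bar> \<le> R1)\<bar>" for m x
      using R1[of m x] by (auto simp: f_def of_bool_def)
    have meas_m: "(\<lambda>x. f (T m) x * of_bool (in_family ?N (T m) p x)) \<in> borel_measurable ?M" for m
      using hb[of m] by (auto simp: has_bochner_integral_iff)
    note dc = meas meas_m integrable_abs[OF box_int] AE_I2[OF lim] AE_I2[OF dom]
    have int: "integrable ?M (\<lambda>x. indicator Pt (comb x) * h (comb x))"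
      by (rule integrable_dominated_convergence[OF dc])
    have "(\<lambda>m. \<integral>x. f (T m) x * of_bool (in_family ?N (T m) p x) \<partial>?M) \<longlonglongrightarrow>
        (\<integral>x. indicator Pt (comb x) * h (comb x) \<partial>?M)"
      by (rule integral_dominated_convergence[OF dc])
    then have "(\<lambda>m. E' (T m)) \<longlonglongrightarrow> (\<integral>x. indicator Pt (comb x) * h (comb x) \<partial>?M)"
      by (simp only: has_bochner_integral_integral_eq[OF hb])
    moreover have "(\<lambda>m. E' (T m)) \<longlonglongrightarrow> E t"
    proof -
      have "filterlim \<epsilon> (at_right 0) sequentially"
        using eps(1) eps_lim less_imp_neq[OF eps(1), THEN not_sym]
        by (auto simp: filterlim_at intro!: always_eventually)
      from filterlim_compose[OF E(2) this] show ?thesis by (simp add: T_def)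
    qed
    ultimately have "(\<integral>x. indicator Pt (comb x) * h (comb x) \<partial>?M) = E t"
      by (rule LIMSEQ_unique)
    with intermediate_sum_eq[OF Pt_borel compact_imp_bounded[OF cPt] h_borel int]
    show ?thesis by (simp add: Pt_def)
  qed
  with E(1) show ?thesis by blast
qed

end

theorem theorem2p37:
  fixes \<Lambda> L :: "'a::euclidean_space set"
    and P :: "'q::finite \<Rightarrow> 'a set"
    and h :: "'a \<Rightarrow> real"
  assumes "lattice_in \<Lambda> UNIV"
    and "\<And>i. semi_rational_polytope \<Lambda> (P i)"
    and "rational_subspace \<Lambda> L"
    and "real_polynomial_function h"
  shows "\<exists>E :: real ^ 'q \<Rightarrow> real. semi_quasi_polynomial E \<and>
           (\<forall>t. (\<forall>i. 0 \<le> t $ i) \<longrightarrow>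
                intermediate_sum \<Lambda> L (\<Sum>i\<in>UNIV. (\<lambda>x. t $ i *\<^sub>R x) ` P i) h = E t)"
proof -
  obtain e k where "adapted_coordinates e \<Lambda> L k"
    using ex_adapted_coordinates[OF assms(1,3)] by blast
  then show ?thesis
    using assms(2,4) by (rule adapted_coordinates.intermediate_sum_semi_quasi_polynomial)
qed

end
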